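(* Let $\sigma:\mathbb{R}^d\to\mathbb{R}^d\otimes\mathbb{R}^m$ and $b:\mathbb{R}^d\to\mathbb{R}^d$ be continuous. Suppose there exist constants $C>0$, $\delta_o\in(0,1]$ and a strictly positive $C^1$ function $r:(0,\delta_o]\to\mathbb{R}_+$ with (i) $\lim_{s\to0}r(s)=+\infty$, (ii) $\int_0^{\delta_o}\frac{ds}{s\,r(s)}=+\infty$, (iii) $\lim_{s\to0}\frac{s\,r'(s)}{r(s)}=0$, such that for all $x\ne y$ in $\mathbb{R}^d$ with $|x-y|\le\delta_o$, $$\|\sigma(x)-\sigma(y)\|^2\le C|x-y|^2\,r(|x-y|^2),\qquad |b(x)-b(y)|\le C|x-y|\,r(|x-y|^2).$$ Assume moreover that the stochastic differential equation $$dX(t)=\sigma(X(t))\,dW_t+b(X(t))\,dt,\qquad X(0)=x_o$$ has no explosion, and denote by $X_t(x_o,w)$ its unique strong solution starting from $x_o$. If $x_o\neq y_o$, then almost surely $X_t(x_o,w)\neq X_t(y_o,w)$ for all $t>0$.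
   Context: $(W_t)_{t\ge0}$ is a standard $m$-dimensional Brownian motion, $w$ denotes the sample path, and the equation is an Itô equation; the solutions $X_t(x_o,w)$ and $X_t(y_o,w)$ are driven by the same Brownian motion. $|\cdot|$ is the Euclidean norm and $\|\cdot\|$ is the Hilbert–Schmidt norm on $d\times m$ matrices. Under the stated conditions on $\sigma,b$ the equation has a unique strong solution up to its lifetime (known earlier result: pathwise uniqueness holds). "No explosion" means that for every starting point the lifetime of the solution is infinite almost surely. *)

theory Defs
  imports "HOL-Probability.Probability"
begin

text \<open>
  Time is the half-line \<open>t \<ge> 0\<close> inside \<open>real\<close>; the values of a process at negative times play no
  role. A \<open>d \<times> m\<close> matrix is an element of \<open>real ^ 'm ^ 'd\<close>, and the library's norm on that type,
  the L2 norm of the L2 norms of the rows, is the Hilbert--Schmidt norm.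
\<close>

definition past_events :: "'w measure \<Rightarrow> (real \<Rightarrow> 'w \<Rightarrow> real ^ 'm) \<Rightarrow> real \<Rightarrow> 'w set set" where
  "past_events M W t = {W s -` A \<inter> space M | s A. 0 \<le> s \<and> s \<le> t \<and> A \<in> sets borel}"

text \<open>The filtration generated by \<open>W\<close>, augmented by the null sets of \<open>M\<close>.\<close>

definition brownian_filtration ::
    "'w measure \<Rightarrow> (real \<Rightarrow> 'w \<Rightarrow> real ^ 'm) \<Rightarrow> real \<Rightarrow> 'w measure" where
  "brownian_filtration M W t = sigma (space M) (past_events M W t \<union> null_sets M)"

definition std_brownian_motion :: "'w measure \<Rightarrow> (real \<Rightarrow> 'w \<Rightarrow> real ^ 'm) \<Rightarrow> bool" where
  "std_brownian_motion M W \<longleftrightarrow>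
     prob_space M \<and>
     (\<forall>t\<ge>0. W t \<in> borel_measurable M) \<and>
     (AE \<omega> in M. W 0 \<omega> = 0) \<and>
     (AE \<omega> in M. continuous_on {0..} (\<lambda>t. W t \<omega>)) \<and>
     (\<forall>s t. 0 \<le> s \<longrightarrow> s < t \<longrightarrow>
        prob_space.indep_set M (sigma_sets (space M) (past_events M W s))
          {(\<lambda>\<omega>. W t \<omega> - W s \<omega>) -` A \<inter> space M | A. A \<in> sets borel} \<and>
        distributed M lborel (\<lambda>\<omega>. W t \<omega> - W s \<omega>)
          (\<lambda>x. ennreal (\<Prod>i\<in>UNIV. normal_density 0 (sqrt (t - s)) (x $ i))))"

text \<open>
  The triple \<open>(k, p, \<xi>)\<close> stands for the simple integrand
  \<open>\<Sum>i<k. \<xi> i * indicator {p i<..p (Suc i)}\<close> with bounded \<open>\<xi> i\<close> known at time \<open>p i\<close>.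
\<close>

definition simple_integrand ::
    "'w measure \<Rightarrow> (real \<Rightarrow> 'w measure) \<Rightarrow> nat \<Rightarrow> (nat \<Rightarrow> real) \<Rightarrow>
     (nat \<Rightarrow> 'w \<Rightarrow> real ^ 'm ^ 'd) \<Rightarrow> bool" where
  "simple_integrand M F k p \<xi> \<longleftrightarrow>
     0 \<le> p 0 \<and>
     (\<forall>i<k. p i < p (Suc i) \<and> \<xi> i \<in> borel_measurable (F (p i)) \<and>
        (\<exists>B. \<forall>\<omega>\<in>space M. norm (\<xi> i \<omega>) \<le> B))"

definition simple_process ::
    "nat \<Rightarrow> (nat \<Rightarrow> real) \<Rightarrow> (nat \<Rightarrow> 'w \<Rightarrow> real ^ 'm ^ 'd) \<Rightarrow>
     real \<Rightarrow> 'w \<Rightarrow> real ^ 'm ^ 'd" where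
  "simple_process k p \<xi> s \<omega> = (\<Sum>i<k. indicator {p i<..p (Suc i)} s *\<^sub>R \<xi> i \<omega>)"

definition simple_ito_integral ::
    "(real \<Rightarrow> 'w \<Rightarrow> real ^ 'm) \<Rightarrow> nat \<Rightarrow> (nat \<Rightarrow> real) \<Rightarrow>
     (nat \<Rightarrow> 'w \<Rightarrow> real ^ 'm ^ 'd) \<Rightarrow> real \<Rightarrow> 'w \<Rightarrow> real ^ 'd" where
  "simple_ito_integral W k p \<xi> t \<omega> =
     (\<Sum>i<k. \<xi> i \<omega> *v (W (min t (p (Suc i))) \<omega> - W (min t (p i)) \<omega>))"

definition progressive ::
    "(real \<Rightarrow> 'w measure) \<Rightarrow> (real \<Rightarrow> 'w \<Rightarrow> 'e::topological_space) \<Rightarrow> bool" where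
  "progressive F H \<longleftrightarrow>
     (\<forall>t\<ge>0. (\<lambda>(s, \<omega>). H s \<omega>) \<in> borel_measurable (restrict_space borel {0..t} \<Otimes>\<^sub>M F t))"

text \<open>
  The relation ``\<open>I t = \<integral>\<^sub>0\<^sup>t H s dW s\<close> for all \<open>t \<ge> 0\<close>'': \<open>H\<close> is progressively measurable and
  almost surely locally square integrable in time, and \<open>I\<close> is a continuous adapted process which is
  the limit in probability of the integrals of simple processes that converge to \<open>H\<close> in
  \<open>L\<^sup>2([0, T])\<close> in probability for every \<open>T\<close>. It determines \<open>I\<close> up to indistinguishability.
\<close>

definition has_ito_integral ::
    "'w measure \<Rightarrow> (real \<Rightarrow> 'w measure) \<Rightarrow> (real \<Rightarrow> 'w \<Rightarrow> real ^ 'm) \<Rightarrow>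
     (real \<Rightarrow> 'w \<Rightarrow> real ^ 'm ^ 'd) \<Rightarrow> (real \<Rightarrow> 'w \<Rightarrow> real ^ 'd) \<Rightarrow> bool" where
  "has_ito_integral M F W H I \<longleftrightarrow>
     progressive F H \<and>
     (AE \<omega> in M. \<forall>T\<ge>0. (\<integral>\<^sup>+ s\<in>{0..T}. ennreal ((norm (H s \<omega>))\<^sup>2) \<partial>lborel) < \<infinity>) \<and>
     (\<forall>t\<ge>0. I t \<in> borel_measurable (F t)) \<and>
     (AE \<omega> in M. continuous_on {0..} (\<lambda>t. I t \<omega>)) \<and>
     (\<exists>k p \<xi>.
        (\<forall>n::nat. simple_integrand M F (k n) (p n) (\<xi> n)) \<and>
        (\<forall>T\<ge>0. \<forall>\<epsilon>>0. (\<lambda>n. measure M {\<omega>\<in>space M. ennreal \<epsilon> <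
             (\<integral>\<^sup>+ s\<in>{0..T}. ennreal ((norm (simple_process (k n) (p n) (\<xi> n) s \<omega> - H s \<omega>))\<^sup>2)
                \<partial>lborel)}) \<longlonglongrightarrow> 0) \<and>
        (\<forall>t\<ge>0. \<forall>\<epsilon>>0. (\<lambda>n. measure M {\<omega>\<in>space M.
             \<epsilon> < norm (simple_ito_integral W (k n) (p n) (\<xi> n) t \<omega> - I t \<omega>)}) \<longlonglongrightarrow> 0))"

text \<open>
  A process with lifetime is a pair of \<open>X\<close> and \<open>\<zeta>\<close>, where only the values \<open>X t \<omega>\<close> with
  \<open>t < \<zeta> \<omega>\<close> are meaningful. An empty infimum in \<open>exit_time\<close> is \<open>\<infinity>\<close>.
\<close>

definition exit_time ::
    "(real \<Rightarrow> 'w \<Rightarrow> real ^ 'd) \<Rightarrow> ('w \<Rightarrow> ereal) \<Rightarrow> nat \<Rightarrow> 'w \<Rightarrow> ereal" where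
  "exit_time X \<zeta> n \<omega> =
     Inf {ereal t | t. 0 \<le> t \<and> ereal t < \<zeta> \<omega> \<and> real n \<le> norm (X t \<omega>)}"

text \<open>
  Strong solution, up to its lifetime \<open>\<zeta>\<close>, of \<open>dX = \<sigma>(X) dW + b(X) dt\<close>, \<open>X 0 = x\<close>:
  \<open>X\<close> is adapted to the augmented filtration of \<open>W\<close>, is continuous on \<open>[0, \<zeta>)\<close>, tends to infinity
  at \<open>\<zeta>\<close> if \<open>\<zeta> < \<infinity>\<close>, and for every \<open>n\<close> satisfies the equation stopped on leaving the open ball
  of radius \<open>n\<close>. The blow-up at \<open>\<zeta>\<close> makes \<open>min t (exit_time X \<zeta> n \<omega>)\<close> smaller than \<open>\<zeta> \<omega>\<close>, so
  the stopped equation only involves meaningful values of \<open>X\<close>.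
\<close>

definition strong_solution ::
    "'w measure \<Rightarrow> (real \<Rightarrow> 'w \<Rightarrow> real ^ 'm) \<Rightarrow>
     (real ^ 'd \<Rightarrow> real ^ 'm ^ 'd) \<Rightarrow> (real ^ 'd \<Rightarrow> real ^ 'd) \<Rightarrow> real ^ 'd \<Rightarrow>
     (real \<Rightarrow> 'w \<Rightarrow> real ^ 'd) \<Rightarrow> ('w \<Rightarrow> ereal) \<Rightarrow> bool" where
  "strong_solution M W \<sigma> b x X \<zeta> \<longleftrightarrow>
     (let F = brownian_filtration M W in
     (\<forall>t\<ge>0. {\<omega>\<in>space M. ereal t < \<zeta> \<omega>} \<in> sets (F t) \<and>
        X t \<in> borel_measurable (restrict_space (F t) {\<omega>\<in>space M. ereal t < \<zeta> \<omega>})) \<and>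
     (AE \<omega> in M. 0 < \<zeta> \<omega> \<and> X 0 \<omega> = x \<and>
        continuous_on {t. 0 \<le> t \<and> ereal t < \<zeta> \<omega>} (\<lambda>t. X t \<omega>) \<and>
        (\<zeta> \<omega> < \<infinity> \<longrightarrow>
           filterlim (\<lambda>t. X t \<omega>) at_infinity (at_left (real_of_ereal (\<zeta> \<omega>))))) \<and>
     (\<forall>n. \<exists>I.
        has_ito_integral M F W
          (\<lambda>s \<omega>. if ereal s \<le> exit_time X \<zeta> n \<omega> then \<sigma> (X s \<omega>) else 0) I \<and>
        (AE \<omega> in M. \<forall>t\<ge>0.
           (let \<tau> = real_of_ereal (min (ereal t) (exit_time X \<zeta> n \<omega>)) in
            X \<tau> \<omega> = x + I t \<omega> + (LINT s:{0..\<tau>}|lborel. b (X s \<omega>))))))"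

definition no_explosion ::
    "'w measure \<Rightarrow> (real \<Rightarrow> 'w \<Rightarrow> real ^ 'm) \<Rightarrow>
     (real ^ 'd \<Rightarrow> real ^ 'm ^ 'd) \<Rightarrow> (real ^ 'd \<Rightarrow> real ^ 'd) \<Rightarrow> bool" where
  "no_explosion M W \<sigma> b \<longleftrightarrow>
     (\<forall>x X \<zeta>. strong_solution M W \<sigma> b x X \<zeta> \<longrightarrow> (AE \<omega> in M. \<zeta> \<omega> = \<infinity>))"

end

theory Submission
  imports Defs
begin

text \<open>
  The integral condition makes \<open>\<integral> ds / (s * r s)\<close> blow up at \<open>0\<close>, and the slow variation of \<open>r\<close> makes
  \<open>1 / (s * r s)\<close> decrease near \<open>0\<close> with \<open>|d/ds (1 / (s * r s))| \<le> 2 / (s\<^sup>2 * r s)\<close>. Hence a regularised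
  antiderivative \<open>g\<close> with \<open>g' = - 1 / (u * r u)\<close> near \<open>0\<close> can be made arbitrarily large at \<open>0\<close>, while the
  drift of \<open>g (|X t - Y t|\<^sup>2)\<close> stays below a fixed multiple of \<open>C\<close> and its initial value stays bounded.
  By the maximal inequality, \<open>X\<close> and \<open>Y\<close> then meet before leaving a ball with probability at most
  \<open>const / g 0\<close>, which can be made arbitrarily small.

  No Ito formula for continuous semimartingales is used. Along a grid, an increment of the stopped
  difference is the frozen diffusion coefficient times the increment of \<open>W\<close> plus a remainder. Summed
  over the grid, the second moments of the remainders tend to \<open>0\<close> by the isometry, since the integrand has
  left limits; the second order Taylor expansion of \<open>g (|z|\<^sup>2)\<close> then only involves Gaussian moments.
\<close>

section \<open>Moments of Brownian increments\<close>

text \<open>The bound on the meeting probability tolerates every error that does not grow with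
  \<open>g 0\<close>, so a crude substitute for stochastic calculus is enough. The Ito integral is
  given through limits in probability only. For integrands bounded on \<open>[0, T]\<close> this
  yields two facts about increments: zero mean against bounded variables of the past, and a second
  moment bound with a spare factor 2. Bounded coefficients come from stopping on leaving a ball; the
  resulting constant \<open>K\<close> depends on the ball but not on \<open>g\<close>. Stopping
  takes place at grid times, and Fatou's lemma removes the grid, so that no stopping theorem in
  continuous time enters. As \<open>r\<close> is evaluated at the squared distance, the derivatives
  of \<open>g\<close> vanish beyond some \<open>c \<le> \<delta>\<^sup>2\<close>: below
  \<open>c\<close> both moduli of continuity apply, above it there is no drift.\<close>

lemma lborel_vec_prod:
  fixes f :: "'m::finite \<Rightarrow> real \<Rightarrow> real"
  assumes f: "\<And>i. integrable lborel (f i)"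
  shows "has_bochner_integral lborel (\<lambda>x::real^'m. \<Prod>i\<in>UNIV. f i (x $ i)) (\<Prod>i\<in>UNIV. integral\<^sup>L lborel (f i))"
proof -
  \<comment> \<open>\<open>ix\<close> returns the index of a basis vector. It carries products over
    \<open>Basis\<close>, the index set in \<open>lborel_eq\<close>, to products over
    coordinates.\<close>
  define ix :: "real^'m \<Rightarrow> 'm" where "ix = the_inv (\<lambda>i. axis i 1)"
  have inj: "inj (\<lambda>i::'m. axis i (1::real))" by (simp add: inj_def axis_eq_axis)
  have ix: "ix (axis i 1) = i" for i unfolding ix_def by (rule the_inv_f_f[OF inj])
  have B: "(Basis :: (real^'m) set) = range (\<lambda>i. axis i 1)" by (auto simp: Basis_vec_def)
  have re: "(\<Prod>b\<in>(Basis :: (real^'m) set). g (ix b) b) = (\<Prod>i\<in>UNIV. g i (axis i 1))" for g :: "'m \<Rightarrow> _ \<Rightarrow> real"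
    unfolding B by (subst prod.reindex[OF inj]) (simp add: ix)
  have fm: "f i \<in> borel_measurable borel" for i using f[of i] by auto
  have [measurable]: "(\<lambda>x::real^'m. \<Prod>i\<in>UNIV. f i (x $ i)) \<in> borel_measurable borel"
    by (intro borel_measurable_prod measurable_compose[OF _ fm] borel_measurable_nth)
  interpret P: product_sigma_finite "\<lambda>b::real^'m. lborel :: real measure" ..
  have eq: "(\<Prod>i\<in>UNIV. f i ((\<Sum>b\<in>Basis. x b *\<^sub>R b) $ i)) = (\<Prod>b\<in>(Basis :: (real^'m) set). f (ix b) (x b))" for x :: "real^'m \<Rightarrow> real"
  proof -
    have "(\<Sum>b\<in>Basis. x b *\<^sub>R b) $ i = x (axis i 1)" for i
    proof -
      have "(\<Sum>b\<in>Basis. x b *\<^sub>R b) $ i = (\<Sum>b\<in>Basis. x b *\<^sub>R b) \<bullet> axis i 1" by (simp add: inner_axis)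
      also have "\<dots> = x (axis i 1)" by (rule inner_sum_left_Basis) (auto simp: B)
      finally show ?thesis .
    qed
    then show ?thesis using re[of "\<lambda>i b. f i (x b)"] by simp
  qed
  have *: "integrable (\<Pi>\<^sub>M b\<in>(Basis::(real^'m) set). lborel) (\<lambda>x. \<Prod>b\<in>Basis. f (ix b) (x b))"
    by (rule P.product_integrable_prod) (auto intro: f)
  have **: "(\<integral>x. (\<Prod>b\<in>Basis. f (ix b) (x b)) \<partial>(\<Pi>\<^sub>M b\<in>(Basis::(real^'m) set). lborel)) = (\<Prod>b\<in>(Basis::(real^'m) set). integral\<^sup>L lborel (f (ix b)))"
    by (rule P.product_integral_prod) (auto intro: f)
  have 1: "integrable lborel (\<lambda>x::real^'m. \<Prod>i\<in>UNIV. f i (x $ i))"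
    by (subst lborel_eq, subst integrable_distr_eq) (simp_all only: eq *, measurable)
  have 2: "integral\<^sup>L lborel (\<lambda>x::real^'m. \<Prod>i\<in>UNIV. f i (x $ i)) = (\<Prod>i\<in>UNIV. integral\<^sup>L lborel (f i))"
    by (subst lborel_eq, subst integral_distr)
      (simp_all only: eq ** re[of "\<lambda>i b. integral\<^sup>L lborel (f i)"], measurable)
  show ?thesis using 1 2 by (simp add: has_bochner_integral_iff)
qed

lemma gaussian_vec_prod_moment:
  fixes n :: "'m::finite \<Rightarrow> nat"
  assumes "0 < s"
  shows "has_bochner_integral lborel
    (\<lambda>x::real^'m. (\<Prod>i\<in>UNIV. normal_density 0 s (x $ i)) * (\<Prod>i\<in>UNIV. (x $ i) ^ n i))
    (\<Prod>i\<in>UNIV. \<integral>x. normal_density 0 s x * x ^ n i \<partial>lborel)"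
  using lborel_vec_prod[of "\<lambda>i x. normal_density 0 s x * x ^ n i"]
    integrable_normal_moment[OF assms, of 0] by (simp add: prod.distrib)

lemma distributed_gaussian_moment:
  fixes X :: "'w \<Rightarrow> real^'m"
  assumes D: "distributed M lborel X (\<lambda>x. ennreal (\<Prod>i\<in>UNIV. normal_density 0 s (x $ i)))" and s: "0 < s"
  shows "has_bochner_integral M (\<lambda>\<omega>. \<Prod>i\<in>UNIV. (X \<omega> $ i) ^ n i) (\<Prod>i\<in>UNIV. \<integral>x. normal_density 0 s x * x ^ n i \<partial>lborel)"
proof -
  have [measurable]: "(\<lambda>x::real^'m. \<Prod>i\<in>UNIV. (x $ i) ^ n i) \<in> borel_measurable borel"
    by (intro borel_measurable_prod borel_measurable_power borel_measurable_nth)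
  have nn: "0 \<le> (\<Prod>i\<in>UNIV. normal_density 0 s ((x::real^'m) $ i))" for x by (intro prod_nonneg) auto
  show ?thesis
    using gaussian_vec_prod_moment[OF s, of n] distributed_integral[OF D, of "\<lambda>x. \<Prod>i\<in>UNIV. (x $ i) ^ n i"]
      distributed_integrable[OF D, of "\<lambda>x. \<Prod>i\<in>UNIV. (x $ i) ^ n i"] nn
    by (simp add: has_bochner_integral_iff)
qed

lemma normal_moments_0124:
  assumes "0 < s"
  shows "(\<integral>x. normal_density 0 s x * x ^ 0 \<partial>lborel) = 1"
    "(\<integral>x. normal_density 0 s x * x ^ 1 \<partial>lborel) = 0"
    "(\<integral>x. normal_density 0 s x * x ^ 2 \<partial>lborel) = s\<^sup>2"
    "(\<integral>x. normal_density 0 s x * x ^ 4 \<partial>lborel) = 3 * s ^ 4"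
  using integral_normal_moment_even[OF assms, of 0 0] integral_normal_moment_odd[OF assms, of 0 0]
    integral_normal_moment_even[OF assms, of 0 1] integral_normal_moment_even[OF assms, of 0 2] assms
  by (auto simp: fact_numeral field_simps power4_eq_xxxx power2_eq_square)

lemma gaussian_vec_moments:
  fixes X :: "'w \<Rightarrow> real^'m"
  assumes D: "distributed M lborel X (\<lambda>x. ennreal (\<Prod>i\<in>UNIV. normal_density 0 s (x $ i)))" and s: "0 < s"
  shows "has_bochner_integral M (\<lambda>\<omega>. X \<omega> $ i) 0"
    and "has_bochner_integral M (\<lambda>\<omega>. X \<omega> $ i * X \<omega> $ j) (if i = j then s\<^sup>2 else 0)"
    and "has_bochner_integral M (\<lambda>\<omega>. (X \<omega> $ i) ^ 4) (3 * s ^ 4)"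
proof -
  note mom = normal_moments_0124[OF s]
  \<comment> \<open>Exponents concentrated on one coordinate: all other factors are zeroth moments,
    which equal 1.\<close>
  have pr: "(\<Prod>k\<in>UNIV. (x $ k) ^ (if k = i then n else 0)) = (x $ i) ^ n" for x :: "real^'m" and n i
    by (subst prod.remove[of _ i]) (auto intro!: prod.neutral)
  have pr0: "(\<Prod>k\<in>UNIV. F (if k = i then n else 0)) = F n" if "F 0 = (1::real)" for F :: "nat \<Rightarrow> real" and n and i :: 'm
    by (subst prod.remove[of _ i]) (auto intro!: prod.neutral simp: that)
  let ?F = "\<lambda>n. \<integral>x. normal_density 0 s x * x ^ n \<partial>lborel"
  have 1: "has_bochner_integral M (\<lambda>\<omega>. (X \<omega> $ i) ^ n) (?F n)" for n i
    using distributed_gaussian_moment[OF D s, of "\<lambda>k. if k = i then n else 0"] pr0[of ?F i n] mom(1)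
    by (simp add: pr)
  show "has_bochner_integral M (\<lambda>\<omega>. X \<omega> $ i) 0" using 1[of i 1] unfolding mom(2) by simp
  show "has_bochner_integral M (\<lambda>\<omega>. (X \<omega> $ i) ^ 4) (3 * s ^ 4)" using 1[of i 4] unfolding mom(4) .
  show "has_bochner_integral M (\<lambda>\<omega>. X \<omega> $ i * X \<omega> $ j) (if i = j then s\<^sup>2 else 0)"
  proof (cases "i = j")
    case True then show ?thesis using 1[of i 2] unfolding mom(3) by (simp add: power2_eq_square)
  next
    case False
    \<comment> \<open>For \<open>i \<noteq> j\<close> the exponent is 1 at both coordinates, so the
      product contains a vanishing first moment.\<close>
    let ?n = "\<lambda>k. if k = i \<or> k = j then 1 else 0 :: nat"
    have a: "(\<Prod>k\<in>UNIV. (x $ k) ^ ?n k) = x $ i * x $ j" for x :: "real^'m"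
      using False by (subst prod.remove[of _ i], simp, simp, subst prod.remove[of _ j]) (auto intro!: prod.neutral)
    have b: "(\<Prod>k\<in>UNIV. ?F (?n k)) = 0"
      using mom(2) by (intro prod_zero) (auto intro!: bexI[of _ i])
    show ?thesis using distributed_gaussian_moment[OF D s, of ?n] False unfolding a b by simp
  qed
qed

lemma Int_stable_vimages: "Int_stable {f -` A \<inter> S |A. A \<in> sets N}"
proof (rule Int_stableI)
  fix a b assume "a \<in> {f -` A \<inter> S |A. A \<in> sets N}" "b \<in> {f -` A \<inter> S |A. A \<in> sets N}"
  then obtain A B where "A \<in> sets N" "B \<in> sets N" "a = f -` A \<inter> S" "b = f -` B \<inter> S" by auto
  then show "a \<inter> b \<in> {f -` A \<inter> S |A. A \<in> sets N}"
    by (intro CollectI exI[of _ "A \<inter> B"]) auto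
qed

section \<open>The augmented filtration and the independence of increments\<close>

locale brownian = prob_space M for M :: "'w measure" +
  fixes W :: "real \<Rightarrow> 'w \<Rightarrow> real ^ 'm"
  assumes bm: "std_brownian_motion M W"
begin

abbreviation "F \<equiv> brownian_filtration M W"

lemma W_measurable [measurable (raw)]: "0 \<le> t \<Longrightarrow> W t \<in> borel_measurable M"
  using bm by (auto simp: std_brownian_motion_def)

lemma past_events_sets: "past_events M W t \<subseteq> sets M"
  using W_measurable by (auto simp: past_events_def intro!: measurable_sets)

lemma gen_subset: "past_events M W t \<union> null_sets M \<subseteq> Pow (space M)"
  using past_events_sets[of t] sets.sets_into_space by (auto dest: null_setsD2)

lemma space_F [simp]: "space (F t) = space M"
  unfolding brownian_filtration_def by (rule space_measure_of[OF gen_subset])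

lemma sets_F: "sets (F t) = sigma_sets (space M) (past_events M W t \<union> null_sets M)"
  unfolding brownian_filtration_def by (rule sets_measure_of[OF gen_subset])

lemma sets_F_subset: "sets (F t) \<subseteq> sets M"
  unfolding sets_F using past_events_sets[of t] by (intro sets.sigma_sets_subset) auto

lemma measurable_F: "f \<in> measurable (F t) N \<Longrightarrow> f \<in> measurable M N"
  using sets_F_subset[of t] by (auto simp: measurable_def)

lemma sets_F_mono: "s \<le> t \<Longrightarrow> sets (F s) \<subseteq> sets (F t)"
  unfolding sets_F by (intro sigma_sets_mono' Un_mono) (fastforce simp: past_events_def)+

lemma measurable_F_mono: "f \<in> measurable (F s) N \<Longrightarrow> s \<le> t \<Longrightarrow> f \<in> measurable (F t) N"
  using sets_F_mono[of s t] by (auto simp: measurable_def)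

lemma null_sets_F: "N \<in> null_sets M \<Longrightarrow> N \<in> sets (F t)"
  unfolding sets_F by (rule sigma_sets.Basic) auto

lemma W_measurable_F: "0 \<le> s \<Longrightarrow> s \<le> t \<Longrightarrow> W s \<in> borel_measurable (F t)"
  by (rule measurableI) (auto simp: sets_F past_events_def intro!: sigma_sets.Basic)

text \<open>Augmentation changes events by null sets only, as induction over the generation of
  \<open>F t\<close> shows. This is what carries the independence assumed for the raw past over to
  \<open>F\<close>.\<close>

lemma sets_F_AE_past:
  assumes "A \<in> sets (F t)"
  shows "\<exists>A'\<in>sigma_sets (space M) (past_events M W t). AE \<omega> in M. \<omega> \<in> A \<longleftrightarrow> \<omega> \<in> A'"
  using assms unfolding sets_F
proof induction
  case (Basic a)
  then show ?case
  proof
    assume "a \<in> null_sets M"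
    then have "AE \<omega> in M. \<omega> \<in> a \<longleftrightarrow> \<omega> \<in> {}" using AE_not_in by auto
    then show ?thesis using sigma_sets.Empty by blast
  qed (auto intro: sigma_sets.Basic)
next
  case Empty
  then show ?case using sigma_sets.Empty by blast
next
  case (Compl a)
  then obtain A' where A': "A'\<in>sigma_sets (space M) (past_events M W t)" "AE \<omega> in M. \<omega> \<in> a \<longleftrightarrow> \<omega> \<in> A'" by auto
  show ?case
    using A'(2) by (intro bexI[of _ "space M - A'"] sigma_sets.Compl A'(1)) auto
next
  case (Union a)
  then obtain A' where A': "\<And>i. A' i\<in>sigma_sets (space M) (past_events M W t)" "\<And>i. AE \<omega> in M. \<omega> \<in> a i \<longleftrightarrow> \<omega> \<in> A' i" by metis
  have "AE \<omega> in M. \<forall>i::nat. \<omega> \<in> a i \<longleftrightarrow> \<omega> \<in> A' i" using A'(2) by (simp add: AE_all_countable)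
  then show ?case
    by (intro bexI[of _ "\<Union>i. A' i"] sigma_sets.Union A'(1)) auto
qed

lemma increment_distributed:
  assumes "0 \<le> s" "s < t"
  shows "distributed M lborel (\<lambda>\<omega>. W t \<omega> - W s \<omega>)
          (\<lambda>x. ennreal (\<Prod>i\<in>UNIV. normal_density 0 (sqrt (t - s)) (x $ i)))"
  using bm assms by (auto simp: std_brownian_motion_def)

text \<open>Independence in \<open>std_brownian_motion\<close> concerns the raw past, whereas simple
  integrands are measurable for the augmented filtration. Exchanging an event of \<open>F s\<close>
  for the equivalent one from \<open>sets_F_AE_past\<close> alters no probability, and the families
  of preimages are stable under intersection and generate both sigma-algebras.\<close>

lemma indep_increment:
  assumes st: "0 \<le> s" "s < t" and X: "X \<in> borel_measurable (F s)" and g[measurable]: "g \<in> borel_measurable borel"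
  shows "indep_var borel X borel (\<lambda>\<omega>. g (W t \<omega> - W s \<omega>))"
proof -
  have ind: "indep_set (sigma_sets (space M) (past_events M W s))
          {(\<lambda>\<omega>. W t \<omega> - W s \<omega>) -` A \<inter> space M | A. A \<in> sets borel}"
    using bm st by (auto simp: std_brownian_motion_def)
  have [measurable]: "W s \<in> borel_measurable M" "W t \<in> borel_measurable M" using st by auto
  show ?thesis unfolding indep_var_eq
  proof (intro conjI indep_set_sigma_sets)
    show X': "X \<in> borel_measurable M" by (rule measurable_F[OF X])
    show gm: "(\<lambda>\<omega>. g (W t \<omega> - W s \<omega>)) \<in> borel_measurable M" by measurable
    show "indep_set {X -` A \<inter> space M |A. A \<in> sets borel} {(\<lambda>\<omega>. g (W t \<omega> - W s \<omega>)) -` A \<inter> space M |A. A \<in> sets borel}"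
    proof (intro indep_setI)
      show "{X -` A \<inter> space M |A. A \<in> sets borel} \<subseteq> events"
        "{(\<lambda>\<omega>. g (W t \<omega> - W s \<omega>)) -` A \<inter> space M |A. A \<in> sets borel} \<subseteq> events"
        using X' gm by (auto intro: measurable_sets)
      fix a b assume a: "a \<in> {X -` A \<inter> space M |A. A \<in> sets borel}"
        and b: "b \<in> {(\<lambda>\<omega>. g (W t \<omega> - W s \<omega>)) -` A \<inter> space M |A. A \<in> sets borel}"
      have "a \<in> sets (F s)" using a X by (auto dest: measurable_sets)
      then obtain a' where a': "a'\<in>sigma_sets (space M) (past_events M W s)" "AE \<omega> in M. \<omega> \<in> a \<longleftrightarrow> \<omega> \<in> a'"
        using sets_F_AE_past by blast
      have b': "b \<in> {(\<lambda>\<omega>. W t \<omega> - W s \<omega>) -` A \<inter> space M | A. A \<in> sets borel}"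
      proof -
        from b obtain A where A: "A \<in> sets borel" "b = (\<lambda>\<omega>. g (W t \<omega> - W s \<omega>)) -` A \<inter> space M" by auto
        have "g -` A \<in> sets borel" using measurable_sets[OF g A(1)] by simp
        then show ?thesis using A by (intro CollectI exI[of _ "g -` A"]) auto
      qed
      have am: "a \<in> sets M" using a X' by auto
      have a'm: "a' \<in> sets M" using indep_setD_ev1[OF ind] a'(1) by auto
      have bm: "b \<in> sets M" using b gm by auto
      have "prob (a \<inter> b) = prob (a' \<inter> b)" using a'(2) am a'm bm by (intro measure_eq_AE) auto
      also have "\<dots> = prob a' * prob b" by (rule indep_setD[OF ind a'(1) b'])
      also have "prob a' = prob a" using a'(2) am a'm by (intro measure_eq_AE) auto
      finally show "prob (a \<inter> b) = prob a * prob b" .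
    qed
    show "Int_stable {X -` A \<inter> space M |A. A \<in> sets borel}"
      "Int_stable {(\<lambda>\<omega>. g (W t \<omega> - W s \<omega>)) -` A \<inter> space M |A. A \<in> sets borel}"
      by (rule Int_stable_vimages)+
  qed
qed

lemma increment_moment1:
  assumes st: "0 \<le> s" "s \<le> t" and Z: "Z \<in> borel_measurable (F s)" "integrable M Z"
  shows "has_bochner_integral M (\<lambda>\<omega>. Z \<omega> * (W t \<omega> - W s \<omega>) $ i) 0"
proof (cases "s = t")
  case False
  then have st': "0 \<le> s" "s < t" using st by auto
  from gaussian_vec_moments(1)[OF increment_distributed[OF st'], of i] st'
  have h: "has_bochner_integral M (\<lambda>\<omega>. (W t \<omega> - W s \<omega>) $ i) 0" by simp
  have "indep_var borel Z borel (\<lambda>\<omega>. (\<lambda>x. x $ i) (W t \<omega> - W s \<omega>))"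
    by (rule indep_increment[OF st' Z(1)]) auto
  then show ?thesis using h Z
    using indep_var_lebesgue_integral[of Z "\<lambda>\<omega>. (W t \<omega> - W s \<omega>) $ i"]
      indep_var_integrable[of Z "\<lambda>\<omega>. (W t \<omega> - W s \<omega>) $ i"]
    by (simp add: has_bochner_integral_iff)
qed (auto simp: has_bochner_integral_iff)

lemma increment_moment2:
  assumes st: "0 \<le> s" "s \<le> t" and Z: "Z \<in> borel_measurable (F s)" "integrable M Z"
  shows "has_bochner_integral M (\<lambda>\<omega>. Z \<omega> * ((W t \<omega> - W s \<omega>) $ i * (W t \<omega> - W s \<omega>) $ j))
    (if i = j then (t - s) * expectation Z else 0)"
proof (cases "s = t")
  case False
  then have st': "0 \<le> s" "s < t" using st by auto
  from gaussian_vec_moments(2)[OF increment_distributed[OF st'], of i j] st'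
  have h: "has_bochner_integral M (\<lambda>\<omega>. (W t \<omega> - W s \<omega>) $ i * (W t \<omega> - W s \<omega>) $ j) (if i = j then t - s else 0)" by (auto split: if_splits)
  have "indep_var borel Z borel (\<lambda>\<omega>. (\<lambda>x. x $ i * x $ j) (W t \<omega> - W s \<omega>))"
    by (rule indep_increment[OF st' Z(1)]) auto
  then show ?thesis using h Z
    using indep_var_lebesgue_integral[of Z "\<lambda>\<omega>. (W t \<omega> - W s \<omega>) $ i * (W t \<omega> - W s \<omega>) $ j"]
      indep_var_integrable[of Z "\<lambda>\<omega>. (W t \<omega> - W s \<omega>) $ i * (W t \<omega> - W s \<omega>) $ j"]
    by (auto simp: has_bochner_integral_iff)
qed (auto simp: has_bochner_integral_iff)

lemma increment_inner_mean:
  fixes Z :: "'w \<Rightarrow> real ^ 'm"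
  assumes st: "0 \<le> s" "s \<le> t" and Z: "Z \<in> borel_measurable (F s)" "integrable M Z"
  shows "has_bochner_integral M (\<lambda>\<omega>. Z \<omega> \<bullet> (W t \<omega> - W s \<omega>)) 0"
proof -
  have "has_bochner_integral M (\<lambda>\<omega>. \<Sum>i\<in>UNIV. Z \<omega> $ i * (W t \<omega> - W s \<omega>) $ i) (\<Sum>i\<in>(UNIV::'m set). 0)"
    using Z by (intro has_bochner_integral_sum increment_moment1 st)
      (auto intro!: borel_measurable_nth measurable_compose[OF Z(1)] integrable_bounded_linear[OF bounded_linear_vec_nth])
  then show ?thesis by (simp add: inner_vec_def)
qed

lemma integrable_bounded_F:
  fixes f :: "'w \<Rightarrow> 'e::{banach, second_countable_topology}"
  assumes "f \<in> borel_measurable (F s)" "\<And>\<omega>. \<omega> \<in> space M \<Longrightarrow> norm (f \<omega>) \<le> B"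
  shows "integrable M f"
  by (rule integrable_const_bound[of _ B]) (use assms measurable_F in auto)

text \<open>In coordinates, distinct components of the increment are uncorrelated, so only the
  diagonal survives. The weight \<open>c\<close> may have either sign; later it carries the second
  derivative of the test function.\<close>

lemma increment_quadratic:
  fixes Z :: "'w \<Rightarrow> real ^ 'm" and c :: "'w \<Rightarrow> real"
  assumes st: "0 \<le> s" "s \<le> t"
    and Z[measurable]: "Z \<in> borel_measurable (F s)" and ZB: "\<And>\<omega>. \<omega> \<in> space M \<Longrightarrow> norm (Z \<omega>) \<le> B"
    and c[measurable]: "c \<in> borel_measurable (F s)" and cB: "\<And>\<omega>. \<omega> \<in> space M \<Longrightarrow> \<bar>c \<omega>\<bar> \<le> B'"
  shows "has_bochner_integral M (\<lambda>\<omega>. c \<omega> * (Z \<omega> \<bullet> (W t \<omega> - W s \<omega>))\<^sup>2) ((t - s) * expectation (\<lambda>\<omega>. c \<omega> * (norm (Z \<omega>))\<^sup>2))"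
proof -
  let ?D = "\<lambda>\<omega>. W t \<omega> - W s \<omega>"
  have [measurable]: "(\<lambda>\<omega>. Z \<omega> $ i) \<in> borel_measurable (F s)" for i
    by (rule measurable_compose[OF Z]) auto
  have B: "\<bar>Z \<omega> $ i\<bar> \<le> B" if "\<omega> \<in> space M" for \<omega> i
    using component_le_norm_cart[of "Z \<omega>" i] ZB[OF that] by linarith
  have int: "integrable M (\<lambda>\<omega>. c \<omega> * (Z \<omega> $ i * Z \<omega> $ j))" for i j
  proof (rule integrable_bounded_F[of _ s "B' * (B * B)"])
    fix \<omega> assume w: "\<omega> \<in> space M"
    have "\<bar>c \<omega>\<bar> * (\<bar>Z \<omega> $ i\<bar> * \<bar>Z \<omega> $ j\<bar>) \<le> B' * (B * B)"
      using B[OF w] cB[OF w] by (intro mult_mono) (auto intro: order_trans[OF abs_ge_zero])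
    then show "norm (c \<omega> * (Z \<omega> $ i * Z \<omega> $ j)) \<le> B' * (B * B)" by (simp add: abs_mult)
  qed measurable
  have "has_bochner_integral M (\<lambda>\<omega>. \<Sum>i\<in>UNIV. \<Sum>j\<in>UNIV. (c \<omega> * (Z \<omega> $ i * Z \<omega> $ j)) * (?D \<omega> $ i * ?D \<omega> $ j))
    (\<Sum>i\<in>UNIV. \<Sum>j\<in>UNIV. if i = j then (t - s) * expectation (\<lambda>\<omega>. c \<omega> * (Z \<omega> $ i * Z \<omega> $ j)) else 0)"
    by (intro has_bochner_integral_sum increment_moment2 st int) measurable
  moreover have "(\<Sum>i\<in>UNIV. \<Sum>j\<in>UNIV. (c \<omega> * (Z \<omega> $ i * Z \<omega> $ j)) * (?D \<omega> $ i * ?D \<omega> $ j)) = c \<omega> * (Z \<omega> \<bullet> ?D \<omega>)\<^sup>2" for \<omega>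
    by (simp add: power2_eq_square inner_vec_def sum_product sum_distrib_left mult_ac)
  moreover have "(\<Sum>i\<in>UNIV. \<Sum>j\<in>UNIV. if i = j then (t - s) * expectation (\<lambda>\<omega>. c \<omega> * (Z \<omega> $ i * Z \<omega> $ j)) else 0)
    = (t - s) * expectation (\<lambda>\<omega>. c \<omega> * (norm (Z \<omega>))\<^sup>2)"
  proof -
    have "expectation (\<lambda>\<omega>. c \<omega> * (norm (Z \<omega>))\<^sup>2) = expectation (\<lambda>\<omega>. \<Sum>i\<in>UNIV. c \<omega> * (Z \<omega> $ i * Z \<omega> $ i))"
      by (simp add: power2_norm_eq_inner inner_vec_def sum_distrib_left)
    also have "\<dots> = (\<Sum>i\<in>UNIV. expectation (\<lambda>\<omega>. c \<omega> * (Z \<omega> $ i * Z \<omega> $ i)))"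
      by (rule Bochner_Integration.integral_sum) (rule int)
    finally show ?thesis by (simp add: sum_distrib_left)
  qed
  ultimately show ?thesis by simp
qed

text \<open>The order \<open>(t - s)\<^sup>2\<close> makes fourth order terms vanish when summed
  over a refining grid. The constant combines the coordinate moment
  \<open>3 * (t - s)\<^sup>2\<close> with the Cauchy-Schwarz inequality for the sum of squared
  coordinates.\<close>

lemma increment_norm4:
  assumes st: "0 \<le> s" "s \<le> t"
  shows "integrable M (\<lambda>\<omega>. (norm (W t \<omega> - W s \<omega>)) ^ 4)"
    and "expectation (\<lambda>\<omega>. (norm (W t \<omega> - W s \<omega>)) ^ 4) \<le> 3 * (real CARD('m))\<^sup>2 * (t - s)\<^sup>2"
proof -
  let ?D = "\<lambda>\<omega>. W t \<omega> - W s \<omega>"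
  have [measurable]: "W s \<in> borel_measurable M" "W t \<in> borel_measurable M" using st by auto
  have h: "has_bochner_integral M (\<lambda>\<omega>. (?D \<omega> $ i) ^ 4) (3 * (t - s)\<^sup>2)" for i
  proof (cases "s = t")
    case False
    then have st': "0 \<le> s" "s < t" using st by auto
    have "sqrt (t - s) ^ 4 = (t - s)\<^sup>2" using st by (simp add: power4_eq_xxxx power2_eq_square)
    then show ?thesis using gaussian_vec_moments(3)[OF increment_distributed[OF st'], of i] st' by simp
  qed (auto simp: has_bochner_integral_iff)
  have h2: "has_bochner_integral M (\<lambda>\<omega>. real CARD('m) * (\<Sum>i\<in>UNIV. (?D \<omega> $ i) ^ 4)) (real CARD('m) * (\<Sum>i\<in>(UNIV :: 'm set). 3 * (t - s)\<^sup>2))"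
    by (intro has_bochner_integral_mult_right has_bochner_integral_sum h)
  have le: "(norm x) ^ 4 \<le> real CARD('m) * (\<Sum>i\<in>UNIV. (x $ i) ^ 4)" for x :: "real^'m"
  proof -
    have "(norm x) ^ 4 = (\<Sum>i\<in>UNIV. (x $ i)\<^sup>2)\<^sup>2"
      by (simp add: norm_vec_def L2_set_def sum_nonneg power4_eq_xxxx power2_eq_square flip: abs_mult)
    also have "\<dots> \<le> (\<Sum>i\<in>(UNIV::'m set). 1\<^sup>2) * (\<Sum>i\<in>UNIV. ((x $ i)\<^sup>2)\<^sup>2)"
      using Cauchy_Schwarz_ineq_sum[of "\<lambda>_. 1" "\<lambda>i. (x $ i)\<^sup>2" UNIV] by simp
    finally show ?thesis by simp
  qed
  show i: "integrable M (\<lambda>\<omega>. (norm (?D \<omega>)) ^ 4)"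
    by (rule Bochner_Integration.integrable_bound[OF integrable.intros[OF h2]])
      (use le in \<open>auto intro!: AE_I2 order_trans[OF le order_trans[OF _ abs_ge_self]]\<close>)
  have "expectation (\<lambda>\<omega>. (norm (?D \<omega>)) ^ 4) \<le> expectation (\<lambda>\<omega>. real CARD('m) * (\<Sum>i\<in>UNIV. (?D \<omega> $ i) ^ 4))"
    by (intro integral_mono i integrable.intros[OF h2] le)
  then show "expectation (\<lambda>\<omega>. (norm (?D \<omega>)) ^ 4) \<le> 3 * (real CARD('m))\<^sup>2 * (t - s)\<^sup>2"
    using has_bochner_integral_integral_eq[OF h2] by (simp add: power2_eq_square)
qed

end

section \<open>Matrix products and the Hilbert--Schmidt norm\<close>

lemma norm_matrix_vector_mult_le: "norm (A *v x) \<le> norm A * norm x"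
  for A :: "real^'m^'d" and x :: "real^'m"
proof -
  have "norm (A *v x) = L2_set (\<lambda>i. \<bar>A $ i \<bullet> x\<bar>) UNIV"
    by (simp add: norm_vec_def matrix_vector_mul_component)
  also have "\<dots> \<le> L2_set (\<lambda>i. norm (A $ i) * norm x) UNIV"
    by (rule L2_set_mono) (auto simp: Cauchy_Schwarz_ineq2)
  also have "\<dots> = norm A * norm x"
    by (simp add: norm_vec_def[of A] L2_set_right_distrib mult.commute)
  finally show ?thesis .
qed

lemma norm_power2_rows: "(norm A)\<^sup>2 = (\<Sum>i\<in>UNIV. (norm (A $ i))\<^sup>2)" for A :: "real^'m^'d"
  by (simp add: norm_vec_def[of A] L2_set_def sum_nonneg)

text \<open>By duality the square of the left side is \<open>x\<close> paired with
  \<open>A *v (x v* A)\<close>, so the bound for \<open>*v\<close> applies and one factor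
  cancels.\<close>

lemma norm_vector_matrix_mult_le: "norm (x v* A) \<le> norm x * norm A"
  for A :: "real^'m^'d" and x :: "real^'d"
proof -
  have "(norm (x v* A))\<^sup>2 = x \<bullet> (A *v (x v* A))"
    by (simp add: power2_norm_eq_inner dot_lmul_matrix)
  also have "\<dots> \<le> norm x * (norm A * norm (x v* A))"
    by (meson norm_cauchy_schwarz norm_matrix_vector_mult_le mult_left_mono norm_ge_zero order_trans)
  finally have "norm (x v* A) * norm (x v* A) \<le> (norm x * norm A) * norm (x v* A)" by (simp add: power2_eq_square)
  then show ?thesis by (cases "norm (x v* A) = 0") (auto simp: mult_le_cancel_right)
qed

lemma continuous_on_matrix_vector_mult [continuous_intros]:
  fixes f :: "'a::topological_space \<Rightarrow> real^'m^'d"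
  assumes "continuous_on S f" "continuous_on S g"
  shows "continuous_on S (\<lambda>x. f x *v g x)"
  unfolding matrix_vector_mult_def using assms
  by (intro continuous_on_vec_lambda continuous_intros)

lemma continuous_on_vector_matrix_mult [continuous_intros]:
  fixes f :: "'a::topological_space \<Rightarrow> real^'m^'d"
  assumes "continuous_on S f" "continuous_on S g"
  shows "continuous_on S (\<lambda>x. g x v* f x)"
  unfolding vector_matrix_mult_def using assms
  by (intro continuous_on_vec_lambda continuous_intros)

lemma borel_measurable_matrix_vector_mult [measurable (raw)]:
  fixes f :: "'a \<Rightarrow> real^'m^'d"
  assumes "f \<in> borel_measurable N" "g \<in> borel_measurable N"
  shows "(\<lambda>x. f x *v g x) \<in> borel_measurable N"
  by (rule borel_measurable_continuous_Pair[OF assms, where H="\<lambda>A x. A *v x"]) (auto intro!: continuous_intros)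

lemma borel_measurable_vector_matrix_mult [measurable (raw)]:
  fixes f :: "'a \<Rightarrow> real^'m^'d"
  assumes "f \<in> borel_measurable N" "g \<in> borel_measurable N"
  shows "(\<lambda>x. g x v* f x) \<in> borel_measurable N"
  by (rule borel_measurable_continuous_Pair[OF assms, where H="\<lambda>A x. x v* A"]) (auto intro!: continuous_intros)

lemma power2_sum_le: "(a + b)\<^sup>2 \<le> 2 * a\<^sup>2 + 2 * b\<^sup>2" for a b :: real
  by (smt (verit, best) sum_squares_bound power2_sum)

section \<open>Stochastic sums over a partition\<close>

context brownian
begin

lemma increment_matrix_quadratic:
  fixes A :: "'w \<Rightarrow> real ^ 'm ^ 'd" and c :: "'w \<Rightarrow> real"
  assumes st: "0 \<le> s" "s \<le> t"
    and A[measurable]: "A \<in> borel_measurable (F s)" and AB: "\<And>\<omega>. \<omega> \<in> space M \<Longrightarrow> norm (A \<omega>) \<le> B"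
    and c[measurable]: "c \<in> borel_measurable (F s)" and cB: "\<And>\<omega>. \<omega> \<in> space M \<Longrightarrow> \<bar>c \<omega>\<bar> \<le> B'"
  shows "has_bochner_integral M (\<lambda>\<omega>. c \<omega> * (norm (A \<omega> *v (W t \<omega> - W s \<omega>)))\<^sup>2) ((t - s) * expectation (\<lambda>\<omega>. c \<omega> * (norm (A \<omega>))\<^sup>2))"
proof -
  let ?D = "\<lambda>\<omega>. W t \<omega> - W s \<omega>"
  have [measurable]: "(\<lambda>\<omega>. A \<omega> $ i) \<in> borel_measurable (F s)" for i
    by (rule measurable_compose[OF A borel_measurable_continuous_onI]) (intro continuous_intros)
  have row: "norm (A \<omega> $ i) \<le> B" if "\<omega> \<in> space M" for \<omega> i
    using Finite_Cartesian_Product.norm_nth_le[of "A \<omega>" i] AB[OF that] by linarith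
  have int: "integrable M (\<lambda>\<omega>. c \<omega> * (norm (A \<omega> $ i))\<^sup>2)" for i
  proof (rule integrable_bounded_F[of _ s "B' * B\<^sup>2"])
    fix \<omega> assume w: "\<omega> \<in> space M"
    show "norm (c \<omega> * (norm (A \<omega> $ i))\<^sup>2) \<le> B' * B\<^sup>2"
      using row[OF w] cB[OF w] by (auto simp: abs_mult intro!: mult_mono power_mono intro: order_trans[OF abs_ge_zero])
  qed measurable
  have "has_bochner_integral M (\<lambda>\<omega>. \<Sum>i\<in>UNIV. c \<omega> * (A \<omega> $ i \<bullet> ?D \<omega>)\<^sup>2)
    (\<Sum>i\<in>UNIV. (t - s) * expectation (\<lambda>\<omega>. c \<omega> * (norm (A \<omega> $ i))\<^sup>2))"
    by (intro has_bochner_integral_sum increment_quadratic[OF st _ row _ cB]) auto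
  moreover have "(\<Sum>i\<in>UNIV. c \<omega> * (A \<omega> $ i \<bullet> ?D \<omega>)\<^sup>2) = c \<omega> * (norm (A \<omega> *v ?D \<omega>))\<^sup>2" for \<omega>
    by (simp add: norm_vec_def[of "A \<omega> *v _"] L2_set_def sum_nonneg sum_distrib_left matrix_vector_mul_component)
  moreover have "(\<Sum>i\<in>UNIV. (t - s) * expectation (\<lambda>\<omega>. c \<omega> * (norm (A \<omega> $ i))\<^sup>2)) = (t - s) * expectation (\<lambda>\<omega>. c \<omega> * (norm (A \<omega>))\<^sup>2)"
  proof -
    have "expectation (\<lambda>\<omega>. c \<omega> * (norm (A \<omega>))\<^sup>2) = expectation (\<lambda>\<omega>. \<Sum>i\<in>UNIV. c \<omega> * (norm (A \<omega> $ i))\<^sup>2)"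
      by (simp add: norm_power2_rows sum_distrib_left)
    also have "\<dots> = (\<Sum>i\<in>UNIV. expectation (\<lambda>\<omega>. c \<omega> * (norm (A \<omega> $ i))\<^sup>2))"
      by (rule Bochner_Integration.integral_sum) (rule int)
    finally show ?thesis by (simp add: sum_distrib_left)
  qed
  ultimately show ?thesis by simp
qed

text \<open>The stochastic integral of a step integrand over a whole deterministic partition, free
  of the truncation at a time \<open>t\<close> in \<open>simple_ito_integral\<close>. Partitions
  clamped to a window, with cells of length zero, fit this form.\<close>

definition step_sum :: "(nat \<Rightarrow> real) \<Rightarrow> (nat \<Rightarrow> 'w \<Rightarrow> real ^ 'm ^ 'd) \<Rightarrow> nat \<Rightarrow> 'w \<Rightarrow> real ^ 'd" where
  "step_sum q \<xi> m \<omega> = (\<Sum>i<m. \<xi> i \<omega> *v (W (q (Suc i)) \<omega> - W (q i) \<omega>))"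

context
  fixes q :: "nat \<Rightarrow> real" and \<xi> :: "nat \<Rightarrow> 'w \<Rightarrow> real ^ 'm ^ 'd" and m :: nat
  assumes q0: "0 \<le> q 0" and q: "\<And>i. i < m \<Longrightarrow> q i \<le> q (Suc i)"
    and \<xi>: "\<And>i. i < m \<Longrightarrow> \<xi> i \<in> borel_measurable (F (q i))"
    and \<xi>B: "\<And>i. i < m \<Longrightarrow> \<exists>B. \<forall>\<omega>\<in>space M. norm (\<xi> i \<omega>) \<le> B"
begin

lemma step_mono: "i \<le> j \<Longrightarrow> j \<le> m \<Longrightarrow> q i \<le> q j"
proof (induction j)
  case (Suc j)
  then show ?case using q[of j] by (cases "i = Suc j") auto
qed simp

lemma step_nonneg: "i \<le> m \<Longrightarrow> 0 \<le> q i"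
  using step_mono[of 0 i] q0 by simp

lemma step_sum_measurable: "n \<le> m \<Longrightarrow> step_sum q \<xi> n \<in> borel_measurable (F (q n))"
proof (induction n)
  case 0
  then show ?case by (simp add: step_sum_def[abs_def])
next
  case (Suc n)
  have [measurable]: "step_sum q \<xi> n \<in> borel_measurable (F (q (Suc n)))"
    using Suc by (intro measurable_F_mono[OF Suc.IH]) (auto intro: q)
  have [measurable]: "\<xi> n \<in> borel_measurable (F (q (Suc n)))"
    using Suc by (intro measurable_F_mono[OF \<xi>]) (auto intro: q)
  have [measurable]: "W (q n) \<in> borel_measurable (F (q (Suc n)))" "W (q (Suc n)) \<in> borel_measurable (F (q (Suc n)))"
    using Suc by (auto intro!: W_measurable_F step_nonneg q)
  have "step_sum q \<xi> (Suc n) = (\<lambda>\<omega>. step_sum q \<xi> n \<omega> + \<xi> n \<omega> *v (W (q (Suc n)) \<omega> - W (q n) \<omega>))"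
    by (auto simp: step_sum_def fun_eq_iff)
  then show ?case by simp
qed

text \<open>Induction over the cells. In the cross term the earlier sum moves by transposition into
  a factor known at \<open>q n\<close>, so its product with the next increment has mean zero; the
  new square is \<open>increment_matrix_quadratic\<close>.\<close>

lemma step_sum_isometry:
  "n \<le> m \<Longrightarrow> has_bochner_integral M (\<lambda>\<omega>. (norm (step_sum q \<xi> n \<omega>))\<^sup>2)
    (\<Sum>i<n. (q (Suc i) - q i) * expectation (\<lambda>\<omega>. (norm (\<xi> i \<omega>))\<^sup>2))"
proof (induction n)
  case 0
  then show ?case by (simp add: step_sum_def has_bochner_integral_iff)
next
  case (Suc n)
  define D where "D = (\<lambda>\<omega>. W (q (Suc n)) \<omega> - W (q n) \<omega>)"
  let ?S = "step_sum q \<xi> n"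
  have st: "0 \<le> q n" "q n \<le> q (Suc n)" using Suc by (auto intro: step_nonneg q)
  note [measurable] = step_sum_measurable[of n] \<xi>[of n]
  have [measurable]: "?S \<in> borel_measurable (F (q n))" "\<xi> n \<in> borel_measurable (F (q n))"
    using Suc by auto
  obtain B where B: "\<And>\<omega>. \<omega> \<in> space M \<Longrightarrow> norm (\<xi> n \<omega>) \<le> B" using \<xi>B[of n] Suc by auto
  have IH: "has_bochner_integral M (\<lambda>\<omega>. (norm (?S \<omega>))\<^sup>2) (\<Sum>i<n. (q (Suc i) - q i) * expectation (\<lambda>\<omega>. (norm (\<xi> i \<omega>))\<^sup>2))"
    using Suc by simp
  \<comment> \<open>The partial sum is unbounded, but square integrable by the induction hypothesis;
    \<open>x \<le> 1 + x\<^sup>2\<close> turns this into an integrable bound.\<close>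
  have Sint: "integrable M (\<lambda>\<omega>. ?S \<omega> v* \<xi> n \<omega>)"
  proof (rule Bochner_Integration.integrable_bound)
    show "integrable M (\<lambda>\<omega>. \<bar>B\<bar> * (1 + (norm (?S \<omega>))\<^sup>2))"
      using IH by (auto simp: has_bochner_integral_iff)
    show "AE \<omega> in M. norm (?S \<omega> v* \<xi> n \<omega>) \<le> norm (\<bar>B\<bar> * (1 + (norm (?S \<omega>))\<^sup>2))"
    proof (rule AE_I2)
      fix \<omega> assume w: "\<omega> \<in> space M"
      have "norm (?S \<omega> v* \<xi> n \<omega>) \<le> norm (?S \<omega>) * norm (\<xi> n \<omega>)" by (rule norm_vector_matrix_mult_le)
      also have "\<dots> \<le> (1 + (norm (?S \<omega>))\<^sup>2) * \<bar>B\<bar>"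
      proof (rule mult_mono)
        show "norm (?S \<omega>) \<le> 1 + (norm (?S \<omega>))\<^sup>2"
          using sum_squares_bound[of "norm (?S \<omega>)" 1] norm_ge_zero[of "?S \<omega>"] by (simp, linarith)
      qed (use B[OF w] in auto)
      finally show "norm (?S \<omega> v* \<xi> n \<omega>) \<le> norm (\<bar>B\<bar> * (1 + (norm (?S \<omega>))\<^sup>2))" by (simp add: mult.commute abs_mult)
    qed
    show "(\<lambda>\<omega>. ?S \<omega> v* \<xi> n \<omega>) \<in> borel_measurable M" by (rule measurable_F[of _ "q n"]) measurable
  qed
  have c: "has_bochner_integral M (\<lambda>\<omega>. (?S \<omega> v* \<xi> n \<omega>) \<bullet> D \<omega>) 0"
    unfolding D_def by (rule increment_inner_mean[OF st _ Sint]) measurable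
  have d: "has_bochner_integral M (\<lambda>\<omega>. 1 * (norm (\<xi> n \<omega> *v D \<omega>))\<^sup>2) ((q (Suc n) - q n) * expectation (\<lambda>\<omega>. 1 * (norm (\<xi> n \<omega>))\<^sup>2))"
    unfolding D_def by (rule increment_matrix_quadratic[OF st _ B, where c = "\<lambda>_. 1" and B' = 1]) auto
  have "has_bochner_integral M (\<lambda>\<omega>. (norm (?S \<omega>))\<^sup>2 + (2 * ((?S \<omega> v* \<xi> n \<omega>) \<bullet> D \<omega>) + 1 * (norm (\<xi> n \<omega> *v D \<omega>))\<^sup>2))
      ((\<Sum>i<n. (q (Suc i) - q i) * expectation (\<lambda>\<omega>. (norm (\<xi> i \<omega>))\<^sup>2)) + (2 * 0 + (q (Suc n) - q n) * expectation (\<lambda>\<omega>. 1 * (norm (\<xi> n \<omega>))\<^sup>2)))"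
    by (intro has_bochner_integral_add IH c d has_bochner_integral_mult_right)
  moreover have "(norm (?S \<omega>))\<^sup>2 + (2 * ((?S \<omega> v* \<xi> n \<omega>) \<bullet> D \<omega>) + 1 * (norm (\<xi> n \<omega> *v D \<omega>))\<^sup>2) = (norm (step_sum q \<xi> (Suc n) \<omega>))\<^sup>2" for \<omega>
    unfolding dot_lmul_matrix
    by (simp add: step_sum_def D_def power2_norm_eq_inner inner_add_left inner_add_right inner_commute)
  ultimately show ?case by simp
qed

text \<open>Martingale property in tested form: by transposition \<open>Z\<close> becomes part of
  the coefficient of each cell, which remains known at the left endpoint since \<open>Z\<close> is
  known at \<open>q 0\<close>.\<close>

lemma step_sum_mean:
  assumes Z: "Z \<in> borel_measurable (F (q 0))" "\<And>\<omega>. \<omega> \<in> space M \<Longrightarrow> norm (Z \<omega>) \<le> K"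
  shows "has_bochner_integral M (\<lambda>\<omega>. Z \<omega> \<bullet> step_sum q \<xi> m \<omega>) 0"
proof -
  have "has_bochner_integral M (\<lambda>\<omega>. (Z \<omega> v* \<xi> i \<omega>) \<bullet> (W (q (Suc i)) \<omega> - W (q i) \<omega>)) 0" if i: "i < m" for i
  proof -
    have [measurable]: "Z \<in> borel_measurable (F (q i))" "\<xi> i \<in> borel_measurable (F (q i))"
      using i \<xi> by (auto intro!: measurable_F_mono[OF Z(1)] step_mono)
    obtain B where B: "\<And>\<omega>. \<omega> \<in> space M \<Longrightarrow> norm (\<xi> i \<omega>) \<le> B" using \<xi>B[OF i] by auto
    have m: "(\<lambda>\<omega>. Z \<omega> v* \<xi> i \<omega>) \<in> borel_measurable (F (q i))" by measurable
    show ?thesis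
    proof (rule increment_inner_mean[OF _ _ m])
      show "integrable M (\<lambda>\<omega>. Z \<omega> v* \<xi> i \<omega>)"
      proof (rule integrable_bounded_F[OF m])
        fix \<omega> assume w: "\<omega> \<in> space M"
        have "norm (Z \<omega> v* \<xi> i \<omega>) \<le> norm (Z \<omega>) * norm (\<xi> i \<omega>)" by (rule norm_vector_matrix_mult_le)
        also have "\<dots> \<le> K * B" using B[OF w] Z(2)[OF w] by (intro mult_mono) (auto intro: order_trans[OF norm_ge_zero])
        finally show "norm (Z \<omega> v* \<xi> i \<omega>) \<le> K * B" .
      qed
    qed (use i in \<open>auto intro: step_nonneg q\<close>)
  qed
  then have "has_bochner_integral M (\<lambda>\<omega>. \<Sum>i<m. (Z \<omega> v* \<xi> i \<omega>) \<bullet> (W (q (Suc i)) \<omega> - W (q i) \<omega>)) (\<Sum>i<m. 0)"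
    by (intro has_bochner_integral_sum) auto
  then show ?thesis by (simp add: step_sum_def inner_sum_right dot_lmul_matrix)
qed

end
end

section \<open>Simple integrals and the isometry\<close>

text \<open>Left-open cells tile the interval without overlap, and an empty cell imposes no
  condition on \<open>g\<close>.\<close>

lemma nn_integral_step_function:
  fixes q :: "nat \<Rightarrow> real" and g :: "real \<Rightarrow> ennreal"
  assumes q: "\<And>i. i < m \<Longrightarrow> q i \<le> q (Suc i)"
    and g: "\<And>i u. i < m \<Longrightarrow> q i < u \<Longrightarrow> u \<le> q (Suc i) \<Longrightarrow> g u = c i"
  shows "(\<integral>\<^sup>+u\<in>{q 0<..q m}. g u \<partial>lborel) = (\<Sum>i<m. ennreal (q (Suc i) - q i) * c i)"
proof -
  have "q 0 \<le> q n" if "n \<le> m" for n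
    using that by (induction n) (auto intro: order_trans[OF _ q])
  have split: "(\<lambda>u. g u * indicator {q 0<..q n} u) = (\<lambda>u. \<Sum>i<n. c i * indicator {q i<..q (Suc i)} u) \<and> q 0 \<le> q n" if "n \<le> m" for n
    using that
  proof (induction n)
    case (Suc n)
    then have a: "q 0 \<le> q n" "q n \<le> q (Suc n)" and IH: "(\<lambda>u. g u * indicator {q 0<..q n} u) = (\<lambda>u. \<Sum>i<n. c i * indicator {q i<..q (Suc i)} u)"
      using q by auto
    have "g u * indicator {q 0<..q (Suc n)} u = g u * indicator {q 0<..q n} u + c n * indicator {q n<..q (Suc n)} u" for u
      using g[of n u] Suc(2) a by (auto simp: indicator_def)
    then show ?case using fun_cong[OF IH] a by auto
  qed auto
  show "(\<integral>\<^sup>+u\<in>{q 0<..q m}. g u \<partial>lborel) = (\<Sum>i<m. ennreal (q (Suc i) - q i) * c i)"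
    by (subst conjunct1[OF split[OF order_refl]], subst nn_integral_sum, simp, intro sum.cong refl,
      subst nn_integral_cmult_indicator, simp, simp add: q mult.commute)
qed

text \<open>Fatou along an almost surely convergent subsequence. The bound is required only
  eventually and up to \<open>e\<close>, as the approximating integrals satisfy theirs only in the
  limit.\<close>

lemma (in prob_space) prob_tendsto_imp_L2_bound:
  fixes S :: "'a \<Rightarrow> 'e::{banach, second_countable_topology}"
  assumes [measurable]: "\<And>n. Sn n \<in> borel_measurable M" "S \<in> borel_measurable M"
    and conv: "\<And>\<epsilon>. 0 < \<epsilon> \<Longrightarrow> (\<lambda>n. prob {\<omega> \<in> space M. \<epsilon> < norm (Sn n \<omega> - S \<omega>)}) \<longlonglongrightarrow> 0"
    and c: "\<And>e. 0 < e \<Longrightarrow> \<forall>\<^sub>F n in sequentially. (\<integral>\<^sup>+\<omega>. ennreal ((norm (Sn n \<omega>))\<^sup>2) \<partial>M) \<le> c + ennreal e"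
  shows "(\<integral>\<^sup>+\<omega>. ennreal ((norm (S \<omega>))\<^sup>2) \<partial>M) \<le> c"
proof -
  \<comment> \<open>Truncation at 1 makes the distance integrable, so that convergence in
    probability becomes L1 convergence, from which an almost surely convergent subsequence is
    extracted.\<close>
  define u where "u n \<omega> = min 1 (norm (Sn n \<omega> - S \<omega>))" for n \<omega>
  have u[measurable]: "u n \<in> borel_measurable M" for n unfolding u_def by measurable
  have ui: "integrable M (u n)" for n
    by (rule integrable_const_bound[of _ 1]) (auto simp: u_def)
  have "(\<lambda>n. expectation (\<lambda>\<omega>. norm (u n \<omega>))) \<longlonglongrightarrow> 0"
  proof (rule LIMSEQ_I)
    fix e :: real assume e: "0 < e"
    have "\<forall>\<^sub>F n in sequentially. prob {\<omega> \<in> space M. e/2 < norm (Sn n \<omega> - S \<omega>)} < e/2"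
      using order_tendstoD(2)[OF conv[of "e/2"], of "e/2"] e by auto
    then obtain N where N: "\<And>n. n \<ge> N \<Longrightarrow> prob {\<omega> \<in> space M. e/2 < norm (Sn n \<omega> - S \<omega>)} < e/2"
      unfolding eventually_sequentially by auto
    show "\<exists>no. \<forall>n\<ge>no. norm (expectation (\<lambda>\<omega>. norm (u n \<omega>)) - 0) < e"
    proof (intro exI allI impI)
      fix n assume n: "N \<le> n"
      have ii: "integrable M (indicator {\<omega> \<in> space M. e/2 < norm (Sn n \<omega> - S \<omega>)} :: _ \<Rightarrow> real)"
        by (intro integrable_real_indicator) (auto simp: emeasure_eq_measure)
      have "expectation (\<lambda>\<omega>. norm (u n \<omega>)) \<le> expectation (\<lambda>\<omega>. e/2 + indicator {\<omega> \<in> space M. e/2 < norm (Sn n \<omega> - S \<omega>)} \<omega>)"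
        by (intro integral_mono integrable_norm ui Bochner_Integration.integrable_add integrable_const ii)
          (use e in \<open>auto simp: u_def indicator_def\<close>)
      also have "\<dots> = e/2 + prob {\<omega> \<in> space M. e/2 < norm (Sn n \<omega> - S \<omega>)}"
        by (subst Bochner_Integration.integral_add[OF integrable_const ii]) (simp_all add: prob_space)
      finally show "norm (expectation (\<lambda>\<omega>. norm (u n \<omega>)) - 0) < e" using N[OF n] by simp
    qed
  qed
  from tendsto_L1_AE_subseq[OF ui this] obtain r :: "nat \<Rightarrow> nat" where r: "strict_mono r" "AE \<omega> in M. (\<lambda>n. u (r n) \<omega>) \<longlonglongrightarrow> 0"
    by auto
  have "AE \<omega> in M. liminf (\<lambda>n. ennreal ((norm (Sn (r n) \<omega>))\<^sup>2)) = ennreal ((norm (S \<omega>))\<^sup>2)"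
    using r(2)
  proof eventually_elim
    case (elim \<omega>)
    have "\<forall>\<^sub>F n in sequentially. u (r n) \<omega> < 1" using order_tendstoD(2)[OF elim, of 1] by simp
    then have "\<forall>\<^sub>F n in sequentially. u (r n) \<omega> = norm (Sn (r n) \<omega> - S \<omega>)"
      by eventually_elim (auto simp: u_def)
    then have "(\<lambda>n. norm (Sn (r n) \<omega> - S \<omega>)) \<longlonglongrightarrow> 0" using elim by (rule Lim_transform_eventually[rotated])
    then have "(\<lambda>n. Sn (r n) \<omega>) \<longlonglongrightarrow> S \<omega>" by (simp add: tendsto_norm_zero_iff LIM_zero_iff)
    then have "(\<lambda>n. ennreal ((norm (Sn (r n) \<omega>))\<^sup>2)) \<longlonglongrightarrow> ennreal ((norm (S \<omega>))\<^sup>2)"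
      by (intro tendsto_intros)
    then show ?case by (rule lim_imp_Liminf[rotated]) simp
  qed
  then have "(\<integral>\<^sup>+\<omega>. ennreal ((norm (S \<omega>))\<^sup>2) \<partial>M) = (\<integral>\<^sup>+\<omega>. liminf (\<lambda>n. ennreal ((norm (Sn (r n) \<omega>))\<^sup>2)) \<partial>M)"
    by (intro nn_integral_cong_AE) auto
  also have "\<dots> \<le> liminf (\<lambda>n. \<integral>\<^sup>+\<omega>. ennreal ((norm (Sn (r n) \<omega>))\<^sup>2) \<partial>M)"
    by (rule nn_integral_liminf) measurable
  also have "\<dots> \<le> c"
  proof (rule ennreal_le_epsilon)
    fix e :: real assume "0 < e"
    from c[OF this] have "\<forall>\<^sub>F n in sequentially. (\<integral>\<^sup>+\<omega>. ennreal ((norm (Sn (r n) \<omega>))\<^sup>2) \<partial>M) \<le> c + ennreal e"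
      using eventually_subseq[OF r(1)] by auto
    then show "liminf (\<lambda>n. \<integral>\<^sup>+\<omega>. ennreal ((norm (Sn (r n) \<omega>))\<^sup>2) \<partial>M) \<le> c + ennreal e"
      by (intro Liminf_le) auto
  qed
  finally show ?thesis .
qed

text \<open>A common second moment bound gives uniform integrability. Concretely, where the distance
  \<open>x\<close> exceeds \<open>e/3\<close> one uses
  \<open>x \<le> a * x\<^sup>2 + 1 / (4 * a)\<close>: the first term is small in mean by the choice
  of \<open>a\<close>, the second because that set has small probability.\<close>

lemma (in prob_space) prob_tendsto_imp_L1_tendsto:
  fixes S :: "'a \<Rightarrow> 'e::{banach, second_countable_topology}"
  assumes [measurable]: "\<And>n. Sn n \<in> borel_measurable M" "S \<in> borel_measurable M"
    and conv: "\<And>\<epsilon>. 0 < \<epsilon> \<Longrightarrow> (\<lambda>n. prob {\<omega> \<in> space M. \<epsilon> < norm (Sn n \<omega> - S \<omega>)}) \<longlonglongrightarrow> 0"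
    and c: "\<And>n. integrable M (\<lambda>\<omega>. (norm (Sn n \<omega>))\<^sup>2)" "\<forall>\<^sub>F n in sequentially. expectation (\<lambda>\<omega>. (norm (Sn n \<omega>))\<^sup>2) \<le> c"
    and S: "integrable M (\<lambda>\<omega>. (norm (S \<omega>))\<^sup>2)" "expectation (\<lambda>\<omega>. (norm (S \<omega>))\<^sup>2) \<le> c"
  shows "(\<lambda>n. expectation (\<lambda>\<omega>. norm (Sn n \<omega> - S \<omega>))) \<longlonglongrightarrow> 0"
proof (rule LIMSEQ_I)
  have c0: "0 \<le> c" using S(2) by (rule order_trans[rotated]) simp
  fix e :: real assume e: "0 < e"
  \<comment> \<open>The expected squared distance is at most \<open>4 * c\<close>, so its share
    becomes at most \<open>e/3\<close>. The added 1 avoids a zero denominator.\<close>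
  define a where "a = e / (4 * c + 1) / 3"
  have a: "0 < a" using e c0 by (simp add: a_def)
  have a4: "a * (4 * c) \<le> e / 3" using e c0 by (simp add: a_def field_simps)
  have "\<forall>\<^sub>F n in sequentially. prob {\<omega> \<in> space M. e/3 < norm (Sn n \<omega> - S \<omega>)} < 4 * a * (e/3)"
    using order_tendstoD(2)[OF conv[of "e/3"], of "4 * a * (e/3)"] e a by auto
  from eventually_conj[OF this c(2)] obtain N where N: "\<And>n. n \<ge> N \<Longrightarrow> prob {\<omega> \<in> space M. e/3 < norm (Sn n \<omega> - S \<omega>)} < 4 * a * (e/3)"
      "\<And>n. n \<ge> N \<Longrightarrow> expectation (\<lambda>\<omega>. (norm (Sn n \<omega>))\<^sup>2) \<le> c"
    unfolding eventually_sequentially by auto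
  show "\<exists>no. \<forall>n\<ge>no. norm (expectation (\<lambda>\<omega>. norm (Sn n \<omega> - S \<omega>)) - 0) < e"
  proof (intro exI allI impI)
    fix n assume n: "N \<le> n"
    let ?B = "{\<omega> \<in> space M. e/3 < norm (Sn n \<omega> - S \<omega>)}"
    let ?g = "\<lambda>\<omega>. e/3 + (a * (2 * (norm (Sn n \<omega>))\<^sup>2 + 2 * (norm (S \<omega>))\<^sup>2) + indicator ?B \<omega> / (4 * a))"
    have ii: "integrable M (indicator ?B :: _ \<Rightarrow> real)"
      by (intro integrable_real_indicator) (auto simp: emeasure_eq_measure)
    have gi: "integrable M ?g"
      by (intro Bochner_Integration.integrable_add integrable_const integrable_mult_right integrable_divide c(1) S(1) ii)
    have pt: "norm (Sn n \<omega> - S \<omega>) \<le> ?g \<omega>" if "\<omega> \<in> space M" for \<omega>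
    proof -
      define x where "x = norm (Sn n \<omega> - S \<omega>)"
      have "x \<le> norm (Sn n \<omega>) + norm (S \<omega>)" unfolding x_def by (rule norm_triangle_ineq4)
      then have "x\<^sup>2 \<le> (norm (Sn n \<omega>) + norm (S \<omega>))\<^sup>2" by (intro power_mono) (auto simp: x_def)
      also have "\<dots> \<le> 2 * (norm (Sn n \<omega>))\<^sup>2 + 2 * (norm (S \<omega>))\<^sup>2" by (rule power2_sum_le)
      finally have x2: "a * x\<^sup>2 \<le> a * (2 * (norm (Sn n \<omega>))\<^sup>2 + 2 * (norm (S \<omega>))\<^sup>2)" using a by simp
      show ?thesis
      proof (cases "e/3 < x")
        case True
        then have "\<omega> \<in> ?B" using that by (simp add: x_def)
        moreover have "x \<le> a * x\<^sup>2 + 1 / (4 * a)"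
        proof -
          have "0 \<le> (2 * a * x - 1)\<^sup>2 / (4 * a)" using a by simp
          also have "\<dots> = a * x\<^sup>2 + 1 / (4 * a) - x" using a by (simp add: power2_eq_square field_simps)
          finally show ?thesis by simp
        qed
        ultimately show ?thesis using x2 e unfolding x_def by simp
      next
        case False
        have "0 \<le> a * (2 * (norm (Sn n \<omega>))\<^sup>2 + 2 * (norm (S \<omega>))\<^sup>2)" using a by simp
        moreover have "0 \<le> indicator ?B \<omega> / (4 * a)" using a by simp
        ultimately show ?thesis using False unfolding x_def by linarith
      qed
    qed
    have "expectation (\<lambda>\<omega>. norm (Sn n \<omega> - S \<omega>)) \<le> expectation ?g"
    proof (rule integral_mono[OF _ gi pt])
      show "integrable M (\<lambda>\<omega>. norm (Sn n \<omega> - S \<omega>))"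
      proof (rule Bochner_Integration.integrable_bound[OF gi])
        show "AE \<omega> in M. norm (norm (Sn n \<omega> - S \<omega>)) \<le> norm (?g \<omega>)"
          unfolding real_norm_def abs_norm_cancel by (rule AE_I2) (rule order_trans[OF pt abs_ge_self])
      qed measurable
    qed
    also have "\<dots> = e/3 + (a * (2 * expectation (\<lambda>\<omega>. (norm (Sn n \<omega>))\<^sup>2) + 2 * expectation (\<lambda>\<omega>. (norm (S \<omega>))\<^sup>2)) + prob ?B / (4 * a))"
    proof (rule has_bochner_integral_integral_eq, intro has_bochner_integral_add has_bochner_integral_mult_right has_bochner_integral_divide_zero)
      show "has_bochner_integral M (\<lambda>_. e) e" by (simp add: has_bochner_integral_iff prob_space)
      show "has_bochner_integral M (indicator ?B) (prob ?B)"
        by (rule has_bochner_integral_real_indicator) (auto simp: emeasure_eq_measure)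
    qed (use c(1) S(1) in \<open>auto simp: has_bochner_integral_iff\<close>)
    also have "\<dots> < e/3 + (e/3 + e/3)"
    proof -
      have "a * (2 * expectation (\<lambda>\<omega>. (norm (Sn n \<omega>))\<^sup>2) + 2 * expectation (\<lambda>\<omega>. (norm (S \<omega>))\<^sup>2)) \<le> a * (4 * c)"
        using N(2)[OF n] S(2) a by (intro mult_left_mono) auto
      moreover have "prob ?B / (4 * a) < e/3" using N(1)[OF n] a by (simp add: field_simps)
      ultimately show ?thesis using a4 by linarith
    qed
    finally show "norm (expectation (\<lambda>\<omega>. norm (Sn n \<omega> - S \<omega>)) - 0) < e" by simp
  qed
qed

section \<open>Simple integrands on a time window\<close>

context brownian
begin

lemma simple_integrand_mono:
  assumes "simple_integrand M F k p \<xi>"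
  shows "i \<le> j \<Longrightarrow> j \<le> k \<Longrightarrow> p i \<le> p j" "i \<le> k \<Longrightarrow> 0 \<le> p i"
proof -
  have s: "p i < p (Suc i)" if "i < k" for i using that assms by (auto simp: simple_integrand_def)
  show a: "i \<le> j \<Longrightarrow> j \<le> k \<Longrightarrow> p i \<le> p j" for i j
  proof (induction j)
    case (Suc j) then show ?case using s[of j] by (cases "i = Suc j") auto
  qed simp
  show "i \<le> k \<Longrightarrow> 0 \<le> p i" using a[of 0 i] assms by (auto simp: simple_integrand_def)
qed

lemma simple_integrandD:
  assumes "simple_integrand M F k p \<xi>"
  shows "0 \<le> p 0" "i < k \<Longrightarrow> p i < p (Suc i)" "i < k \<Longrightarrow> \<xi> i \<in> borel_measurable (F (p i))"
    "i < k \<Longrightarrow> \<exists>B. \<forall>\<omega>\<in>space M. norm (\<xi> i \<omega>) \<le> B"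
  using assms by (auto simp: simple_integrand_def)

lemma simple_process_eq:
  assumes si: "simple_integrand M F k p \<xi>" and i: "i < k" "p i < u" "u \<le> p (Suc i)"
  shows "simple_process k p \<xi> u \<omega> = \<xi> i \<omega>"
proof -
  have "indicator {p j<..p (Suc j)} u *\<^sub>R \<xi> j \<omega> = (if j = i then \<xi> i \<omega> else 0)" if "j < k" for j
  proof (cases "j = i")
    case False
    then consider "Suc j \<le> i" | "Suc i \<le> j" by linarith
    then have "u \<notin> {p j<..p (Suc j)}"
      using simple_integrand_mono(1)[OF si, of "Suc j" i] simple_integrand_mono(1)[OF si, of "Suc i" j] i that
      by cases auto
    then show ?thesis using False by simp
  qed (use i in auto)
  then show ?thesis using i by (simp add: simple_process_def)
qed

lemma simple_process_eq_0:
  assumes si: "simple_integrand M F k p \<xi>" and u: "u \<le> p 0 \<or> p k < u"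
  shows "simple_process k p \<xi> u \<omega> = 0"
proof -
  have "u \<notin> {p j<..p (Suc j)}" if "j < k" for j
    using simple_integrand_mono(1)[OF si, of 0 j] simple_integrand_mono(1)[OF si, of "Suc j" k] u that by auto
  then show ?thesis by (simp add: simple_process_def)
qed

text \<open>
  The partition of \<open>[s, t]\<close> induced by \<open>p\<close> has the points \<open>s\<close>, then \<open>p 0, \<dots>, p k\<close> clamped to \<open>[s, t]\<close>, then \<open>t\<close>.
  The coefficient of a cell is the value there of the simple process; cells that clamping has
  collapsed at \<open>t\<close> get the coefficient \<open>0\<close> because \<open>\<xi>\<close> need not be known at time \<open>t\<close>.
\<close>

definition window :: "nat \<Rightarrow> (nat \<Rightarrow> real) \<Rightarrow> real \<Rightarrow> real \<Rightarrow> nat \<Rightarrow> real" where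
  "window k p s t i = (if i = 0 then s else if i \<le> Suc k then max s (min t (p (i - 1))) else t)"

definition window_coeff :: "nat \<Rightarrow> (nat \<Rightarrow> real) \<Rightarrow> (nat \<Rightarrow> 'w \<Rightarrow> real^'m^'d) \<Rightarrow> real \<Rightarrow> nat \<Rightarrow> 'w \<Rightarrow> real^'m^'d" where
  "window_coeff k p \<xi> t i \<omega> = (if 0 < i \<and> i \<le> k \<and> p (i - 1) < t then \<xi> (i - 1) \<omega> else 0)"

context
  fixes k p and \<xi> :: "nat \<Rightarrow> 'w \<Rightarrow> real^'m^'d" and s t :: real
  assumes si: "simple_integrand M F k p \<xi>" and st: "0 \<le> s" "s \<le> t"
begin

lemma window_ends: "window k p s t 0 = s" "window k p s t (Suc (Suc k)) = t"
  by (auto simp: window_def)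

lemma window_mono: "i < Suc (Suc k) \<Longrightarrow> window k p s t i \<le> window k p s t (Suc i)"
  using simple_integrand_mono(1)[OF si, of "i - 1" i] st by (auto simp: window_def)

lemma window_ge: "s \<le> window k p s t i"
  using st by (auto simp: window_def)

lemma window_coeff_measurable: "window_coeff k p \<xi> t i \<in> borel_measurable (F (window k p s t i))"
proof (cases "0 < i \<and> i \<le> k \<and> p (i - 1) < t")
  case True
  then have "\<xi> (i - 1) \<in> borel_measurable (F (p (i - 1)))" using simple_integrandD(3)[OF si, of "i - 1"] by auto
  then have "\<xi> (i - 1) \<in> borel_measurable (F (window k p s t i))"
    by (rule measurable_F_mono) (use True in \<open>auto simp: window_def\<close>)
  then show ?thesis using True by (simp add: window_coeff_def[abs_def])
next
  case False
  then have "window_coeff k p \<xi> t i = (\<lambda>_. 0)" unfolding window_coeff_def by auto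
  then show ?thesis by simp
qed

lemma window_coeff_bounded: "\<exists>B. \<forall>\<omega>\<in>space M. norm (window_coeff k p \<xi> t i \<omega>) \<le> B"
proof (cases "0 < i \<and> i \<le> k \<and> p (i - 1) < t")
  case True
  then show ?thesis using simple_integrandD(4)[OF si, of "i - 1"] by (auto simp: window_coeff_def)
qed (auto simp: window_coeff_def intro!: exI[of _ 0])

lemma simple_process_window:
  assumes i: "i < Suc (Suc k)" "window k p s t i < u" "u \<le> window k p s t (Suc i)"
  shows "simple_process k p \<xi> u \<omega> = window_coeff k p \<xi> t i \<omega>"
proof (cases "i = 0 \<or> i = Suc k")
  case True
  \<comment> \<open>When nonempty, the first cell lies before \<open>p 0\<close> and the last one
    after \<open>p k\<close>, where the simple process vanishes.\<close>
  then have "u \<le> p 0 \<or> p k < u" using i st by (auto simp: window_def max_def min_def split: if_splits)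
  then show ?thesis using simple_process_eq_0[OF si] True by (auto simp: window_coeff_def)
next
  case False
  then obtain j where j: "i = Suc j" "j < k" using i by (cases i) auto
  then have "p j < u" "u \<le> p (Suc j)" "p j < t" using i by (auto simp: window_def max_def min_def split: if_splits)
  then show ?thesis using simple_process_eq[OF si j(2)] j by (auto simp: window_coeff_def)
qed

lemma simple_ito_integral_window:
  "simple_ito_integral W k p \<xi> t \<omega> - simple_ito_integral W k p \<xi> s \<omega> =
    step_sum (window k p s t) (window_coeff k p \<xi> t) (Suc (Suc k)) \<omega>"
proof -
  let ?c = "\<lambda>x. max s (min t x)"
  \<comment> \<open>For \<open>x \<ge> s\<close> the clamp is \<open>min t x\<close> while
    \<open>min s x = s\<close>; for \<open>x < s\<close> both minima are \<open>x\<close> and the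
    clamp is \<open>s\<close>. Clamped increments are therefore differences of the increments
    stopped at \<open>t\<close> and at \<open>s\<close>.\<close>
  have c: "W (?c x) \<omega> = W (min t x) \<omega> - W (min s x) \<omega> + W s \<omega>" for x
    using st by (auto simp: min_def max_def)
  have "step_sum (window k p s t) (window_coeff k p \<xi> t) (Suc (Suc k)) \<omega> =
    (\<Sum>j<k. (if p j < t then \<xi> j \<omega> else 0) *v (W (?c (p (Suc j))) \<omega> - W (?c (p j)) \<omega>))"
    unfolding step_sum_def
    by (subst sum.lessThan_Suc_shift, subst sum.lessThan_Suc)
      (auto simp: window_coeff_def window_def Suc_le_eq intro!: sum.cong)
  also have "\<dots> = (\<Sum>j<k. \<xi> j \<omega> *v (W (?c (p (Suc j))) \<omega> - W (?c (p j)) \<omega>))"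
  proof (rule sum.cong[OF refl])
    fix j assume "j \<in> {..<k}"
    then have "p j \<le> p (Suc j)" using simple_integrand_mono(1)[OF si, of j "Suc j"] by auto
    then show "(if p j < t then \<xi> j \<omega> else 0) *v (W (?c (p (Suc j))) \<omega> - W (?c (p j)) \<omega>) = \<xi> j \<omega> *v (W (?c (p (Suc j))) \<omega> - W (?c (p j)) \<omega>)"
      by (auto simp: min_def)
  qed
  also have "\<dots> = simple_ito_integral W k p \<xi> t \<omega> - simple_ito_integral W k p \<xi> s \<omega>"
    unfolding simple_ito_integral_def sum_subtractf[symmetric] matrix_vector_mult_diff_distrib[symmetric]
    by (intro sum.cong refl arg_cong2[where f="(*v)"]) (simp add: c)
  finally show ?thesis ..
qed

lemma simple_process_nn_integral:
  fixes g :: "real^'m^'d \<Rightarrow> ennreal"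
  shows "(\<integral>\<^sup>+u\<in>{s<..t}. g (simple_process k p \<xi> u \<omega>) \<partial>lborel) =
    (\<Sum>i<Suc (Suc k). ennreal (window k p s t (Suc i) - window k p s t i) * g (window_coeff k p \<xi> t i \<omega>))"
  using nn_integral_step_function[of "Suc (Suc k)" "window k p s t" "\<lambda>u. g (simple_process k p \<xi> u \<omega>)" "\<lambda>i. g (window_coeff k p \<xi> t i \<omega>)"]
    window_mono simple_process_window by (simp add: window_ends del: sum.lessThan_Suc)

end

text \<open>The increments telescope, so a common \<open>h\<close> comes out of the sum. This
  presents the error of freezing a coefficient as a step sum, to which the isometry applies.\<close>

lemma step_sum_diff: "step_sum q (\<lambda>i \<omega>. \<xi> i \<omega> - h \<omega>) m \<omega> = step_sum q \<xi> m \<omega> - h \<omega> *v (W (q m) \<omega> - W (q 0) \<omega>)"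
proof -
  have "W (q m) \<omega> - W (q 0) \<omega> = (\<Sum>i<m. W (q (Suc i)) \<omega> - W (q i) \<omega>)"
    by (rule sum_lessThan_telescope[symmetric])
  then show ?thesis
    unfolding step_sum_def matrix_vector_mult_diff_rdistrib
    by (simp only: sum_subtractf[where f = "\<lambda>i. \<xi> i \<omega> *v _ i"] linear_sum[OF matrix_vector_mul_linear])
qed

end

context brownian
begin

lemma simple_ito_integral_measurable:
  assumes si: "simple_integrand M F k p \<xi>" and t: "0 \<le> t"
  shows "simple_ito_integral W k p \<xi> t \<in> borel_measurable M"
proof -
  have "(\<lambda>\<omega>. \<xi> i \<omega> *v (W (min t (p (Suc i))) \<omega> - W (min t (p i)) \<omega>)) \<in> borel_measurable M" if "i < k" for i
    using measurable_F[OF simple_integrandD(3)[OF si that]]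
      simple_integrand_mono(2)[OF si, of i] simple_integrand_mono(2)[OF si, of "Suc i"] t that
    by (intro borel_measurable_matrix_vector_mult borel_measurable_diff W_measurable) auto
  then show ?thesis unfolding simple_ito_integral_def[abs_def] by (intro borel_measurable_sum) auto
qed

text \<open>\<open>h\<close> is known at \<open>s\<close> and hence admissible as a coefficient on
  every cell of the window. The freezing error is itself a step sum, with coefficients
  \<open>window_coeff - h\<close>, and the isometry gives its second moment exactly.\<close>

lemma simple_ito_increment:
  fixes \<xi> :: "nat \<Rightarrow> 'w \<Rightarrow> real^'m^'d"
  assumes si: "simple_integrand M F k p \<xi>" and st: "0 \<le> s" "s \<le> t"
    and h: "h \<in> borel_measurable (F s)" and hB: "\<And>\<omega>. \<omega> \<in> space M \<Longrightarrow> norm (h \<omega>) \<le> B"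
  shows "integrable M (\<lambda>\<omega>. (norm (simple_ito_integral W k p \<xi> t \<omega> - simple_ito_integral W k p \<xi> s \<omega> - h \<omega> *v (W t \<omega> - W s \<omega>)))\<^sup>2)"
    and "(\<integral>\<^sup>+\<omega>. ennreal ((norm (simple_ito_integral W k p \<xi> t \<omega> - simple_ito_integral W k p \<xi> s \<omega> - h \<omega> *v (W t \<omega> - W s \<omega>)))\<^sup>2) \<partial>M)
      = (\<integral>\<^sup>+\<omega>. (\<integral>\<^sup>+u\<in>{s<..t}. ennreal ((norm (simple_process k p \<xi> u \<omega> - h \<omega>))\<^sup>2) \<partial>lborel) \<partial>M)"
proof -
  let ?q = "window k p s t" and ?\<xi> = "window_coeff k p \<xi> t" and ?n = "Suc (Suc k)"
  have q: "\<And>i. i < ?n \<Longrightarrow> ?q i \<le> ?q (Suc i)" by (rule window_mono[OF si st])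
  have q0: "0 \<le> ?q 0" using st by (simp add: window_ends[OF si st])
  let ?\<eta> = "\<lambda>i \<omega>. ?\<xi> i \<omega> - h \<omega>"
  have m[measurable]: "?\<eta> i \<in> borel_measurable (F (?q i))" for i
    by (intro borel_measurable_diff window_coeff_measurable[OF si st] measurable_F_mono[OF h] window_ge[OF si st])
  have mM[measurable]: "?\<eta> i \<in> borel_measurable M" for i by (rule measurable_F[OF m])
  have b: "\<exists>B. \<forall>\<omega>\<in>space M. norm (?\<eta> i \<omega>) \<le> B" for i
  proof -
    obtain B' where "\<forall>\<omega>\<in>space M. norm (?\<xi> i \<omega>) \<le> B'" using window_coeff_bounded[OF si st] by blast
    then have "\<forall>\<omega>\<in>space M. norm (?\<eta> i \<omega>) \<le> B' + B" using hB by (auto intro!: norm_triangle_le_diff add_mono)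
    then show ?thesis by blast
  qed
  have eq: "simple_ito_integral W k p \<xi> t \<omega> - simple_ito_integral W k p \<xi> s \<omega> - h \<omega> *v (W t \<omega> - W s \<omega>) = step_sum ?q ?\<eta> ?n \<omega>" for \<omega>
    by (simp only: simple_ito_integral_window[OF si st] step_sum_diff window_ends[OF si st])
  have iso: "has_bochner_integral M (\<lambda>\<omega>. (norm (step_sum ?q ?\<eta> ?n \<omega>))\<^sup>2)
    (\<Sum>i<?n. (?q (Suc i) - ?q i) * expectation (\<lambda>\<omega>. (norm (?\<eta> i \<omega>))\<^sup>2))"
    by (rule step_sum_isometry[of ?q ?n ?\<eta> ?n]) (auto simp del: sum.lessThan_Suc intro: q q0 m b)
  then show "integrable M (\<lambda>\<omega>. (norm (simple_ito_integral W k p \<xi> t \<omega> - simple_ito_integral W k p \<xi> s \<omega> - h \<omega> *v (W t \<omega> - W s \<omega>)))\<^sup>2)"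
    unfolding eq by (simp add: has_bochner_integral_iff)
  have "(\<integral>\<^sup>+\<omega>. ennreal ((norm (step_sum ?q ?\<eta> ?n \<omega>))\<^sup>2) \<partial>M) = ennreal (\<Sum>i<?n. (?q (Suc i) - ?q i) * expectation (\<lambda>\<omega>. (norm (?\<eta> i \<omega>))\<^sup>2))"
    using iso by (subst nn_integral_eq_integral) (auto simp: has_bochner_integral_iff)
  also have "\<dots> = (\<Sum>i<?n. ennreal (?q (Suc i) - ?q i) * ennreal (expectation (\<lambda>\<omega>. (norm (?\<eta> i \<omega>))\<^sup>2)))"
    using q by (subst sum_ennreal[symmetric]) (auto simp: ennreal_mult simp del: sum.lessThan_Suc intro!: sum.cong)
  also have "\<dots> = (\<Sum>i<?n. ennreal (?q (Suc i) - ?q i) * (\<integral>\<^sup>+\<omega>. ennreal ((norm (?\<eta> i \<omega>))\<^sup>2) \<partial>M))"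
  proof (intro sum.cong refl arg_cong2[where f="(*)"] nn_integral_eq_integral[symmetric])
    fix i
    obtain B where B: "\<forall>\<omega>\<in>space M. norm (?\<eta> i \<omega>) \<le> B" using b by blast
    show "integrable M (\<lambda>\<omega>. (norm (?\<eta> i \<omega>))\<^sup>2)"
      by (rule integrable_const_bound[of _ "B\<^sup>2"]) (use B in \<open>auto intro!: power_mono\<close>)
  qed auto
  also have "\<dots> = (\<integral>\<^sup>+\<omega>. (\<Sum>i<?n. ennreal (?q (Suc i) - ?q i) * ennreal ((norm (?\<eta> i \<omega>))\<^sup>2)) \<partial>M)"
    by (simp add: nn_integral_sum nn_integral_cmult del: sum.lessThan_Suc)
  also have "\<dots> = (\<integral>\<^sup>+\<omega>. (\<integral>\<^sup>+u\<in>{s<..t}. ennreal ((norm (simple_process k p \<xi> u \<omega> - h \<omega>))\<^sup>2) \<partial>lborel) \<partial>M)"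
    by (intro nn_integral_cong simple_process_nn_integral[OF si st, symmetric, where g="\<lambda>x. ennreal ((norm (x - h _))\<^sup>2)"])
  finally show "(\<integral>\<^sup>+\<omega>. ennreal ((norm (simple_ito_integral W k p \<xi> t \<omega> - simple_ito_integral W k p \<xi> s \<omega> - h \<omega> *v (W t \<omega> - W s \<omega>)))\<^sup>2) \<partial>M)
      = (\<integral>\<^sup>+\<omega>. (\<integral>\<^sup>+u\<in>{s<..t}. ennreal ((norm (simple_process k p \<xi> u \<omega> - h \<omega>))\<^sup>2) \<partial>lborel) \<partial>M)"
    unfolding eq .
qed

lemma simple_ito_increment_mean:
  fixes \<xi> :: "nat \<Rightarrow> 'w \<Rightarrow> real^'m^'d"
  assumes si: "simple_integrand M F k p \<xi>" and st: "0 \<le> s" "s \<le> t"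
    and Z: "Z \<in> borel_measurable (F s)" "\<And>\<omega>. \<omega> \<in> space M \<Longrightarrow> norm (Z \<omega>) \<le> K"
  shows "has_bochner_integral M (\<lambda>\<omega>. Z \<omega> \<bullet> (simple_ito_integral W k p \<xi> t \<omega> - simple_ito_integral W k p \<xi> s \<omega>)) 0"
  unfolding simple_ito_integral_window[OF si st]
  by (rule step_sum_mean)
    (use st Z in \<open>auto intro: window_mono[OF si st] window_coeff_measurable[OF si st] window_coeff_bounded[OF si st] simp: window_ends[OF si st]\<close>)

text \<open>
  Switching an integrand off before its energy on \<open>[0, T]\<close> exceeds \<open>L\<close> turns convergence in
  probability of the approximations into \<open>L\<^sup>2\<close> convergence.
\<close>

definition cutoff :: "(nat \<Rightarrow> real) \<Rightarrow> (nat \<Rightarrow> 'w \<Rightarrow> real^'m^'d) \<Rightarrow> real \<Rightarrow> real \<Rightarrow> nat \<Rightarrow> 'w \<Rightarrow> real^'m^'d" where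
  "cutoff p \<xi> T L i \<omega> =
    (if (\<Sum>j\<le>i. (min T (p (Suc j)) - min T (p j)) * (norm (\<xi> j \<omega>))\<^sup>2) \<le> L then \<xi> i \<omega> else 0)"

lemma simple_process_energy:
  assumes si: "simple_integrand M F k p \<xi>" and T: "0 \<le> T"
  shows "(\<integral>\<^sup>+u\<in>{0..T}. ennreal ((norm (simple_process k p \<xi> u \<omega>))\<^sup>2) \<partial>lborel)
    = ennreal (\<Sum>j<k. (min T (p (Suc j)) - min T (p j)) * (norm (\<xi> j \<omega>))\<^sup>2)"
proof -
  have p: "p j \<le> p (Suc j)" if "j < k" for j using simple_integrandD(2)[OF si that] by simp
  have pm: "0 \<le> min T (p (Suc j)) - min T (p j)" if "j < k" for j using p[OF that] by (simp add: min_def)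
  have p0: "0 \<le> p j" if "j \<le> k" for j using simple_integrand_mono(2)[OF si] that by auto
  have "(\<integral>\<^sup>+u\<in>{0..T}. ennreal ((norm (simple_process k p \<xi> u \<omega>))\<^sup>2) \<partial>lborel)
    = (\<integral>\<^sup>+u\<in>{min T (p 0)<..min T (p k)}. ennreal ((norm (simple_process k p \<xi> u \<omega>))\<^sup>2) \<partial>lborel)"
    by (intro nn_integral_cong)
      (use p0[of 0] in \<open>auto simp: indicator_def min_def simple_process_eq_0[OF si] split: if_splits\<close>)
  also have "\<dots> = (\<Sum>j<k. ennreal (min T (p (Suc j)) - min T (p j)) * ennreal ((norm (\<xi> j \<omega>))\<^sup>2))"
    by (rule nn_integral_step_function[where q = "\<lambda>j. min T (p j)"])
      (use p in \<open>force simp: min_def simple_process_eq[OF si] split: if_splits\<close>)+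
  also have "\<dots> = ennreal (\<Sum>j<k. (min T (p (Suc j)) - min T (p j)) * (norm (\<xi> j \<omega>))\<^sup>2)"
    by (subst sum_ennreal[symmetric]) (use pm in \<open>auto simp: ennreal_mult intro!: sum.cong mult_nonneg_nonneg\<close>)
  finally show ?thesis .
qed

text \<open>The decision on cell \<open>i\<close> may count the energy of cell \<open>i\<close>
  itself, because \<open>\<xi> i\<close> is already known at its left endpoint; the cut integrand
  therefore stays adapted.\<close>

lemma cutoff_simple_integrand:
  assumes si: "simple_integrand M F k p \<xi>"
  shows "simple_integrand M F k p (cutoff p \<xi> T L)"
  unfolding simple_integrand_def
proof (intro conjI allI impI)
  fix i assume i: "i < k"
  have [measurable]: "\<xi> j \<in> borel_measurable (F (p i))" if "j \<le> i" for j
    using that i by (intro measurable_F_mono[OF simple_integrandD(3)[OF si]] simple_integrand_mono(1)[OF si]) auto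
  have [measurable]: "\<xi> i \<in> borel_measurable (F (p i))" by simp
  have "(\<lambda>\<omega>. \<Sum>j\<le>i. (min T (p (Suc j)) - min T (p j)) * (norm (\<xi> j \<omega>))\<^sup>2) \<in> borel_measurable (F (p i))"
    by (intro borel_measurable_sum) auto
  then show "cutoff p \<xi> T L i \<in> borel_measurable (F (p i))"
    unfolding cutoff_def[abs_def] by measurable
  obtain B where B: "\<forall>\<omega>\<in>space M. norm (\<xi> i \<omega>) \<le> B" using simple_integrandD(4)[OF si i] by auto
  show "\<exists>B. \<forall>\<omega>\<in>space M. norm (cutoff p \<xi> T L i \<omega>) \<le> B"
  proof (intro exI[of _ "\<bar>B\<bar>"] ballI)
    fix \<omega> assume "\<omega> \<in> space M"
    then have "norm (\<xi> i \<omega>) \<le> B" using B by auto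
    then show "norm (cutoff p \<xi> T L i \<omega>) \<le> \<bar>B\<bar>" by (auto simp: cutoff_def)
  qed
qed (use si in \<open>auto simp: simple_integrand_def\<close>)

text \<open>Two bounds are carried through the induction: by \<open>L\<close>, and by the energy of
  the original. If the original energy is still within \<open>L\<close>, the second bound implies
  the first; otherwise the cell is switched off and adds nothing.\<close>

lemma cutoff_energy:
  assumes si: "simple_integrand M F k p \<xi>" and T: "0 \<le> T" and L: "0 \<le> L"
  shows "(\<integral>\<^sup>+u\<in>{0..T}. ennreal ((norm (simple_process k p (cutoff p \<xi> T L) u \<omega>))\<^sup>2) \<partial>lborel) \<le> ennreal L"
proof -
  have p: "0 \<le> (min T (p (Suc j)) - min T (p j))" if "j < k" for j using simple_integrandD(2)[OF si that] by (simp add: min_def)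
  let ?e = "\<lambda>\<eta> j. (min T (p (Suc j)) - min T (p j)) * (norm (\<eta> j \<omega>))\<^sup>2"
  have "sum (?e (cutoff p \<xi> T L)) {..<n} \<le> L \<and> sum (?e (cutoff p \<xi> T L)) {..<n} \<le> sum (?e \<xi>) {..<n}" if "n \<le> k" for n
    using that
  proof (induction n)
    case (Suc n)
    have a: "?e (cutoff p \<xi> T L) n \<le> ?e \<xi> n" using p[of n] Suc(2) by (auto simp: cutoff_def intro!: mult_nonneg_nonneg)
    show ?case
    proof (cases "sum (?e \<xi>) {..n} \<le> L")
      case True
      then show ?thesis using Suc a by (auto simp: lessThan_Suc_atMost[symmetric])
    next
      case False
      then have "cutoff p \<xi> T L n \<omega> = 0" by (simp add: cutoff_def)
      then show ?thesis using Suc a by simp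
    qed
  qed (use L in simp)
  then show ?thesis
    using simple_process_energy[OF cutoff_simple_integrand[OF si] T] by (auto intro!: ennreal_leI)
qed

lemma cutoff_inactive:
  assumes si: "simple_integrand M F k p \<xi>" and T: "0 \<le> T" and L: "0 \<le> L"
    and le: "(\<integral>\<^sup>+u\<in>{0..T}. ennreal ((norm (simple_process k p \<xi> u \<omega>))\<^sup>2) \<partial>lborel) \<le> ennreal L" and i: "i < k"
  shows "cutoff p \<xi> T L i \<omega> = \<xi> i \<omega>"
proof -
  have p: "0 \<le> (min T (p (Suc j)) - min T (p j))" if "j < k" for j using simple_integrandD(2)[OF si that] by (simp add: min_def)
  have "(\<Sum>j\<le>i. (min T (p (Suc j)) - min T (p j)) * (norm (\<xi> j \<omega>))\<^sup>2) \<le> (\<Sum>j<k. (min T (p (Suc j)) - min T (p j)) * (norm (\<xi> j \<omega>))\<^sup>2)"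
    using i by (intro sum_mono2) (auto intro!: mult_nonneg_nonneg p)
  also have "\<dots> \<le> L" using le L unfolding simple_process_energy[OF si T] by simp
  finally show ?thesis by (simp add: cutoff_def)
qed

end

section \<open>Integrals of bounded processes\<close>

lemma nn_integral_power2_add_le:
  fixes f g :: "real \<Rightarrow> 'e::real_normed_vector"
  assumes "(\<lambda>u. ennreal ((norm (f u))\<^sup>2) * indicator S u) \<in> borel_measurable borel" "(\<lambda>u. ennreal ((norm (g u))\<^sup>2) * indicator S u) \<in> borel_measurable borel"
    and h: "\<And>u. u \<in> S \<Longrightarrow> norm (h u) \<le> norm (f u) + norm (g u)"
  shows "(\<integral>\<^sup>+u\<in>S. ennreal ((norm (h u))\<^sup>2) \<partial>lborel) \<le>
    2 * (\<integral>\<^sup>+u\<in>S. ennreal ((norm (f u))\<^sup>2) \<partial>lborel) + 2 * (\<integral>\<^sup>+u\<in>S. ennreal ((norm (g u))\<^sup>2) \<partial>lborel)"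
proof -
  have pt: "ennreal ((norm (h u))\<^sup>2) \<le> 2 * ennreal ((norm (f u))\<^sup>2) + 2 * ennreal ((norm (g u))\<^sup>2)" if "u \<in> S" for u
  proof -
    have "(norm (h u))\<^sup>2 \<le> (norm (f u) + norm (g u))\<^sup>2" using h[OF that] by (intro power_mono) auto
    also have "\<dots> \<le> 2 * (norm (f u))\<^sup>2 + 2 * (norm (g u))\<^sup>2" by (rule power2_sum_le)
    finally have "ennreal ((norm (h u))\<^sup>2) \<le> ennreal (2 * (norm (f u))\<^sup>2 + 2 * (norm (g u))\<^sup>2)" by (rule ennreal_leI)
    then show ?thesis by (simp add: ennreal_mult)
  qed
  have "(\<integral>\<^sup>+u\<in>S. ennreal ((norm (h u))\<^sup>2) \<partial>lborel) \<le>
    (\<integral>\<^sup>+u. 2 * (ennreal ((norm (f u))\<^sup>2) * indicator S u) + 2 * (ennreal ((norm (g u))\<^sup>2) * indicator S u) \<partial>lborel)"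
    by (intro nn_integral_mono) (use pt in \<open>auto simp: indicator_def\<close>)
  also have "\<dots> = 2 * (\<integral>\<^sup>+u\<in>S. ennreal ((norm (f u))\<^sup>2) \<partial>lborel) + 2 * (\<integral>\<^sup>+u\<in>S. ennreal ((norm (g u))\<^sup>2) \<partial>lborel)"
    using assms by (subst nn_integral_add) (auto simp: nn_integral_cmult)
  finally show ?thesis .
qed

lemma ennreal_tendsto_0I: "\<lbrakk>\<And>e. 0 < e \<Longrightarrow> \<forall>\<^sub>F n in sequentially. f n \<le> ennreal e\<rbrakk> \<Longrightarrow> f \<longlonglongrightarrow> 0"
proof -
  assume a: "\<And>e. 0 < e \<Longrightarrow> \<forall>\<^sub>F n in sequentially. f n \<le> ennreal e"
  show ?thesis
  proof (rule order_tendstoI)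
    fix y :: ennreal assume "0 < y"
    then obtain e where e: "0 < e" "e < y" by (metis dense)
    then obtain x where x: "e = ennreal x" "0 \<le> x" by (cases e) auto
    then have e': "0 < x" "ennreal x = e" using e by auto
    from a[OF e'(1)] show "\<forall>\<^sub>F n in sequentially. f n < y"
      unfolding e'(2) by (rule eventually_mono) (use e in auto)
  qed simp
qed

context brownian
begin

text \<open>Progressive measurability speaks of \<open>[0, T]\<close> only. Clamping the time gives
  a function on the whole product space, unchanged for times in \<open>[0, T]\<close>, to which
  Fubini's theorem applies.\<close>

lemma progressive_clamp_measurable:
  fixes H :: "real \<Rightarrow> 'w \<Rightarrow> real^'m^'d"
  assumes "progressive F H" and T: "0 \<le> T"
  shows "(\<lambda>x. H (max 0 (min T (snd x))) (fst x)) \<in> borel_measurable (M \<Otimes>\<^sub>M lborel)"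
proof -
  have H: "(\<lambda>(s, \<omega>). H s \<omega>) \<in> borel_measurable (restrict_space borel {0..T} \<Otimes>\<^sub>M F T)"
    using assms by (auto simp: progressive_def)
  have id: "(\<lambda>\<omega>. \<omega>) \<in> measurable M (F T)"
    using sets_F_subset[of T] sets.sets_into_space by (auto simp: measurable_def Int_absorb2)
  have 2: "(\<lambda>x. fst x) \<in> measurable (M \<Otimes>\<^sub>M lborel) (F T)"
    by (rule measurable_compose[OF measurable_fst id])
  have 1: "(\<lambda>x. max 0 (min T (snd x))) \<in> measurable (M \<Otimes>\<^sub>M lborel) (restrict_space borel {0..T})"
    using T by (intro measurable_restrict_space2) auto
  show ?thesis
    using measurable_compose[OF measurable_Pair[OF 1 2] H] by simp
qed

lemma simple_process_joint_measurable:
  fixes \<xi> :: "nat \<Rightarrow> 'w \<Rightarrow> real^'m^'d"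
  assumes si: "simple_integrand M F k p \<xi>"
  shows "(\<lambda>x. simple_process k p \<xi> (snd x) (fst x)) \<in> borel_measurable (M \<Otimes>\<^sub>M lborel)"
proof -
  have [measurable]: "\<xi> i \<in> borel_measurable M" if "i < k" for i
    by (rule measurable_F[OF simple_integrandD(3)[OF si that]])
  show ?thesis unfolding simple_process_def
    by (intro borel_measurable_sum borel_measurable_scaleR measurable_compose[OF measurable_fst] measurable_compose[OF measurable_snd]) auto
qed

lemma distance_measurable:
  fixes H G :: "real \<Rightarrow> 'w \<Rightarrow> real^'m^'d"
  assumes pr: "progressive F H" and T: "0 \<le> T" and G: "(\<lambda>x. G (snd x) (fst x)) \<in> borel_measurable (M \<Otimes>\<^sub>M lborel)"
    and S: "S \<subseteq> {0..T}" "S \<in> sets borel"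
  shows "(\<lambda>\<omega>. \<integral>\<^sup>+u\<in>S. ennreal ((norm (G u \<omega> - H u \<omega>))\<^sup>2) \<partial>lborel) \<in> borel_measurable M"
    and "\<omega> \<in> space M \<Longrightarrow> (\<lambda>u. ennreal ((norm (G u \<omega> - H u \<omega>))\<^sup>2) * indicator S u) \<in> borel_measurable borel"
proof -
  note [measurable] = progressive_clamp_measurable[OF pr T] G S(2)
  have m: "(\<lambda>x. ennreal ((norm (G (snd x) (fst x) - H (max 0 (min T (snd x))) (fst x)))\<^sup>2) * indicator S (snd x)) \<in> borel_measurable (M \<Otimes>\<^sub>M lborel)"
    by measurable
  have eq: "ennreal ((norm (G u \<omega> - H (max 0 (min T u)) \<omega>))\<^sup>2) * indicator S u = ennreal ((norm (G u \<omega> - H u \<omega>))\<^sup>2) * indicator S u" for u \<omega>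
    using S(1) by (cases "u \<in> S") (auto simp: subset_iff max_def min_def)
  show "(\<lambda>\<omega>. \<integral>\<^sup>+u\<in>S. ennreal ((norm (G u \<omega> - H u \<omega>))\<^sup>2) \<partial>lborel) \<in> borel_measurable M"
    using lborel.borel_measurable_nn_integral_fst[OF m] by (simp add: eq)
  show "(\<lambda>u. ennreal ((norm (G u \<omega> - H u \<omega>))\<^sup>2) * indicator S u) \<in> borel_measurable borel" if "\<omega> \<in> space M"
    using measurable_compose[OF measurable_Pair1'[OF that] m] by (simp add: eq)
qed

lemma constant_joint_measurable: "h \<in> borel_measurable M \<Longrightarrow> (\<lambda>x. (\<lambda>u \<omega>. h \<omega>) (snd x) (fst x)) \<in> borel_measurable (M \<Otimes>\<^sub>M lborel)"
  by (auto intro: measurable_compose[OF measurable_fst])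

context
  fixes H :: "real \<Rightarrow> 'w \<Rightarrow> real^'m^'d" and I :: "real \<Rightarrow> 'w \<Rightarrow> real^'d" and K T :: real
  assumes ito: "has_ito_integral M F W H I" and T: "0 \<le> T"
    and HK: "AE \<omega> in M. \<forall>u\<in>{0..T}. norm (H u \<omega>) \<le> K"
begin

lemma ito_progressive: "progressive F H"
  using ito by (simp add: has_ito_integral_def)

lemma ito_measurable: "0 \<le> t \<Longrightarrow> I t \<in> borel_measurable M"
  using ito measurable_F by (auto simp: has_ito_integral_def)

text \<open>The given integrands are cut at an energy that they do not reach while close to
  \<open>H\<close>. Where \<open>\<phi> n \<le> 1\<close> nothing is cut, almost surely; elsewhere
  \<open>\<psi> n \<le> B\<close> on an event of vanishing probability. So the mean of
  \<open>\<psi> n\<close> tends to zero, and the stochastic integrals change only on that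
  event.\<close>

lemma ito_bounded_approximation:
  obtains k p \<xi> where "\<And>n::nat. simple_integrand M F (k n) (p n) (\<xi> n)"
    "(\<lambda>n. \<integral>\<^sup>+\<omega>. (\<integral>\<^sup>+u\<in>{0..T}. ennreal ((norm (simple_process (k n) (p n) (\<xi> n) u \<omega> - H u \<omega>))\<^sup>2) \<partial>lborel) \<partial>M) \<longlonglongrightarrow> 0"
    "\<And>t \<epsilon>. 0 \<le> t \<Longrightarrow> 0 < \<epsilon> \<Longrightarrow> (\<lambda>n. prob {\<omega>\<in>space M. \<epsilon> < norm (simple_ito_integral W (k n) (p n) (\<xi> n) t \<omega> - I t \<omega>)}) \<longlonglongrightarrow> 0"
proof -
  obtain k p \<xi> where si: "\<And>n::nat. simple_integrand M F (k n) (p n) (\<xi> n)"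
    and c1: "\<And>\<epsilon>. 0 < \<epsilon> \<Longrightarrow> (\<lambda>n. prob {\<omega>\<in>space M. ennreal \<epsilon> <
             (\<integral>\<^sup>+ s\<in>{0..T}. ennreal ((norm (simple_process (k n) (p n) (\<xi> n) s \<omega> - H s \<omega>))\<^sup>2) \<partial>lborel)}) \<longlonglongrightarrow> 0"
    and c2: "\<And>t \<epsilon>. 0 \<le> t \<Longrightarrow> 0 < \<epsilon> \<Longrightarrow> (\<lambda>n. prob {\<omega>\<in>space M. \<epsilon> < norm (simple_ito_integral W (k n) (p n) (\<xi> n) t \<omega> - I t \<omega>)}) \<longlonglongrightarrow> 0"
    using ito T unfolding has_ito_integral_def by blast
  \<comment> \<open>If \<open>\<phi> n \<le> 1\<close>, the energy of the approximation is at most 2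
    plus twice the energy of \<open>H\<close>, which is at most \<open>K\<^sup>2 * T\<close>; at
    this level the cutoff is inactive.\<close>
  define L where "L = 2 * K\<^sup>2 * T + 2"
  have L: "0 \<le> L" using T by (simp add: L_def)
  define \<eta> where "\<eta> n = cutoff (p n) (\<xi> n) T L" for n
  have si': "simple_integrand M F (k n) (p n) (\<eta> n)" for n
    unfolding \<eta>_def by (rule cutoff_simple_integrand[OF si])
  define \<phi> where "\<phi> n \<omega> = (\<integral>\<^sup>+ s\<in>{0..T}. ennreal ((norm (simple_process (k n) (p n) (\<xi> n) s \<omega> - H s \<omega>))\<^sup>2) \<partial>lborel)" for n \<omega>
  define \<psi> where "\<psi> n \<omega> = (\<integral>\<^sup>+ s\<in>{0..T}. ennreal ((norm (simple_process (k n) (p n) (\<eta> n) s \<omega> - H s \<omega>))\<^sup>2) \<partial>lborel)" for n \<omega>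
  note dm = distance_measurable[OF ito_progressive T _ order_refl]
  have \<phi>[measurable]: "\<phi> n \<in> borel_measurable M" for n
    unfolding \<phi>_def[abs_def] by (rule dm(1)[OF simple_process_joint_measurable[OF si]]) auto
  have \<psi>[measurable]: "\<psi> n \<in> borel_measurable M" for n
    unfolding \<psi>_def[abs_def] by (rule dm(1)[OF simple_process_joint_measurable[OF si']]) auto
  \<comment> \<open>Twice the cut energy plus twice that of \<open>H\<close>: a bound on
    \<open>\<psi> n\<close> that also holds where the approximation is poor.\<close>
  define B where "B = 2 * L + 2 * (K\<^sup>2 * T)"
  have B: "0 \<le> B" using L T by (simp add: B_def)
  have AEb: "AE \<omega> in M. (\<phi> n \<omega> \<le> 1 \<longrightarrow> \<psi> n \<omega> = \<phi> n \<omega> \<and> (\<forall>t. simple_ito_integral W (k n) (p n) (\<eta> n) t \<omega> = simple_ito_integral W (k n) (p n) (\<xi> n) t \<omega>)) \<and> \<psi> n \<omega> \<le> ennreal B" for n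
    using HK AE_space
  proof eventually_elim
    case (elim \<omega>)
    have Hm: "(\<lambda>u. ennreal ((norm (H u \<omega>))\<^sup>2) * indicator {0..T} u) \<in> borel_measurable borel"
      using dm(2)[of "\<lambda>_ _. 0" \<omega>] elim by auto
    have Hle: "(\<integral>\<^sup>+u\<in>{0..T}. ennreal ((norm (H u \<omega>))\<^sup>2) \<partial>lborel) \<le> ennreal (K\<^sup>2 * T)"
    proof -
      have "(\<integral>\<^sup>+u\<in>{0..T}. ennreal ((norm (H u \<omega>))\<^sup>2) \<partial>lborel) \<le> (\<integral>\<^sup>+u. ennreal (K\<^sup>2) * indicator {0..T} u \<partial>lborel)"
        by (intro nn_integral_mono) (use elim in \<open>auto simp: indicator_def intro!: ennreal_leI power_mono\<close>)
      also have "\<dots> = ennreal (K\<^sup>2 * T)" using T by (simp add: nn_integral_cmult_indicator ennreal_mult)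
      finally show ?thesis .
    qed
    have sm: "(\<lambda>u. ennreal ((norm (simple_process (k n) (p n) \<zeta> u \<omega>))\<^sup>2) * indicator {0..T} u) \<in> borel_measurable borel" for \<zeta> :: "nat \<Rightarrow> 'w \<Rightarrow> real^'m^'d"
      unfolding simple_process_def by measurable
    have "\<psi> n \<omega> \<le> 2 * (\<integral>\<^sup>+u\<in>{0..T}. ennreal ((norm (simple_process (k n) (p n) (\<eta> n) u \<omega>))\<^sup>2) \<partial>lborel) + 2 * (\<integral>\<^sup>+u\<in>{0..T}. ennreal ((norm (H u \<omega>))\<^sup>2) \<partial>lborel)"
      unfolding \<psi>_def by (rule nn_integral_power2_add_le[OF sm Hm]) (rule norm_triangle_ineq4)
    also have "\<dots> \<le> 2 * ennreal L + 2 * ennreal (K\<^sup>2 * T)"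
      unfolding \<eta>_def by (intro add_mono mult_left_mono cutoff_energy[OF si T L] Hle) auto
    also have "\<dots> = ennreal B" using L T by (simp add: B_def ennreal_mult)
    finally have b: "\<psi> n \<omega> \<le> ennreal B" .
    moreover have "\<psi> n \<omega> = \<phi> n \<omega> \<and> (\<forall>t. simple_ito_integral W (k n) (p n) (\<eta> n) t \<omega> = simple_ito_integral W (k n) (p n) (\<xi> n) t \<omega>)" if "\<phi> n \<omega> \<le> 1"
    proof -
      have "(\<integral>\<^sup>+u\<in>{0..T}. ennreal ((norm (simple_process (k n) (p n) (\<xi> n) u \<omega>))\<^sup>2) \<partial>lborel) \<le> 2 * \<phi> n \<omega> + 2 * (\<integral>\<^sup>+u\<in>{0..T}. ennreal ((norm (H u \<omega>))\<^sup>2) \<partial>lborel)"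
        unfolding \<phi>_def
        by (rule nn_integral_power2_add_le[OF dm(2)[OF simple_process_joint_measurable[OF si]] Hm])
          (use elim norm_triangle_sub in \<open>auto simp: add.commute\<close>)
      also have "\<dots> \<le> 2 * 1 + 2 * ennreal (K\<^sup>2 * T)"
        by (intro add_mono mult_left_mono that Hle) auto
      also have "\<dots> = ennreal L"
      proof -
        have "ennreal L = ennreal (2 * (K\<^sup>2 * T)) + ennreal 2"
          unfolding L_def using T by (subst ennreal_plus[symmetric]) (auto simp: ac_simps)
        also have "\<dots> = ennreal 2 * ennreal (K\<^sup>2 * T) + ennreal 2"
          using T by (subst ennreal_mult) auto
        finally have "ennreal L = ennreal 2 + ennreal 2 * ennreal (K\<^sup>2 * T)" by (simp add: add.commute)
        then show ?thesis by simp
      qed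
      finally have "\<And>i. i < k n \<Longrightarrow> \<eta> n i \<omega> = \<xi> n i \<omega>"
        unfolding \<eta>_def by (rule cutoff_inactive[OF si T L])
      then show ?thesis unfolding \<phi>_def \<psi>_def simple_process_def simple_ito_integral_def by simp
    qed
    ultimately show ?case by blast
  qed
  show ?thesis
  proof (rule that[of k p \<eta>, OF si'])
    have "(\<lambda>n. \<integral>\<^sup>+\<omega>. \<psi> n \<omega> \<partial>M) \<longlonglongrightarrow> 0"
    proof (rule ennreal_tendsto_0I)
      fix e :: real assume e: "0 < e"
      \<comment> \<open>\<open>e' \<le> 1\<close> places the complement of \<open>?A\<close> in the
        region without cutoff, where \<open>\<psi> n = \<phi> n \<le> e'\<close>.\<close>
      define e' where "e' = min 1 (e / 2)"
      have e': "0 < e'" "e' \<le> 1" "e' \<le> e/2" using e by (auto simp: e'_def)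
      have pe: "0 < e / 2 / (B + 1)" using e B by simp
      have "\<forall>\<^sub>F n in sequentially. prob {\<omega>\<in>space M. ennreal e' < \<phi> n \<omega>} < e / 2 / (B + 1)"
        unfolding \<phi>_def by (rule order_tendstoD(2)[OF c1[OF e'(1)] pe])
      then show "\<forall>\<^sub>F n in sequentially. (\<integral>\<^sup>+\<omega>. \<psi> n \<omega> \<partial>M) \<le> ennreal e"
      proof eventually_elim
        case (elim n)
        let ?A = "{\<omega>\<in>space M. ennreal e' < \<phi> n \<omega>}"
        have A: "?A \<in> sets M" by measurable
        have "(\<integral>\<^sup>+\<omega>. \<psi> n \<omega> \<partial>M) \<le> (\<integral>\<^sup>+\<omega>. ennreal e' + ennreal B * indicator ?A \<omega> \<partial>M)"
        proof (rule nn_integral_mono_AE)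
          show "AE \<omega> in M. \<psi> n \<omega> \<le> ennreal e' + ennreal B * indicator ?A \<omega>"
            using AEb[of n] AE_space
          proof eventually_elim
            case (elim \<omega>)
            show ?case
            proof (cases "\<omega> \<in> ?A")
              case False
              then have "\<phi> n \<omega> \<le> ennreal e'" using elim by auto
              moreover have "ennreal e' \<le> 1" using e' by simp
              ultimately show ?thesis using elim by (auto intro: order_trans)
            qed (use elim in \<open>auto intro: add_increasing\<close>)
          qed
        qed
        also have "\<dots> = ennreal e' + ennreal B * emeasure M ?A"
          using A by (subst nn_integral_add) (auto simp: nn_integral_cmult_indicator emeasure_space_1)
        also have "\<dots> = ennreal (e' + B * prob ?A)"
          using e' B by (simp add: emeasure_eq_measure ennreal_mult)
        also have "\<dots> \<le> ennreal e"
        proof (rule ennreal_leI)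
          have "B * prob ?A \<le> (B + 1) * (e / 2 / (B + 1))" using elim B by (intro mult_mono) auto
          also have "\<dots> = e / 2"
            by (subst times_divide_eq_right, rule nonzero_mult_div_cancel_left) (use B in auto)
          finally have "B * prob ?A \<le> e / 2" .
          then show "e' + B * prob ?A \<le> e" using e' B by simp
        qed
        finally show ?case .
      qed
    qed
    then show "(\<lambda>n. \<integral>\<^sup>+\<omega>. (\<integral>\<^sup>+u\<in>{0..T}. ennreal ((norm (simple_process (k n) (p n) (\<eta> n) u \<omega> - H u \<omega>))\<^sup>2) \<partial>lborel) \<partial>M) \<longlonglongrightarrow> 0"
      by (simp add: \<psi>_def)
  next
    fix t \<epsilon> :: real assume t: "0 \<le> t" and \<epsilon>: "0 < \<epsilon>"
    have [measurable]: "simple_ito_integral W (k n) (p n) (\<eta> n) t \<in> borel_measurable M"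
      "simple_ito_integral W (k n) (p n) (\<xi> n) t \<in> borel_measurable M" "I t \<in> borel_measurable M" for n
      using simple_ito_integral_measurable[OF si t] simple_ito_integral_measurable[OF si' t] ito_measurable[OF t] by auto
    let ?P = "\<lambda>n. prob {\<omega>\<in>space M. \<epsilon> < norm (simple_ito_integral W (k n) (p n) (\<xi> n) t \<omega> - I t \<omega>)}
      + prob {\<omega>\<in>space M. ennreal 1 < \<phi> n \<omega>}"
    show "(\<lambda>n. prob {\<omega>\<in>space M. \<epsilon> < norm (simple_ito_integral W (k n) (p n) (\<eta> n) t \<omega> - I t \<omega>)}) \<longlonglongrightarrow> 0"
    proof (rule tendsto_sandwich[of "\<lambda>_. 0" _ _ ?P])
      show "?P \<longlonglongrightarrow> 0"
        using tendsto_add[OF c2[OF t \<epsilon>] c1[of 1]] by (simp add: \<phi>_def)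
      show "\<forall>\<^sub>F n in sequentially. prob {\<omega>\<in>space M. \<epsilon> < norm (simple_ito_integral W (k n) (p n) (\<eta> n) t \<omega> - I t \<omega>)} \<le> ?P n"
      proof (rule always_eventually, rule allI)
        fix n
        have "prob {\<omega>\<in>space M. \<epsilon> < norm (simple_ito_integral W (k n) (p n) (\<eta> n) t \<omega> - I t \<omega>)}
          \<le> prob ({\<omega>\<in>space M. \<epsilon> < norm (simple_ito_integral W (k n) (p n) (\<xi> n) t \<omega> - I t \<omega>)} \<union> {\<omega>\<in>space M. ennreal 1 < \<phi> n \<omega>})"
        proof (rule finite_measure_mono_AE)
          show "AE \<omega> in M. \<omega> \<in> {\<omega>\<in>space M. \<epsilon> < norm (simple_ito_integral W (k n) (p n) (\<eta> n) t \<omega> - I t \<omega>)} \<longrightarrow>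
            \<omega> \<in> {\<omega>\<in>space M. \<epsilon> < norm (simple_ito_integral W (k n) (p n) (\<xi> n) t \<omega> - I t \<omega>)} \<union> {\<omega>\<in>space M. ennreal 1 < \<phi> n \<omega>}"
            using AEb[of n] by eventually_elim auto
        qed measurable
        also have "\<dots> \<le> ?P n" by (rule measure_Un_le) measurable
        finally show "prob {\<omega>\<in>space M. \<epsilon> < norm (simple_ito_integral W (k n) (p n) (\<eta> n) t \<omega> - I t \<omega>)} \<le> ?P n" .
      qed
    qed auto
  qed
qed

end
end

section \<open>Moments of Ito increments for bounded integrands\<close>

context brownian
begin

context
  fixes H :: "real \<Rightarrow> 'w \<Rightarrow> real^'m^'d" and I :: "real \<Rightarrow> 'w \<Rightarrow> real^'d" and K T :: real
  assumes ito: "has_ito_integral M F W H I" and T: "0 \<le> T"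
    and HK: "AE \<omega> in M. \<forall>u\<in>{0..T}. norm (H u \<omega>) \<le> K"
begin

text \<open>One sequence \<open>J\<close> serves both moment statements below. The factor 2 stems
  from splitting \<open>simple_process - h\<close> at \<open>H\<close>; it is harmless, since later
  only finiteness of the right side and its convergence to zero matter.\<close>

lemma ito_increment_approximation:
  obtains J :: "nat \<Rightarrow> real \<Rightarrow> 'w \<Rightarrow> real^'d"
  where "\<And>n t. 0 \<le> t \<Longrightarrow> J n t \<in> borel_measurable M"
    and "\<And>s t \<epsilon>. 0 \<le> s \<Longrightarrow> 0 \<le> t \<Longrightarrow> 0 < \<epsilon> \<Longrightarrow>
      (\<lambda>n. prob {\<omega>\<in>space M. \<epsilon> < norm ((J n t \<omega> - J n s \<omega>) - (I t \<omega> - I s \<omega>))}) \<longlonglongrightarrow> 0"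
    and "\<And>n s t h B. 0 \<le> s \<Longrightarrow> s \<le> t \<Longrightarrow> h \<in> borel_measurable (F s) \<Longrightarrow> (\<And>\<omega>. \<omega> \<in> space M \<Longrightarrow> norm (h \<omega>) \<le> B) \<Longrightarrow>
      integrable M (\<lambda>\<omega>. (norm (J n t \<omega> - J n s \<omega> - h \<omega> *v (W t \<omega> - W s \<omega>)))\<^sup>2)"
    and "\<And>s t h B e. 0 \<le> s \<Longrightarrow> s \<le> t \<Longrightarrow> t \<le> T \<Longrightarrow> h \<in> borel_measurable (F s) \<Longrightarrow> (\<And>\<omega>. \<omega> \<in> space M \<Longrightarrow> norm (h \<omega>) \<le> B) \<Longrightarrow> 0 < e \<Longrightarrow>
      \<forall>\<^sub>F n in sequentially. (\<integral>\<^sup>+\<omega>. ennreal ((norm (J n t \<omega> - J n s \<omega> - h \<omega> *v (W t \<omega> - W s \<omega>)))\<^sup>2) \<partial>M)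
        \<le> 2 * (\<integral>\<^sup>+\<omega>. (\<integral>\<^sup>+u\<in>{s<..t}. ennreal ((norm (h \<omega> - H u \<omega>))\<^sup>2) \<partial>lborel) \<partial>M) + ennreal e"
    and "\<And>n s t (Z :: 'w \<Rightarrow> real^'d) B. 0 \<le> s \<Longrightarrow> s \<le> t \<Longrightarrow> Z \<in> borel_measurable (F s) \<Longrightarrow> (\<And>\<omega>. \<omega> \<in> space M \<Longrightarrow> norm (Z \<omega>) \<le> B) \<Longrightarrow>
      has_bochner_integral M (\<lambda>\<omega>. Z \<omega> \<bullet> (J n t \<omega> - J n s \<omega>)) 0"
proof -
  note pr = ito_progressive[OF ito T HK]
  obtain k p \<xi> where si: "\<And>n::nat. simple_integrand M F (k n) (p n) (\<xi> n)"
    and c1: "(\<lambda>n. \<integral>\<^sup>+\<omega>. (\<integral>\<^sup>+u\<in>{0..T}. ennreal ((norm (simple_process (k n) (p n) (\<xi> n) u \<omega> - H u \<omega>))\<^sup>2) \<partial>lborel) \<partial>M) \<longlonglongrightarrow> 0"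
    and c2: "\<And>t \<epsilon>. 0 \<le> t \<Longrightarrow> 0 < \<epsilon> \<Longrightarrow> (\<lambda>n. prob {\<omega>\<in>space M. \<epsilon> < norm (simple_ito_integral W (k n) (p n) (\<xi> n) t \<omega> - I t \<omega>)}) \<longlonglongrightarrow> 0"
    by (rule ito_bounded_approximation[OF ito T HK]) blast
  define J where "J n = simple_ito_integral W (k n) (p n) (\<xi> n)" for n
  have Jm[measurable]: "J n t \<in> borel_measurable M" if "0 \<le> t" for n t
    unfolding J_def using simple_ito_integral_measurable[OF si that] .
  show ?thesis
  proof (rule that[of J, OF Jm])
    fix n s t B and Z :: "'w \<Rightarrow> real^'d" assume "0 \<le> s" "s \<le> t" "Z \<in> borel_measurable (F s)" "\<And>\<omega>. \<omega> \<in> space M \<Longrightarrow> norm (Z \<omega>) \<le> B"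
    then show "has_bochner_integral M (\<lambda>\<omega>. Z \<omega> \<bullet> (J n t \<omega> - J n s \<omega>)) 0"
      unfolding J_def by (rule simple_ito_increment_mean[OF si])
  next
    fix n s t and h :: "'w \<Rightarrow> real^'m^'d" and B assume "0 \<le> s" "s \<le> t" "h \<in> borel_measurable (F s)" "\<And>\<omega>. \<omega> \<in> space M \<Longrightarrow> norm (h \<omega>) \<le> B"
    then show "integrable M (\<lambda>\<omega>. (norm (J n t \<omega> - J n s \<omega> - h \<omega> *v (W t \<omega> - W s \<omega>)))\<^sup>2)"
      unfolding J_def by (rule simple_ito_increment(1)[OF si])
  next
    fix s t \<epsilon> :: real assume s: "0 \<le> s" and t: "0 \<le> t" and e: "0 < \<epsilon>"
    then have e2: "0 < \<epsilon> / 2" by simp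
    have [measurable]: "I t \<in> borel_measurable M" "I s \<in> borel_measurable M"
      using ito_measurable[OF ito T HK] s t by auto
    have [measurable]: "J n t \<in> borel_measurable M" "J n s \<in> borel_measurable M" for n using Jm s t by auto
    let ?A = "\<lambda>t n. {\<omega>\<in>space M. \<epsilon>/2 < norm (J n t \<omega> - I t \<omega>)}"
    let ?D = "\<lambda>n. {\<omega> \<in> space M. \<epsilon> < norm ((J n t \<omega> - J n s \<omega>) - (I t \<omega> - I s \<omega>))}"
    show "(\<lambda>n. prob (?D n)) \<longlonglongrightarrow> 0"
    proof (rule tendsto_sandwich[of "\<lambda>_. 0" _ _ "\<lambda>n. prob (?A t n) + prob (?A s n)"])
      show "(\<lambda>n. prob (?A t n) + prob (?A s n)) \<longlonglongrightarrow> 0"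
        using tendsto_add[OF c2[OF t e2] c2[OF s e2]] by (simp add: J_def)
      show "\<forall>\<^sub>F n in sequentially. prob (?D n) \<le> prob (?A t n) + prob (?A s n)"
      proof (rule always_eventually, rule allI)
        fix n
        have "?D n \<subseteq> ?A t n \<union> ?A s n"
        proof
          fix \<omega> assume a: "\<omega> \<in> ?D n"
          have "(J n t \<omega> - J n s \<omega>) - (I t \<omega> - I s \<omega>) = (J n t \<omega> - I t \<omega>) - (J n s \<omega> - I s \<omega>)" by simp
          then have "\<epsilon> < norm (J n t \<omega> - I t \<omega>) + norm (J n s \<omega> - I s \<omega>)"
            using a norm_triangle_ineq4[of "J n t \<omega> - I t \<omega>" "J n s \<omega> - I s \<omega>"] by (simp only: mem_Collect_eq) linarith
          then show "\<omega> \<in> ?A t n \<union> ?A s n" using a by auto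
        qed
        then have "prob (?D n) \<le> prob (?A t n \<union> ?A s n)"
          by (rule finite_measure_mono) measurable
        also have "\<dots> \<le> prob (?A t n) + prob (?A s n)" by (rule measure_Un_le) measurable
        finally show "prob (?D n) \<le> prob (?A t n) + prob (?A s n)" .
      qed
    qed auto
  next
    fix s t e B and h :: "'w \<Rightarrow> real^'m^'d"
    assume st: "0 \<le> s" "s \<le> t" "t \<le> T" and h: "h \<in> borel_measurable (F s)"
      and hB: "\<And>\<omega>. \<omega> \<in> space M \<Longrightarrow> norm (h \<omega>) \<le> B" and "0 < (e::real)"
    have hM: "h \<in> borel_measurable M" by (rule measurable_F[OF h])
    have sub: "{s<..t} \<subseteq> {0..T}" using st by auto
    let ?c = "\<integral>\<^sup>+\<omega>. (\<integral>\<^sup>+u\<in>{s<..t}. ennreal ((norm (h \<omega> - H u \<omega>))\<^sup>2) \<partial>lborel) \<partial>M"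
    have "0 < ennreal (e / 2)" using \<open>0 < e\<close> by simp
    from order_tendstoD(2)[OF c1 this]
    show "\<forall>\<^sub>F n in sequentially. (\<integral>\<^sup>+\<omega>. ennreal ((norm (J n t \<omega> - J n s \<omega> - h \<omega> *v (W t \<omega> - W s \<omega>)))\<^sup>2) \<partial>M) \<le> 2 * ?c + ennreal e"
    proof eventually_elim
      case (elim n)
      let ?X = "simple_process (k n) (p n) (\<xi> n)"
      note m1 = distance_measurable[OF pr T constant_joint_measurable[OF hM] sub]
      note m2 = distance_measurable[OF pr T simple_process_joint_measurable[OF si[of n]] sub]
      have "(\<integral>\<^sup>+\<omega>. ennreal ((norm (J n t \<omega> - J n s \<omega> - h \<omega> *v (W t \<omega> - W s \<omega>)))\<^sup>2) \<partial>M) = (\<integral>\<^sup>+\<omega>. (\<integral>\<^sup>+u\<in>{s<..t}. ennreal ((norm (?X u \<omega> - h \<omega>))\<^sup>2) \<partial>lborel) \<partial>M)"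
        unfolding J_def by (rule simple_ito_increment(2)[OF si st(1,2) h hB])
      also have "\<dots> \<le> (\<integral>\<^sup>+\<omega>. 2 * (\<integral>\<^sup>+u\<in>{s<..t}. ennreal ((norm (h \<omega> - H u \<omega>))\<^sup>2) \<partial>lborel) +
          2 * (\<integral>\<^sup>+u\<in>{s<..t}. ennreal ((norm (?X u \<omega> - H u \<omega>))\<^sup>2) \<partial>lborel) \<partial>M)"
      proof (rule nn_integral_mono)
        fix \<omega> assume w: "\<omega> \<in> space M"
        show "(\<integral>\<^sup>+u\<in>{s<..t}. ennreal ((norm (?X u \<omega> - h \<omega>))\<^sup>2) \<partial>lborel) \<le> 2 * (\<integral>\<^sup>+u\<in>{s<..t}. ennreal ((norm (h \<omega> - H u \<omega>))\<^sup>2) \<partial>lborel) +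
          2 * (\<integral>\<^sup>+u\<in>{s<..t}. ennreal ((norm (?X u \<omega> - H u \<omega>))\<^sup>2) \<partial>lborel)"
        proof (rule nn_integral_power2_add_le)
          fix u
          have "?X u \<omega> - h \<omega> = (?X u \<omega> - H u \<omega>) - (h \<omega> - H u \<omega>)" by simp
          then show "norm (?X u \<omega> - h \<omega>) \<le> norm (h \<omega> - H u \<omega>) + norm (?X u \<omega> - H u \<omega>)"
            by (metis norm_triangle_ineq4 add.commute)
        qed (use m1(2)[OF _ w] m2(2)[OF _ w] in auto)
      qed
      also have "\<dots> = 2 * ?c + 2 * (\<integral>\<^sup>+\<omega>. (\<integral>\<^sup>+u\<in>{s<..t}. ennreal ((norm (?X u \<omega> - H u \<omega>))\<^sup>2) \<partial>lborel) \<partial>M)"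
        using m1(1) m2(1) by (subst nn_integral_add) (auto simp: nn_integral_cmult)
      also have "\<dots> \<le> 2 * ?c + 2 * (\<integral>\<^sup>+\<omega>. (\<integral>\<^sup>+u\<in>{0..T}. ennreal ((norm (?X u \<omega> - H u \<omega>))\<^sup>2) \<partial>lborel) \<partial>M)"
        by (intro add_left_mono mult_left_mono nn_integral_mono) (use sub in \<open>auto simp: indicator_def\<close>)
      also have "\<dots> \<le> 2 * ?c + 2 * ennreal (e / 2)"
        using elim by (intro add_left_mono mult_left_mono) auto
      also have "2 * ennreal (e / 2) = ennreal e"
        using ennreal_mult[of 2 "e/2"] \<open>0 < e\<close> by simp
      finally show ?case .
    qed
  qed
qed

lemma ito_increment_second_moment:
  assumes st: "0 \<le> s" "s \<le> t" "t \<le> T"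
    and h: "h \<in> borel_measurable (F s)" and hB: "\<And>\<omega>. \<omega> \<in> space M \<Longrightarrow> norm (h \<omega>) \<le> B"
  shows "(\<integral>\<^sup>+\<omega>. ennreal ((norm (I t \<omega> - I s \<omega> - h \<omega> *v (W t \<omega> - W s \<omega>)))\<^sup>2) \<partial>M)
    \<le> 2 * (\<integral>\<^sup>+\<omega>. (\<integral>\<^sup>+u\<in>{s<..t}. ennreal ((norm (h \<omega> - H u \<omega>))\<^sup>2) \<partial>lborel) \<partial>M)"
proof (rule ito_increment_approximation)
  fix J :: "nat \<Rightarrow> real \<Rightarrow> 'w \<Rightarrow> real^'d"
  assume Jm: "\<And>n t. 0 \<le> t \<Longrightarrow> J n t \<in> borel_measurable M"
    and Jc: "\<And>s t \<epsilon>. 0 \<le> s \<Longrightarrow> 0 \<le> t \<Longrightarrow> 0 < \<epsilon> \<Longrightarrow>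
      (\<lambda>n. prob {\<omega>\<in>space M. \<epsilon> < norm ((J n t \<omega> - J n s \<omega>) - (I t \<omega> - I s \<omega>))}) \<longlonglongrightarrow> 0"
    and J2: "\<And>s t h B e. 0 \<le> s \<Longrightarrow> s \<le> t \<Longrightarrow> t \<le> T \<Longrightarrow> h \<in> borel_measurable (F s) \<Longrightarrow> (\<And>\<omega>. \<omega> \<in> space M \<Longrightarrow> norm (h \<omega>) \<le> B) \<Longrightarrow> 0 < e \<Longrightarrow>
      \<forall>\<^sub>F n in sequentially. (\<integral>\<^sup>+\<omega>. ennreal ((norm (J n t \<omega> - J n s \<omega> - h \<omega> *v (W t \<omega> - W s \<omega>)))\<^sup>2) \<partial>M)
        \<le> 2 * (\<integral>\<^sup>+\<omega>. (\<integral>\<^sup>+u\<in>{s<..t}. ennreal ((norm (h \<omega> - H u \<omega>))\<^sup>2) \<partial>lborel) \<partial>M) + ennreal e"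
  have t: "0 \<le> t" using st by simp
  have [measurable]: "J n t \<in> borel_measurable M" "J n s \<in> borel_measurable M" for n using Jm st t by auto
  have [measurable]: "I t \<in> borel_measurable M" "I s \<in> borel_measurable M"
    using ito_measurable[OF ito T HK] st t by auto
  have [measurable]: "h \<in> borel_measurable M" by (rule measurable_F[OF h])
  have [measurable]: "W t \<in> borel_measurable M" "W s \<in> borel_measurable M" using st t by auto
  have eq: "J n t \<omega> - J n s \<omega> - h \<omega> *v (W t \<omega> - W s \<omega>) - (I t \<omega> - I s \<omega> - h \<omega> *v (W t \<omega> - W s \<omega>)) = (J n t \<omega> - J n s \<omega>) - (I t \<omega> - I s \<omega>)" for n \<omega>
    by simp
  show ?thesis
  proof (rule prob_tendsto_imp_L2_bound[of "\<lambda>n \<omega>. J n t \<omega> - J n s \<omega> - h \<omega> *v (W t \<omega> - W s \<omega>)"], goal_cases)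
    case (3 \<epsilon>)
    show ?case unfolding eq by (rule Jc[OF st(1) t 3])
  next
    case (4 \<epsilon>)
    show ?case by (rule J2[OF st h hB 4])
  qed measurable
qed

text \<open>The form \<open>0 - H u \<omega>\<close> matches the second moment bound with
  \<open>h = 0\<close>.\<close>

lemma energy_finite:
  assumes st: "0 \<le> s" "s \<le> t" "t \<le> T"
  shows "(\<integral>\<^sup>+\<omega>. (\<integral>\<^sup>+u\<in>{s<..t}. ennreal ((norm (0 - H u \<omega>))\<^sup>2) \<partial>lborel) \<partial>M) < \<infinity>"
proof -
  have "(\<integral>\<^sup>+\<omega>. (\<integral>\<^sup>+u\<in>{s<..t}. ennreal ((norm (0 - H u \<omega>))\<^sup>2) \<partial>lborel) \<partial>M) \<le> (\<integral>\<^sup>+\<omega>. ennreal (K\<^sup>2 * (t - s)) \<partial>M)"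
  proof (rule nn_integral_mono_AE)
    show "AE \<omega> in M. (\<integral>\<^sup>+u\<in>{s<..t}. ennreal ((norm (0 - H u \<omega>))\<^sup>2) \<partial>lborel) \<le> ennreal (K\<^sup>2 * (t - s))"
      using HK
    proof eventually_elim
      case (elim \<omega>)
      have "(\<integral>\<^sup>+u\<in>{s<..t}. ennreal ((norm (0 - H u \<omega>))\<^sup>2) \<partial>lborel) \<le> (\<integral>\<^sup>+u. ennreal (K\<^sup>2) * indicator {s<..t} u \<partial>lborel)"
        by (intro nn_integral_mono) (use elim st in \<open>auto simp: indicator_def intro!: ennreal_leI power_mono\<close>)
      also have "\<dots> = ennreal (K\<^sup>2 * (t - s))" using st by (simp add: nn_integral_cmult_indicator ennreal_mult)
      finally show ?case .
    qed
  qed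
  also have "\<dots> < \<infinity>" by (simp add: emeasure_space_1)
  finally show "(\<integral>\<^sup>+\<omega>. (\<integral>\<^sup>+u\<in>{s<..t}. ennreal ((norm (0 - H u \<omega>))\<^sup>2) \<partial>lborel) \<partial>M) < \<infinity>" .
qed

lemma ito_increment_square_integrable:
  assumes st: "0 \<le> s" "s \<le> t" "t \<le> T"
  shows "integrable M (\<lambda>\<omega>. (norm (I t \<omega> - I s \<omega>))\<^sup>2)" and "integrable M (\<lambda>\<omega>. I t \<omega> - I s \<omega>)"
proof -
  have t: "0 \<le> t" using st by simp
  have [measurable]: "I t \<in> borel_measurable M" "I s \<in> borel_measurable M"
    using ito_measurable[OF ito T HK] st t by auto
  have "(\<integral>\<^sup>+\<omega>. ennreal ((norm (I t \<omega> - I s \<omega> - (\<lambda>_. 0) \<omega> *v (W t \<omega> - W s \<omega>)))\<^sup>2) \<partial>M) < \<infinity>"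
    using le_less_trans[OF ito_increment_second_moment[OF st, of "\<lambda>_. 0" 0]] energy_finite[OF st] by (auto simp: ennreal_mult_less_top)
  then show 2: "integrable M (\<lambda>\<omega>. (norm (I t \<omega> - I s \<omega>))\<^sup>2)"
    by (intro integrableI_bounded) auto
  show "integrable M (\<lambda>\<omega>. I t \<omega> - I s \<omega>)"
  proof (rule Bochner_Integration.integrable_bound)
    show "integrable M (\<lambda>\<omega>. 1 + (norm (I t \<omega> - I s \<omega>))\<^sup>2)" using 2 by simp
    show "AE \<omega> in M. norm (I t \<omega> - I s \<omega>) \<le> norm (1 + (norm (I t \<omega> - I s \<omega>))\<^sup>2)"
    proof (rule AE_I2)
      fix \<omega>
      show "norm (I t \<omega> - I s \<omega>) \<le> norm (1 + (norm (I t \<omega> - I s \<omega>))\<^sup>2)"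
        using sum_squares_bound[of "norm (I t \<omega> - I s \<omega>)" 1] norm_ge_zero[of "I t \<omega> - I s \<omega>"] by (simp, linarith)
    qed
  qed measurable
qed

text \<open>The increments of \<open>J\<close> have mean zero against \<open>Z\<close>. Their second
  moments are eventually bounded, so convergence in probability improves to L1 convergence, which
  suffices because \<open>Z\<close> is bounded.\<close>

lemma ito_increment_mean:
  assumes st: "0 \<le> s" "s \<le> t" "t \<le> T"
    and Z: "Z \<in> borel_measurable (F s)" and ZB: "\<And>\<omega>. \<omega> \<in> space M \<Longrightarrow> norm (Z \<omega>) \<le> B"
  shows "has_bochner_integral M (\<lambda>\<omega>. Z \<omega> \<bullet> (I t \<omega> - I s \<omega>)) 0"
proof (rule ito_increment_approximation)
  fix J :: "nat \<Rightarrow> real \<Rightarrow> 'w \<Rightarrow> real^'d"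
  assume Jm: "\<And>n t. 0 \<le> t \<Longrightarrow> J n t \<in> borel_measurable M"
    and Jc: "\<And>s t \<epsilon>. 0 \<le> s \<Longrightarrow> 0 \<le> t \<Longrightarrow> 0 < \<epsilon> \<Longrightarrow>
      (\<lambda>n. prob {\<omega>\<in>space M. \<epsilon> < norm ((J n t \<omega> - J n s \<omega>) - (I t \<omega> - I s \<omega>))}) \<longlonglongrightarrow> 0"
    and Ji: "\<And>n s t h B. 0 \<le> s \<Longrightarrow> s \<le> t \<Longrightarrow> h \<in> borel_measurable (F s) \<Longrightarrow> (\<And>\<omega>. \<omega> \<in> space M \<Longrightarrow> norm (h \<omega>) \<le> B) \<Longrightarrow>
      integrable M (\<lambda>\<omega>. (norm (J n t \<omega> - J n s \<omega> - h \<omega> *v (W t \<omega> - W s \<omega>)))\<^sup>2)"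
    and J2: "\<And>s t h B e. 0 \<le> s \<Longrightarrow> s \<le> t \<Longrightarrow> t \<le> T \<Longrightarrow> h \<in> borel_measurable (F s) \<Longrightarrow> (\<And>\<omega>. \<omega> \<in> space M \<Longrightarrow> norm (h \<omega>) \<le> B) \<Longrightarrow> 0 < e \<Longrightarrow>
      \<forall>\<^sub>F n in sequentially. (\<integral>\<^sup>+\<omega>. ennreal ((norm (J n t \<omega> - J n s \<omega> - h \<omega> *v (W t \<omega> - W s \<omega>)))\<^sup>2) \<partial>M)
        \<le> 2 * (\<integral>\<^sup>+\<omega>. (\<integral>\<^sup>+u\<in>{s<..t}. ennreal ((norm (h \<omega> - H u \<omega>))\<^sup>2) \<partial>lborel) \<partial>M) + ennreal e"
    and JZ: "\<And>n s t (Z :: 'w \<Rightarrow> real^'d) B. 0 \<le> s \<Longrightarrow> s \<le> t \<Longrightarrow> Z \<in> borel_measurable (F s) \<Longrightarrow> (\<And>\<omega>. \<omega> \<in> space M \<Longrightarrow> norm (Z \<omega>) \<le> B) \<Longrightarrow>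
      has_bochner_integral M (\<lambda>\<omega>. Z \<omega> \<bullet> (J n t \<omega> - J n s \<omega>)) 0"
  have t: "0 \<le> t" using st by simp
  define S where "S n \<omega> = J n t \<omega> - J n s \<omega>" for n \<omega>
  define S' where "S' \<omega> = I t \<omega> - I s \<omega>" for \<omega>
  have "J n t \<in> borel_measurable M" "J n s \<in> borel_measurable M" for n using Jm st t by auto
  then have Sm[measurable]: "S n \<in> borel_measurable M" for n by (simp add: S_def[abs_def])
  have Si: "integrable M (\<lambda>\<omega>. (norm (S n \<omega>))\<^sup>2)" for n using Ji[OF st(1,2), of "\<lambda>_. 0" 0 n] by (simp add: S_def)
  have S'i: "integrable M (\<lambda>\<omega>. (norm (S' \<omega>))\<^sup>2)" and S'i1: "integrable M S'"
    unfolding S'_def using ito_increment_square_integrable[OF st] by auto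
  have [measurable]: "Z \<in> borel_measurable M" by (rule measurable_F[OF Z])
  define C where "C = 2 * (\<integral>\<^sup>+\<omega>. (\<integral>\<^sup>+u\<in>{s<..t}. ennreal ((norm (0 - H u \<omega>))\<^sup>2) \<partial>lborel) \<partial>M) + ennreal 1"
  have Cfin: "C < \<infinity>"
    using energy_finite[OF st] by (auto simp: C_def ennreal_mult_less_top)
  \<comment> \<open>The maximum is a single constant for the approximations and for their limit, as
    \<open>prob_tendsto_imp_L1_tendsto\<close> demands.\<close>
  have ev: "\<forall>\<^sub>F n in sequentially. expectation (\<lambda>\<omega>. (norm (S n \<omega>))\<^sup>2) \<le> max (enn2real C) (expectation (\<lambda>\<omega>. (norm (S' \<omega>))\<^sup>2))"
    using J2[OF st, of "\<lambda>_. 0" 0 1]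
  proof (simp, elim eventually_mono)
    fix n assume "(\<integral>\<^sup>+\<omega>. ennreal ((norm (J n t \<omega> - J n s \<omega>))\<^sup>2) \<partial>M) \<le> 2 * (\<integral>\<^sup>+\<omega>. (\<integral>\<^sup>+u\<in>{s<..t}. ennreal ((norm (H u \<omega>))\<^sup>2) \<partial>lborel) \<partial>M) + 1"
    then have "ennreal (expectation (\<lambda>\<omega>. (norm (S n \<omega>))\<^sup>2)) \<le> C"
      using nn_integral_eq_integral[OF Si] by (simp add: S_def C_def)
    also have "C = ennreal (enn2real C)" using Cfin by simp
    finally show "expectation (\<lambda>\<omega>. (norm (S n \<omega>))\<^sup>2) \<le> max (enn2real C) (expectation (\<lambda>\<omega>. (norm (S' \<omega>))\<^sup>2))"
      by (simp add: le_max_iff_disj)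
  qed
  have lim: "(\<lambda>n. expectation (\<lambda>\<omega>. norm (S n \<omega> - S' \<omega>))) \<longlonglongrightarrow> 0"
  proof (rule prob_tendsto_imp_L1_tendsto[OF Sm _ _ Si ev S'i])
    show "S' \<in> borel_measurable M" using S'i1 by auto
    show "(\<lambda>n. prob {\<omega> \<in> space M. \<epsilon> < norm (S n \<omega> - S' \<omega>)}) \<longlonglongrightarrow> 0" if "0 < \<epsilon>" for \<epsilon>
      unfolding S_def S'_def by (rule Jc[OF st(1) t that])
  qed simp
  have SS: "integrable M (\<lambda>\<omega>. norm (S n \<omega> - S' \<omega>))" for n
  proof (rule Bochner_Integration.integrable_bound)
    show "integrable M (\<lambda>\<omega>. 1 + (norm (S n \<omega>))\<^sup>2 + norm (S' \<omega>))" using Si S'i1 by simp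
    show "AE \<omega> in M. norm (norm (S n \<omega> - S' \<omega>)) \<le> norm (1 + (norm (S n \<omega>))\<^sup>2 + norm (S' \<omega>))"
    proof (rule AE_I2)
      fix \<omega>
      have "norm (S n \<omega>) \<le> 1 + (norm (S n \<omega>))\<^sup>2"
        using sum_squares_bound[of "norm (S n \<omega>)" 1] norm_ge_zero[of "S n \<omega>"] by (simp, linarith)
      then show "norm (norm (S n \<omega> - S' \<omega>)) \<le> norm (1 + (norm (S n \<omega>))\<^sup>2 + norm (S' \<omega>))"
        using norm_triangle_ineq4[of "S n \<omega>" "S' \<omega>"] by simp
    qed
  qed (use S'i1 in auto)
  have Zi: "integrable M (\<lambda>\<omega>. Z \<omega> \<bullet> S' \<omega>)"
  proof (rule Bochner_Integration.integrable_bound)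
    show "integrable M (\<lambda>\<omega>. B * norm (S' \<omega>))" using S'i1 by simp
    show "AE \<omega> in M. norm (Z \<omega> \<bullet> S' \<omega>) \<le> norm (B * norm (S' \<omega>))"
    proof (rule AE_I2)
      fix \<omega> assume "\<omega> \<in> space M"
      then have "norm (Z \<omega>) * norm (S' \<omega>) \<le> B * norm (S' \<omega>)" using ZB by (intro mult_right_mono) auto
      then show "norm (Z \<omega> \<bullet> S' \<omega>) \<le> norm (B * norm (S' \<omega>))"
        using Cauchy_Schwarz_ineq2[of "Z \<omega>" "S' \<omega>"] by (simp add: order_trans[OF _ abs_ge_self])
    qed
  qed (use S'i1 in auto)
  have bd: "\<bar>expectation (\<lambda>\<omega>. Z \<omega> \<bullet> S' \<omega>)\<bar> \<le> \<bar>B\<bar> * expectation (\<lambda>\<omega>. norm (S n \<omega> - S' \<omega>))" for n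
  proof -
    have z: "has_bochner_integral M (\<lambda>\<omega>. Z \<omega> \<bullet> S n \<omega>) 0" unfolding S_def by (rule JZ[OF st(1,2) Z ZB])
    then have "expectation (\<lambda>\<omega>. Z \<omega> \<bullet> (S n \<omega> - S' \<omega>)) = - expectation (\<lambda>\<omega>. Z \<omega> \<bullet> S' \<omega>)"
      using Zi by (simp add: inner_diff_right has_bochner_integral_iff)
    then have "\<bar>expectation (\<lambda>\<omega>. Z \<omega> \<bullet> S' \<omega>)\<bar> = norm (expectation (\<lambda>\<omega>. Z \<omega> \<bullet> (S n \<omega> - S' \<omega>)))" by simp
    also have "\<dots> \<le> expectation (\<lambda>\<omega>. norm (Z \<omega> \<bullet> (S n \<omega> - S' \<omega>)))" by (rule integral_norm_bound)
    also have "\<dots> \<le> expectation (\<lambda>\<omega>. \<bar>B\<bar> * norm (S n \<omega> - S' \<omega>))"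
    proof (rule integral_mono)
      show "integrable M (\<lambda>\<omega>. norm (Z \<omega> \<bullet> (S n \<omega> - S' \<omega>)))"
        using z Zi by (auto simp: inner_diff_right has_bochner_integral_iff)
      fix \<omega> assume "\<omega> \<in> space M"
      then have "norm (Z \<omega>) * norm (S n \<omega> - S' \<omega>) \<le> \<bar>B\<bar> * norm (S n \<omega> - S' \<omega>)" using ZB[of \<omega>] by (intro mult_right_mono) auto
      then show "norm (Z \<omega> \<bullet> (S n \<omega> - S' \<omega>)) \<le> \<bar>B\<bar> * norm (S n \<omega> - S' \<omega>)"
        using Cauchy_Schwarz_ineq2[of "Z \<omega>" "S n \<omega> - S' \<omega>"] by simp
    qed (use SS in auto)
    finally show ?thesis by simp
  qed
  have "\<bar>expectation (\<lambda>\<omega>. Z \<omega> \<bullet> S' \<omega>)\<bar> \<le> 0"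
    using LIMSEQ_le_const[OF tendsto_mult_left[OF lim, of "\<bar>B\<bar>"], of "\<bar>expectation (\<lambda>\<omega>. Z \<omega> \<bullet> S' \<omega>)\<bar>"] bd
    by (simp only: mult_zero_right) blast
  then show ?thesis using Zi by (simp add: has_bochner_integral_iff S'_def)
qed

end
end

section \<open>Sampling on a grid\<close>

definition grid :: "real \<Rightarrow> nat \<Rightarrow> nat \<Rightarrow> real" where "grid T N j = T * real j / real N"

text \<open>Left endpoint of the left-open cell containing \<open>u\<close>. A ceiling minus one,
  instead of a floor, keeps it strictly below \<open>u\<close> even at grid points, so that limits
  along it are left limits.\<close>

definition grid_floor :: "real \<Rightarrow> nat \<Rightarrow> real \<Rightarrow> real" where
  "grid_floor T N u = T * real_of_int (\<lceil>u * real N / T\<rceil> - 1) / real N"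

lemma grid_simps [simp]: "grid T N 0 = 0" "N > 0 \<Longrightarrow> grid T N N = T"
  by (auto simp: grid_def)

lemma grid_mono: "0 \<le> T \<Longrightarrow> i \<le> j \<Longrightarrow> grid T N i \<le> grid T N j"
  by (auto simp: grid_def intro!: divide_right_mono mult_left_mono)

lemma grid_nonneg: "0 \<le> T \<Longrightarrow> 0 \<le> grid T N j"
  by (auto simp: grid_def)

lemma grid_le: "0 \<le> T \<Longrightarrow> j \<le> N \<Longrightarrow> grid T N j \<le> T"
  using grid_mono[of T j N N] by (cases "N = 0") (auto simp: grid_def)

lemma grid_Suc: "grid T N (Suc j) - grid T N j = T / real N"
  by (simp add: grid_def add_divide_distrib distrib_left)

lemma grid_floor_eq:
  assumes "0 < T" "0 < N" "grid T N j < u" "u \<le> grid T N (Suc j)"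
  shows "grid_floor T N u = grid T N j"
proof -
  have "real j < u * real N / T" "u * real N / T \<le> real (Suc j)"
    using assms by (auto simp: grid_def field_simps)
  then have "\<lceil>u * real N / T\<rceil> = int (Suc j)" by (intro ceiling_unique) auto
  then show ?thesis by (simp add: grid_floor_def grid_def)
qed

lemma grid_floor_bounds:
  assumes "0 < T" "0 < N"
  shows "grid_floor T N u < u" "u - T / real N \<le> grid_floor T N u" "0 < u \<Longrightarrow> 0 \<le> grid_floor T N u"
proof -
  let ?c = "\<lceil>u * real N / T\<rceil>"
  have c: "real_of_int ?c - 1 < u * real N / T" "u * real N / T \<le> real_of_int ?c" by linarith+
  have e: "u = T * (u * real N / T) / real N" using assms by simp
  show "grid_floor T N u < u"
    unfolding grid_floor_def using c assms by (subst (2) e) (intro divide_strict_right_mono mult_strict_left_mono, auto)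
  have "u - T / real N = T * (u * real N / T - 1) / real N" using assms by (simp add: field_simps)
  also have "\<dots> \<le> grid_floor T N u"
    unfolding grid_floor_def using c assms by (intro divide_right_mono mult_left_mono) auto
  finally show "u - T / real N \<le> grid_floor T N u" .
  show "0 \<le> grid_floor T N u" if "0 < u"
  proof -
    have "0 < u * real N / T" using that assms by simp
    then have "1 \<le> ?c" by (simp add: int_one_le_iff_zero_less)
    then show ?thesis using assms by (auto simp: grid_floor_def)
  qed
qed

lemma grid_floor_tendsto:
  assumes "0 < T" shows "filterlim (\<lambda>N. grid_floor T N u) (at_left u) sequentially"
proof -
  have "(\<lambda>N. T / real N) \<longlonglongrightarrow> 0" by (rule lim_const_over_n)
  then have l: "(\<lambda>N. u - T / real N) \<longlonglongrightarrow> u - 0" by (intro tendsto_diff tendsto_const)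
  have "(\<lambda>N. grid_floor T N u) \<longlonglongrightarrow> u"
  proof (rule tendsto_sandwich[OF _ _ _ tendsto_const])
    show "\<forall>\<^sub>F N in sequentially. u - T / real N \<le> grid_floor T N u"
      using eventually_gt_at_top[of 0] by eventually_elim (rule grid_floor_bounds[OF assms])
    show "\<forall>\<^sub>F N in sequentially. grid_floor T N u \<le> u"
      using eventually_gt_at_top[of 0] by eventually_elim (intro less_imp_le grid_floor_bounds[OF assms])
  qed (use l in simp)
  moreover have "\<forall>\<^sub>F N in sequentially. grid_floor T N u \<in> {..<u}"
    using eventually_gt_at_top[of 0] by eventually_elim (use grid_floor_bounds[OF assms] in auto)
  moreover have "\<forall>\<^sub>F N in sequentially. grid_floor T N u \<noteq> u"
    using eventually_gt_at_top[of 0] by eventually_elim (use grid_floor_bounds(1)[OF assms] in \<open>auto simp: less_imp_neq\<close>)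
  ultimately show ?thesis by (auto simp: filterlim_at intro: eventually_conj)
qed

lemma indicator_partition:
  fixes q :: "nat \<Rightarrow> real"
  assumes "\<And>i. i < m \<Longrightarrow> q i \<le> q (Suc i)"
  shows "(\<Sum>i<m. indicator {q i<..q (Suc i)} u :: 'a::semiring_1) = indicator {q 0<..q m} u"
proof -
  have "q 0 \<le> q n \<and> (\<Sum>i<n. indicator {q i<..q (Suc i)} u :: 'a) = indicator {q 0<..q n} u" if "n \<le> m" for n
    using that
  proof (induction n)
    case (Suc n)
    then show ?case using assms[of n] by (auto simp: indicator_def)
  qed auto
  then show ?thesis by blast
qed

lemma nn_integral_partition:
  fixes q :: "nat \<Rightarrow> real"
  assumes q: "\<And>i. i < m \<Longrightarrow> q i \<le> q (Suc i)"
    and g: "\<And>i. i < m \<Longrightarrow> (\<lambda>u. g u * indicator {q i<..q (Suc i)} u) \<in> borel_measurable borel"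
  shows "(\<integral>\<^sup>+u\<in>{q 0<..q m}. g u \<partial>lborel) = (\<Sum>i<m. \<integral>\<^sup>+u\<in>{q i<..q (Suc i)}. g u \<partial>lborel)"
proof -
  have "g u * indicator {q 0<..q m} u = (\<Sum>i<m. g u * indicator {q i<..q (Suc i)} u)" for u
    using indicator_partition[where 'a=ennreal and q=q and m=m and u=u, OF q] by (simp only: sum_distrib_left[symmetric])
  then show ?thesis using g by (subst nn_integral_sum[symmetric]) auto
qed

text \<open>
  Grid points approach \<open>u\<close> strictly from the left, so it is enough that \<open>\<phi>\<close> gives the left limits of \<open>\<psi>\<close>.
  Below, \<open>\<psi>\<close> is switched off for \<open>s \<ge> e\<close> but \<open>\<phi>\<close> only for \<open>s > e\<close>.
\<close>

lemma grid_left_limit_integral: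
  fixes \<phi> \<psi> :: "real \<Rightarrow> 'e::{real_normed_vector, second_countable_topology}"
  assumes T: "0 < T" and p: "0 < (p::nat)"
    and lim: "\<And>u. 0 < u \<Longrightarrow> u \<le> T \<Longrightarrow> (\<psi> \<longlongrightarrow> \<phi> u) (at_left u)"
    and K: "\<And>u. 0 \<le> u \<Longrightarrow> u \<le> T \<Longrightarrow> norm (\<phi> u) \<le> K" "\<And>u. 0 \<le> u \<Longrightarrow> u \<le> T \<Longrightarrow> norm (\<psi> u) \<le> K"
    and m: "(\<lambda>u. \<phi> (max 0 (min T u))) \<in> borel_measurable borel"
  shows "(\<lambda>N. \<integral>\<^sup>+u\<in>{0<..T}. ennreal ((norm (\<psi> (grid_floor T N u) - \<phi> u)) ^ p) \<partial>lborel) \<longlonglongrightarrow> 0"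
    and "(\<lambda>N. \<Sum>j<N. \<integral>\<^sup>+u\<in>{grid T N j<..grid T N (Suc j)}. ennreal ((norm (\<psi> (grid T N j) - \<phi> u)) ^ p) \<partial>lborel) \<longlonglongrightarrow> 0"
proof -
  have gm: "(\<lambda>u. \<psi> (grid_floor T N u)) \<in> borel_measurable borel" for N
  proof -
    have "(\<lambda>u. \<lceil>u * real N / T\<rceil>) \<in> measurable borel (count_space UNIV)" by measurable
    then show ?thesis unfolding grid_floor_def by (rule measurable_compose) simp
  qed
  have \<phi>m: "(\<lambda>u. \<phi> u) \<in> borel_measurable (restrict_space borel {0<..T})"
    using measurable_restrict_space1[OF m, of "{0<..T}"] by (rule measurable_cong[THEN iffD1, rotated]) (auto simp: space_restrict_space)
  have hm: "(\<lambda>u. ennreal ((norm (\<psi> (grid_floor T N u) - \<phi> u)) ^ p) * indicator {0<..T} u) \<in> borel_measurable borel" for N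
  proof -
    have "(\<lambda>u. ennreal ((norm (\<psi> (grid_floor T N u) - \<phi> (max 0 (min T u)))) ^ p) * indicator {0<..T} u) \<in> borel_measurable borel"
      using gm m by measurable
    also have "(\<lambda>u. ennreal ((norm (\<psi> (grid_floor T N u) - \<phi> (max 0 (min T u)))) ^ p) * indicator {0<..T} u) =
      (\<lambda>u. ennreal ((norm (\<psi> (grid_floor T N u) - \<phi> u)) ^ p) * indicator {0<..T} u)"
      by (auto simp: fun_eq_iff indicator_def)
    finally show ?thesis .
  qed
  have "(\<lambda>N. \<integral>\<^sup>+u. ennreal ((norm (\<psi> (grid_floor T (Suc N) u) - \<phi> u)) ^ p) * indicator {0<..T} u \<partial>lborel) \<longlonglongrightarrow> (\<integral>\<^sup>+u. 0 \<partial>(lborel :: real measure))"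
  proof (rule nn_integral_dominated_convergence[where w = "\<lambda>u. ennreal ((2 * K) ^ p) * indicator {0<..T} u" and u' = "\<lambda>_. 0"])
    have "0 \<le> K" using K(1)[of 0] T norm_ge_zero[of "\<phi> 0"] by linarith
    show "AE u in lborel. ennreal ((norm (\<psi> (grid_floor T (Suc N) u) - \<phi> u)) ^ p) * indicator {0<..T} u \<le> ennreal ((2 * K) ^ p) * indicator {0<..T} u" for N
    proof (rule AE_I2)
      fix u
      have "ennreal (norm (\<psi> (grid_floor T (Suc N) u) - \<phi> u) ^ p) \<le> ennreal ((2 * K) ^ p)" if u: "0 < u" "u \<le> T"
      proof (intro ennreal_leI power_mono)
        have "norm (\<psi> (grid_floor T (Suc N) u)) \<le> K"
          using grid_floor_bounds[OF T, of "Suc N" u] u by (intro K) auto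
        then show "norm (\<psi> (grid_floor T (Suc N) u) - \<phi> u) \<le> 2 * K" using K(1)[of u] u norm_triangle_ineq4[of "\<psi> (grid_floor T (Suc N) u)" "\<phi> u"] by simp
      qed simp
      then show "ennreal ((norm (\<psi> (grid_floor T (Suc N) u) - \<phi> u)) ^ p) * indicator {0<..T} u \<le> ennreal ((2 * K) ^ p) * indicator {0<..T} u"
        by (cases "u \<in> {0<..T}") (simp_all del: power_mult_distrib)
    qed
    show "(\<integral>\<^sup>+u. ennreal ((2 * K) ^ p) * indicator {0<..T} u \<partial>lborel) < \<infinity>"
      using T by (simp add: nn_integral_cmult_indicator ennreal_mult_less_top)
    show "AE u in lborel. (\<lambda>N. ennreal ((norm (\<psi> (grid_floor T (Suc N) u) - \<phi> u)) ^ p) * indicator {0<..T} u) \<longlonglongrightarrow> 0"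
    proof (rule AE_I2)
      fix u
      show "(\<lambda>N. ennreal ((norm (\<psi> (grid_floor T (Suc N) u) - \<phi> u)) ^ p) * indicator {0<..T} u) \<longlonglongrightarrow> 0"
      proof (cases "u \<in> {0<..T}")
        case True
        then have "(\<lambda>N. \<psi> (grid_floor T N u)) \<longlonglongrightarrow> \<phi> u"
          by (intro filterlim_compose[OF lim grid_floor_tendsto[OF T]]) auto
        then have "(\<lambda>N. \<psi> (grid_floor T (Suc N) u)) \<longlonglongrightarrow> \<phi> u" by (rule LIMSEQ_Suc)
        then have "(\<lambda>N. ennreal ((norm (\<psi> (grid_floor T (Suc N) u) - \<phi> u)) ^ p)) \<longlonglongrightarrow> ennreal ((norm (\<phi> u - \<phi> u)) ^ p)"
          by (intro tendsto_intros)
        then show ?thesis using True p by (simp add: power_0_left)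
      qed simp
    qed
  qed (use hm in auto)
  then show 1: "(\<lambda>N. \<integral>\<^sup>+u\<in>{0<..T}. ennreal ((norm (\<psi> (grid_floor T N u) - \<phi> u)) ^ p) \<partial>lborel) \<longlonglongrightarrow> 0"
    by (subst (asm) filterlim_sequentially_Suc) simp
  have "(\<Sum>j<N. \<integral>\<^sup>+u\<in>{grid T N j<..grid T N (Suc j)}. ennreal ((norm (\<psi> (grid T N j) - \<phi> u)) ^ p) \<partial>lborel) =
    (\<integral>\<^sup>+u\<in>{0<..T}. ennreal ((norm (\<psi> (grid_floor T N u) - \<phi> u)) ^ p) \<partial>lborel)" if N: "0 < N" for N
  proof -
    have "(\<integral>\<^sup>+u\<in>{grid T N 0<..grid T N N}. ennreal ((norm (\<psi> (grid_floor T N u) - \<phi> u)) ^ p) \<partial>lborel) =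
      (\<Sum>j<N. \<integral>\<^sup>+u\<in>{grid T N j<..grid T N (Suc j)}. ennreal ((norm (\<psi> (grid_floor T N u) - \<phi> u)) ^ p) \<partial>lborel)"
    proof (rule nn_integral_partition)
      fix i assume i: "i < N"
      have "(\<lambda>u. (ennreal ((norm (\<psi> (grid_floor T N u) - \<phi> u)) ^ p) * indicator {0<..T} u) * indicator {grid T N i<..grid T N (Suc i)} u) \<in> borel_measurable borel"
        using hm by measurable
      also have "(\<lambda>u. (ennreal ((norm (\<psi> (grid_floor T N u) - \<phi> u)) ^ p) * indicator {0<..T} u) * indicator {grid T N i<..grid T N (Suc i)} u) =
        (\<lambda>u. ennreal ((norm (\<psi> (grid_floor T N u) - \<phi> u)) ^ p) * indicator {grid T N i<..grid T N (Suc i)} u)"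
      proof
        fix u
        show "(ennreal ((norm (\<psi> (grid_floor T N u) - \<phi> u)) ^ p) * indicator {0<..T} u) * indicator {grid T N i<..grid T N (Suc i)} u =
          ennreal ((norm (\<psi> (grid_floor T N u) - \<phi> u)) ^ p) * indicator {grid T N i<..grid T N (Suc i)} u"
          using grid_nonneg[of T N i] grid_le[of T "Suc i" N] i T by (auto simp: indicator_def)
      qed
      finally show "(\<lambda>u. ennreal ((norm (\<psi> (grid_floor T N u) - \<phi> u)) ^ p) * indicator {grid T N i<..grid T N (Suc i)} u) \<in> borel_measurable borel" .
    qed (use T in \<open>auto intro: grid_mono\<close>)
    also have "\<dots> = (\<Sum>j<N. \<integral>\<^sup>+u\<in>{grid T N j<..grid T N (Suc j)}. ennreal ((norm (\<psi> (grid T N j) - \<phi> u)) ^ p) \<partial>lborel)"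
      using grid_floor_eq[OF T N] by (intro sum.cong refl nn_integral_cong) (auto simp: indicator_def)
    finally show ?thesis using N by simp
  qed
  then show "(\<lambda>N. \<Sum>j<N. \<integral>\<^sup>+u\<in>{grid T N j<..grid T N (Suc j)}. ennreal ((norm (\<psi> (grid T N j) - \<phi> u)) ^ p) \<partial>lborel) \<longlonglongrightarrow> 0"
    using 1 by (rule_tac Lim_transform_eventually[OF 1]) (auto intro!: eventually_mono[OF eventually_gt_at_top[of 0]])
qed

text \<open>Errors are summed in norm over the cells, which is stronger than convergence of the
  Riemann sums. A cell contributes at most the integral of
  \<open>norm (\<psi> (grid T N j) - \<phi> u)\<close>, so \<open>grid_left_limit_integral\<close>
  with exponent 1 applies.\<close>

lemma grid_riemann_sum:
  fixes \<phi> \<psi> :: "real \<Rightarrow> 'e::euclidean_space"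
  assumes T: "0 < T"
    and lim: "\<And>u. 0 < u \<Longrightarrow> u \<le> T \<Longrightarrow> (\<psi> \<longlongrightarrow> \<phi> u) (at_left u)"
    and K: "\<And>u. 0 \<le> u \<Longrightarrow> u \<le> T \<Longrightarrow> norm (\<phi> u) \<le> K" "\<And>u. 0 \<le> u \<Longrightarrow> u \<le> T \<Longrightarrow> norm (\<psi> u) \<le> K"
    and m: "(\<lambda>u. \<phi> (max 0 (min T u))) \<in> borel_measurable borel"
    and B: "\<And>s t. 0 \<le> s \<Longrightarrow> s \<le> t \<Longrightarrow> t \<le> T \<Longrightarrow> B t - B s = (LINT u:{s<..t}|lborel. \<phi> u)"
  shows "(\<lambda>N. \<Sum>j<N. norm (B (grid T N (Suc j)) - B (grid T N j) - (T / real N) *\<^sub>R \<psi> (grid T N j))) \<longlonglongrightarrow> 0"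
proof -
  let ?d = "\<lambda>N j. norm (B (grid T N (Suc j)) - B (grid T N j) - (T / real N) *\<^sub>R \<psi> (grid T N j))"
  have si: "set_integrable lborel {s<..t} \<phi>" if "0 \<le> s" "t \<le> T" for s t
  proof -
    have "integrable lborel (\<lambda>u. indicator {s<..t} u *\<^sub>R \<phi> (max 0 (min T u)))"
    proof (rule integrableI_bounded_set[where A="{s<..t}" and B=K])
      show "(\<lambda>u. indicator {s<..t} u *\<^sub>R \<phi> (max 0 (min T u))) \<in> borel_measurable lborel" using m by measurable
      show "AE x in lborel. x \<in> {s<..t} \<longrightarrow> norm (indicator {s<..t} x *\<^sub>R \<phi> (max 0 (min T x))) \<le> K"
        using K T by (auto simp: indicator_def intro!: AE_I2)
    qed (auto intro!: AE_I2, cases "s \<le> t", auto)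
    moreover have "(\<lambda>u. indicator {s<..t} u *\<^sub>R \<phi> (max 0 (min T u))) = (\<lambda>u. indicator {s<..t} u *\<^sub>R \<phi> u)"
      using that by (auto simp: fun_eq_iff indicator_def)
    ultimately show ?thesis by (simp add: set_integrable_def)
  qed
  have le: "ennreal (?d N j) \<le> (\<integral>\<^sup>+u\<in>{grid T N j<..grid T N (Suc j)}. ennreal ((norm (\<psi> (grid T N j) - \<phi> u)) ^ 1) \<partial>lborel)" if j: "j < N" for N j
  proof -
    let ?s = "grid T N j" and ?t = "grid T N (Suc j)"
    have st: "0 \<le> ?s" "?s \<le> ?t" "?t \<le> T" using T j grid_nonneg[of T N j] grid_mono[of T j "Suc j" N] grid_le[of T "Suc j" N] by auto
    have c: "set_integrable lborel {?s<..?t} (\<lambda>u. \<psi> ?s)" using st by (auto simp: set_integrable_def intro!: integrable_mult_indicator)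
    have "(LINT u:{?s<..?t}|lborel. \<psi> ?s) = (?t - ?s) *\<^sub>R \<psi> ?s"
      using st by (simp add: set_lebesgue_integral_def)
    then have "B ?t - B ?s - (T / real N) *\<^sub>R \<psi> ?s = (LINT u:{?s<..?t}|lborel. \<phi> u) - (LINT u:{?s<..?t}|lborel. \<psi> ?s)"
      using B[OF st] by (simp add: grid_Suc)
    also have "\<dots> = (LINT u:{?s<..?t}|lborel. \<phi> u - \<psi> ?s)" using si[OF st(1,3)] c by (simp add: set_integral_diff)
    finally have eq: "B ?t - B ?s - (T / real N) *\<^sub>R \<psi> ?s = integral\<^sup>L lborel (\<lambda>u. indicator {?s<..?t} u *\<^sub>R (\<phi> u - \<psi> ?s))"
      by (simp add: set_lebesgue_integral_def)
    have "integrable lborel (\<lambda>u. indicator {?s<..?t} u *\<^sub>R (\<phi> u - \<psi> ?s))"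
      using set_integral_diff(1)[OF si[OF st(1,3)] c] by (simp add: set_integrable_def)
    then have "ennreal (?d N j) \<le> (\<integral>\<^sup>+u. ennreal (norm (indicator {?s<..?t} u *\<^sub>R (\<phi> u - \<psi> ?s))) \<partial>lborel)"
      unfolding eq by (rule integral_norm_bound_ennreal)
    also have "\<dots> = (\<integral>\<^sup>+u\<in>{?s<..?t}. ennreal ((norm (\<psi> ?s - \<phi> u)) ^ 1) \<partial>lborel)"
      by (intro nn_integral_cong) (auto simp: indicator_def norm_minus_commute)
    finally show ?thesis .
  qed
  have "(\<lambda>N. ennreal (\<Sum>j<N. ?d N j)) \<longlonglongrightarrow> 0"
  proof (rule tendsto_sandwich[OF _ _ tendsto_const grid_left_limit_integral(2)[OF T zero_less_one lim K m]])
    show "\<forall>\<^sub>F N in sequentially. ennreal (\<Sum>j<N. ?d N j) \<le> (\<Sum>j<N. \<integral>\<^sup>+u\<in>{grid T N j<..grid T N (Suc j)}. ennreal ((norm (\<psi> (grid T N j) - \<phi> u)) ^ 1) \<partial>lborel)"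
    proof (rule always_eventually, rule allI)
      fix N
      have "ennreal (\<Sum>j<N. ?d N j) = (\<Sum>j<N. ennreal (?d N j))" by (subst sum_ennreal) auto
      also have "\<dots> \<le> (\<Sum>j<N. \<integral>\<^sup>+u\<in>{grid T N j<..grid T N (Suc j)}. ennreal ((norm (\<psi> (grid T N j) - \<phi> u)) ^ 1) \<partial>lborel)"
        by (rule sum_mono) (use le in auto)
      finally show "ennreal (\<Sum>j<N. ?d N j) \<le> (\<Sum>j<N. \<integral>\<^sup>+u\<in>{grid T N j<..grid T N (Suc j)}. ennreal ((norm (\<psi> (grid T N j) - \<phi> u)) ^ 1) \<partial>lborel)" .
    qed
  qed auto
  then show ?thesis
    by (subst (asm) ennreal_0[symmetric]) (subst (asm) tendsto_ennreal_iff, auto intro!: always_eventually sum_nonneg)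
qed

section \<open>Solutions stopped on leaving a ball\<close>

text \<open>A solution in a ball after correction on a null set: adaptedness, continuity and the
  bounds hold for every outcome, whereas the form of \<open>H\<close> and the equation hold almost
  surely. \<open>e\<close> is the corrected exit time.\<close>

locale stopped_ito = brownian M W for M :: "'w measure" and W :: "real \<Rightarrow> 'w \<Rightarrow> real ^ 'm" +
  fixes \<sigma> :: "real ^ 'd \<Rightarrow> real ^ 'm ^ 'd" and b :: "real ^ 'd \<Rightarrow> real ^ 'd"
    and X :: "real \<Rightarrow> 'w \<Rightarrow> real ^ 'd" and e :: "'w \<Rightarrow> ereal"
    and H :: "real \<Rightarrow> 'w \<Rightarrow> real ^ 'm ^ 'd" and I :: "real \<Rightarrow> 'w \<Rightarrow> real ^ 'd"
    and x\<^sub>0 :: "real ^ 'd" and R K :: real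
  assumes \<sigma>_cont: "continuous_on UNIV \<sigma>" and b_cont: "continuous_on UNIV b"
    and X_adapted: "\<And>t. 0 \<le> t \<Longrightarrow> X t \<in> borel_measurable (F t)"
    and X_cont: "\<And>\<omega>. \<omega> \<in> space M \<Longrightarrow> continuous_on {0..} (\<lambda>t. X t \<omega>)"
    and e_adapted: "\<And>t. 0 \<le> t \<Longrightarrow> {\<omega>\<in>space M. ereal t < e \<omega>} \<in> sets (F t)"
    and e_nonneg: "\<And>\<omega>. \<omega> \<in> space M \<Longrightarrow> 0 \<le> e \<omega>"
    and X_bounded: "\<And>\<omega> t. \<omega> \<in> space M \<Longrightarrow> 0 \<le> t \<Longrightarrow> ereal t \<le> e \<omega> \<Longrightarrow> norm (X t \<omega>) \<le> R"
    and K_nonneg: "0 \<le> K" and \<sigma>_bounded: "\<And>x. norm x \<le> R \<Longrightarrow> norm (\<sigma> x) \<le> K"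
    and b_bounded: "\<And>x. norm x \<le> R \<Longrightarrow> norm (b x) \<le> K"
    and ito: "has_ito_integral M F W H I"
    and H_eq: "AE \<omega> in M. \<forall>s\<ge>0. H s \<omega> = (if ereal s \<le> e \<omega> then \<sigma> (X s \<omega>) else 0)"
    and solution: "AE \<omega> in M. \<forall>t\<ge>0. X (real_of_ereal (min (ereal t) (e \<omega>))) \<omega> =
      x\<^sub>0 + I t \<omega> + (LINT s:{0..real_of_ereal (min (ereal t) (e \<omega>))}|lborel. b (X s \<omega>))"
begin

text \<open>
  In contrast to \<open>H\<close>, these coefficients vanish at the exit time itself, so that they are adapted by
  the assumption on \<open>{\<omega>\<in>space M. ereal t < e \<omega>}\<close>.
\<close>

definition diffusion_at :: "real \<Rightarrow> 'w \<Rightarrow> real ^ 'm ^ 'd" where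
  "diffusion_at t \<omega> = (if ereal t < e \<omega> then \<sigma> (X t \<omega>) else 0)"

definition drift_at :: "real \<Rightarrow> 'w \<Rightarrow> real ^ 'd" where
  "drift_at t \<omega> = (if ereal t < e \<omega> then b (X t \<omega>) else 0)"

definition drift_integral :: "real \<Rightarrow> 'w \<Rightarrow> real ^ 'd" where
  "drift_integral t \<omega> = (LINT s:{0..real_of_ereal (min (ereal t) (e \<omega>))}|lborel. b (X s \<omega>))"

text \<open>The right side of the stopped equation is taken as the process: it makes sense at all
  times, its increments are Ito and drift increments, and before the exit it agrees with
  \<open>X\<close> almost surely.\<close>

definition stopped :: "real \<Rightarrow> 'w \<Rightarrow> real ^ 'd" where
  "stopped t \<omega> = x\<^sub>0 + I t \<omega> + drift_integral t \<omega>"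

text \<open>Together with \<open>drift_residual\<close>, the error of one Euler step with
  coefficients frozen at the left end.\<close>

definition ito_residual :: "real \<Rightarrow> real \<Rightarrow> 'w \<Rightarrow> real ^ 'd" where
  "ito_residual s t \<omega> = I t \<omega> - I s \<omega> - diffusion_at s \<omega> *v (W t \<omega> - W s \<omega>)"

definition drift_residual :: "real \<Rightarrow> real \<Rightarrow> 'w \<Rightarrow> real ^ 'd" where
  "drift_residual s t \<omega> = drift_integral t \<omega> - drift_integral s \<omega> - (t - s) *\<^sub>R drift_at s \<omega>"

lemma diffusion_at_adapted: "0 \<le> t \<Longrightarrow> diffusion_at t \<in> borel_measurable (F t)"
  unfolding diffusion_at_def[abs_def]
  by (intro measurable_If measurable_compose[OF X_adapted borel_measurable_continuous_onI[OF \<sigma>_cont]] borel_measurable_const)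
    (simp_all add: e_adapted)

lemma drift_at_adapted: "0 \<le> t \<Longrightarrow> drift_at t \<in> borel_measurable (F t)"
  unfolding drift_at_def[abs_def]
  by (intro measurable_If measurable_compose[OF X_adapted borel_measurable_continuous_onI[OF b_cont]] borel_measurable_const)
    (simp_all add: e_adapted)

lemma diffusion_at_bounded: "\<omega> \<in> space M \<Longrightarrow> 0 \<le> t \<Longrightarrow> norm (diffusion_at t \<omega>) \<le> K"
  using \<sigma>_bounded X_bounded[of \<omega> t] K_nonneg by (auto simp: diffusion_at_def)

lemma drift_at_bounded: "\<omega> \<in> space M \<Longrightarrow> 0 \<le> t \<Longrightarrow> norm (drift_at t \<omega>) \<le> K"
  using b_bounded X_bounded[of \<omega> t] K_nonneg by (auto simp: drift_at_def)

text \<open>The time \<open>u = e \<omega>\<close> is approached through times before the exit, so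
  the left limit there is still \<open>g (X u \<omega>)\<close>; for later \<open>u\<close> the
  function is zero near \<open>u\<close>. This is how \<open><\<close> turns into
  \<open>\<le>\<close>.\<close>

lemma left_limit:
  fixes g :: "real ^ 'd \<Rightarrow> 'e::real_normed_vector"
  assumes \<omega>: "\<omega> \<in> space M" and u: "0 < u" and g: "continuous_on UNIV g"
  shows "((\<lambda>s. if ereal s < e \<omega> then g (X s \<omega>) else 0) \<longlongrightarrow> (if ereal u \<le> e \<omega> then g (X u \<omega>) else 0)) (at_left u)"
proof (cases "ereal u \<le> e \<omega>")
  case True
  have "isCont (\<lambda>s. X s \<omega>) u"
    using continuous_on_interior[OF X_cont[OF \<omega>], of u] u by auto
  moreover have "isCont g (X u \<omega>)"
    using g by (simp add: continuous_on_eq_continuous_at)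
  ultimately have "isCont (\<lambda>s. g (X s \<omega>)) u"
    by (rule isCont_o2)
  then have "((\<lambda>s. g (X s \<omega>)) \<longlongrightarrow> g (X u \<omega>)) (at_left u)"
    by (auto simp: isCont_def intro: tendsto_within_subset)
  then have "((\<lambda>s. if ereal s < e \<omega> then g (X s \<omega>) else 0) \<longlongrightarrow> g (X u \<omega>)) (at_left u)"
  proof (rule Lim_transform_eventually)
    show "\<forall>\<^sub>F s in at_left u. g (X s \<omega>) = (if ereal s < e \<omega> then g (X s \<omega>) else 0)"
      using True by (intro eventually_at_leftI[of "u - 1"]) (auto simp: less_le_trans[of "ereal _" "ereal u"])
  qed
  then show ?thesis using True by simp
next
  case False
  then obtain v where v: "e \<omega> < ereal v" "ereal v < ereal u" using ereal_dense2[of "e \<omega>" "ereal u"] by (force simp: not_le)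
  have "\<forall>\<^sub>F s in at_left u. 0 = (if ereal s < e \<omega> then g (X s \<omega>) else 0)"
  proof (rule eventually_at_leftI[of v])
    fix s assume "s \<in> {v<..<u}"
    then have "e \<omega> < ereal s" using v(1) by (auto intro: less_trans)
    then show "0 = (if ereal s < e \<omega> then g (X s \<omega>) else 0)" by auto
  qed (use v in auto)
  then show ?thesis using False by (intro Lim_transform_eventually[OF tendsto_const]) auto
qed

lemma stopped_path_measurable:
  fixes g :: "real ^ 'd \<Rightarrow> 'e::{real_normed_vector, second_countable_topology}"
  assumes \<omega>: "\<omega> \<in> space M" and T: "0 \<le> T" and g: "continuous_on UNIV g"
  shows "(\<lambda>u. (\<lambda>u. if ereal u \<le> e \<omega> then g (X u \<omega>) else 0) (max 0 (min T u))) \<in> borel_measurable borel"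
proof -
  have "continuous_on UNIV (\<lambda>u. X (max 0 (min T u)) \<omega>)"
    by (rule continuous_on_compose2[OF X_cont[OF \<omega>]]) (auto intro!: continuous_intros)
  then have "continuous_on UNIV (\<lambda>u. g (X (max 0 (min T u)) \<omega>))"
    by (rule continuous_on_compose2[OF g]) auto
  then have [measurable]: "(\<lambda>u. g (X (max 0 (min T u)) \<omega>)) \<in> borel_measurable borel" by (rule borel_measurable_continuous_onI)
  show ?thesis by measurable
qed

text \<open>The random upper limit is moved into the integrand, so that increments become integrals
  of one function over fixed intervals.\<close>

lemma drift_integral_eq:
  assumes \<omega>: "\<omega> \<in> space M" and t: "0 \<le> t"
  shows "drift_integral t \<omega> = (LINT u:{0..t}|lborel. if ereal u \<le> e \<omega> then b (X u \<omega>) else 0)"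
proof -
  define m where "m = real_of_ereal (min (ereal t) (e \<omega>))"
  have m: "min (ereal t) (e \<omega>) = ereal m"
    using e_nonneg[OF \<omega>] t by (cases "e \<omega>") (auto simp: min_def m_def)
  have "u \<le> m \<longleftrightarrow> u \<le> t \<and> ereal u \<le> e \<omega>" for u
    by (simp flip: ereal_less_eq(3) m)
  then show ?thesis unfolding drift_integral_def m_def[symmetric] set_lebesgue_integral_def
    by (intro Bochner_Integration.integral_cong) (auto simp: indicator_def)
qed

lemma drift_set_integrable:
  assumes \<omega>: "\<omega> \<in> space M" and s: "0 \<le> s" and A: "A \<subseteq> {0..t}" "A \<in> sets borel"
  shows "set_integrable lborel A (\<lambda>u. if ereal u \<le> e \<omega> then b (X u \<omega>) else 0)"
proof (cases "0 \<le> t")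
  case True
  let ?\<beta> = "\<lambda>u. if ereal u \<le> e \<omega> then b (X u \<omega>) else 0"
  note m = stopped_path_measurable[OF \<omega> True b_cont]
  have "emeasure lborel A \<le> emeasure lborel {0..t}" using A by (intro emeasure_mono) auto
  then have fin: "emeasure lborel A < \<infinity>" using True by (simp add: le_less_trans)
  have "integrable lborel (\<lambda>u. indicator A u *\<^sub>R ?\<beta> (max 0 (min t u)))"
  proof (rule integrableI_bounded_set[where A=A and B=K])
    have "norm (?\<beta> (max 0 (min t u))) \<le> K" for u
      using b_bounded[OF X_bounded[OF \<omega>, of "max 0 (min t u)"]] K_nonneg by simp
    then show "AE u in lborel. u \<in> A \<longrightarrow> norm (indicator A u *\<^sub>R ?\<beta> (max 0 (min t u))) \<le> K"
      by (intro AE_I2) simp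
    show "(\<lambda>u. indicator A u *\<^sub>R ?\<beta> (max 0 (min t u))) \<in> borel_measurable lborel"
      using m A(2) by (intro borel_measurable_scaleR) simp_all
  qed (use A(2) fin in auto)
  moreover have "(\<lambda>u. indicator A u *\<^sub>R ?\<beta> (max 0 (min t u))) = (\<lambda>u. indicator A u *\<^sub>R ?\<beta> u)"
    using A(1) by (auto simp: fun_eq_iff indicator_def subset_iff max_def min_def)
  ultimately show ?thesis by (simp add: set_integrable_def)
next
  case False
  then have "A = {}" using A by auto
  then show ?thesis by (simp add: set_integrable_def)
qed

lemma drift_integral_diff:
  assumes \<omega>: "\<omega> \<in> space M" and st: "0 \<le> s" "s \<le> t"
  shows "drift_integral t \<omega> - drift_integral s \<omega> = (LINT u:{s<..t}|lborel. if ereal u \<le> e \<omega> then b (X u \<omega>) else 0)"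
    and "norm (drift_integral t \<omega> - drift_integral s \<omega>) \<le> K * (t - s)"
proof -
  let ?\<beta> = "\<lambda>u. if ereal u \<le> e \<omega> then b (X u \<omega>) else 0"
  have t: "0 \<le> t" using st by simp
  have U: "{0..t} = {0..s} \<union> {s<..t}" using st by auto
  have "(LINT u:{0..t}|lborel. ?\<beta> u) = (LINT u:{0..s}|lborel. ?\<beta> u) + (LINT u:{s<..t}|lborel. ?\<beta> u)"
    unfolding U using st by (intro set_integral_Un drift_set_integrable[OF \<omega> st(1), of _ t]) auto
  then show eq: "drift_integral t \<omega> - drift_integral s \<omega> = (LINT u:{s<..t}|lborel. ?\<beta> u)"
    using drift_integral_eq[OF \<omega> t] drift_integral_eq[OF \<omega> st(1)] by simp
  have "norm (LINT u:{s<..t}|lborel. ?\<beta> u) \<le> (LINT u:{s<..t}|lborel. norm (?\<beta> u))"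
    by (rule set_integral_norm_bound) (rule drift_set_integrable[OF \<omega> st(1), of _ t], use st in auto)
  also have "\<dots> \<le> (LINT u:{s<..t}|lborel. K)"
  proof (rule set_integral_mono)
    show "set_integrable lborel {s<..t} (\<lambda>u. norm (?\<beta> u))"
      by (rule set_integrable_norm) (rule drift_set_integrable[OF \<omega> st(1), of _ t], use st in auto)
    show "set_integrable lborel {s<..t} (\<lambda>u. K)" using st by (auto simp: set_integrable_def intro!: integrable_mult_indicator)
    show "norm (?\<beta> u) \<le> K" if "u \<in> {s<..t}" for u
      using that st b_bounded X_bounded[OF \<omega>, of u] K_nonneg by auto
  qed
  also have "\<dots> = K * (t - s)" using st by (simp add: set_lebesgue_integral_def)
  finally show "norm (drift_integral t \<omega> - drift_integral s \<omega>) \<le> K * (t - s)" unfolding eq .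
qed

lemma drift_riemann:
  assumes \<omega>: "\<omega> \<in> space M" and T: "0 < T"
  shows "(\<lambda>N. \<Sum>j<N. norm (drift_integral (grid T N (Suc j)) \<omega> - drift_integral (grid T N j) \<omega> - (T / real N) *\<^sub>R drift_at (grid T N j) \<omega>)) \<longlonglongrightarrow> 0"
proof (rule grid_riemann_sum[OF T, where \<psi> = "\<lambda>s. drift_at s \<omega>" and \<phi> = "\<lambda>u. if ereal u \<le> e \<omega> then b (X u \<omega>) else 0" and K = K])
  show "((\<lambda>s. drift_at s \<omega>) \<longlongrightarrow> (if ereal u \<le> e \<omega> then b (X u \<omega>) else 0)) (at_left u)" if "0 < u" for u
    unfolding drift_at_def by (rule left_limit[OF \<omega> that b_cont])
  show "(\<lambda>u. if ereal (max 0 (min T u)) \<le> e \<omega> then b (X (max 0 (min T u)) \<omega>) else 0) \<in> borel_measurable borel"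
    using stopped_path_measurable[OF \<omega> _ b_cont, of T] T by simp
qed (use drift_at_bounded[OF \<omega>] b_bounded X_bounded[OF \<omega>] K_nonneg drift_integral_diff(1)[OF \<omega>] in auto)

lemma drift_integral_0: "\<omega> \<in> space M \<Longrightarrow> drift_integral 0 \<omega> = 0"
proof -
  assume \<omega>: "\<omega> \<in> space M"
  have "drift_integral 0 \<omega> = (LINT u:{0}|lborel. if ereal u \<le> e \<omega> then b (X u \<omega>) else 0)"
    using drift_integral_eq[OF \<omega>, of 0] by simp
  also have "\<dots> = 0"
    by (intro integral_eq_zero_AE[unfolded set_lebesgue_integral_def[symmetric]] eventually_mono[OF AE_lborel_singleton[of "0::real"]] | simp add: set_lebesgue_integral_def)+
  finally show ?thesis .
qed

text \<open>A pathwise limit of Riemann sums of the adapted values \<open>drift_at\<close>; this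
  avoids joint measurability of \<open>X\<close> in time and outcome.\<close>

lemma drift_integral_measurable:
  assumes t: "0 \<le> t" shows "drift_integral t \<in> borel_measurable M"
proof (cases "t = 0")
  case True
  then show ?thesis using drift_integral_0 by (simp cong: measurable_cong)
next
  case False
  then have t': "0 < t" using t by simp
  have [measurable]: "drift_at (grid t N j) \<in> borel_measurable M" for N j
    by (rule measurable_F[OF drift_at_adapted]) (use t in \<open>auto intro: grid_nonneg\<close>)
  show ?thesis
  proof (rule borel_measurable_LIMSEQ_metric)
    show "(\<lambda>\<omega>. \<Sum>j<N. (t / real N) *\<^sub>R drift_at (grid t N j) \<omega>) \<in> borel_measurable M" for N by measurable
    fix \<omega> assume \<omega>: "\<omega> \<in> space M"
    let ?B = "\<lambda>N j. drift_integral (grid t N j) \<omega>"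
    have "(\<lambda>N. drift_integral t \<omega> - (\<Sum>j<N. (t / real N) *\<^sub>R drift_at (grid t N j) \<omega>)) \<longlonglongrightarrow> 0"
    proof (rule Lim_null_comparison[OF _ drift_riemann[OF \<omega> t']])
      show "\<forall>\<^sub>F N in sequentially. norm (drift_integral t \<omega> - (\<Sum>j<N. (t / real N) *\<^sub>R drift_at (grid t N j) \<omega>))
        \<le> (\<Sum>j<N. norm (?B N (Suc j) - ?B N j - (t / real N) *\<^sub>R drift_at (grid t N j) \<omega>))"
        using eventually_gt_at_top[of 0]
      proof eventually_elim
        case (elim N)
        have "drift_integral t \<omega> = (\<Sum>j<N. ?B N (Suc j) - ?B N j)"
          using sum_lessThan_telescope[of "?B N" N] elim drift_integral_0[OF \<omega>] by simp
        then have "drift_integral t \<omega> - (\<Sum>j<N. (t / real N) *\<^sub>R drift_at (grid t N j) \<omega>) =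
          (\<Sum>j<N. ?B N (Suc j) - ?B N j - (t / real N) *\<^sub>R drift_at (grid t N j) \<omega>)"
          by (simp only: sum_subtractf)
        then show ?case by (simp only:) (rule norm_sum)
      qed
    qed
    then have "(\<lambda>N. drift_integral t \<omega> - (drift_integral t \<omega> - (\<Sum>j<N. (t / real N) *\<^sub>R drift_at (grid t N j) \<omega>))) \<longlonglongrightarrow> drift_integral t \<omega> - 0"
      by (intro tendsto_diff tendsto_const)
    then show "(\<lambda>N. \<Sum>j<N. (t / real N) *\<^sub>R drift_at (grid t N j) \<omega>) \<longlonglongrightarrow> drift_integral t \<omega>" by simp
  qed
qed

lemma stopped_measurable: "0 \<le> t \<Longrightarrow> stopped t \<in> borel_measurable M"
  unfolding stopped_def[abs_def] using drift_integral_measurable[of t] ito measurable_F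
  by (intro borel_measurable_add borel_measurable_const) (auto simp: has_ito_integral_def)

lemma stopped_eq: "AE \<omega> in M. \<forall>t\<ge>0. ereal t < e \<omega> \<longrightarrow> stopped t \<omega> = X t \<omega>"
  using solution by eventually_elim (auto simp: stopped_def drift_integral_def min_def)

lemma H_bounded: "AE \<omega> in M. \<forall>u\<in>{0..T}. norm (H u \<omega>) \<le> K"
  using H_eq AE_space
proof eventually_elim
  case (elim \<omega>)
  then show ?case using \<sigma>_bounded X_bounded[OF elim(2)] K_nonneg by auto
qed

text \<open>Pathwise the sum vanishes by \<open>drift_riemann\<close>. Each of the \<open>N\<close>
  cells contributes at most \<open>2 * K * T / N\<close>, so dominated convergence applies.\<close>

lemma drift_residual_tendsto:
  assumes T: "0 < T"
  shows "(\<lambda>N. \<Sum>j<N. expectation (\<lambda>\<omega>. norm (drift_residual (grid T N j) (grid T N (Suc j)) \<omega>))) \<longlonglongrightarrow> 0"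
    and "integrable M (\<lambda>\<omega>. norm (drift_residual (grid T N j) (grid T N (Suc j)) \<omega>))"
    and "\<omega> \<in> space M \<Longrightarrow> norm (drift_residual (grid T N j) (grid T N (Suc j)) \<omega>) \<le> 2 * K * T / real N"
  unfolding drift_residual_def grid_Suc
proof -
  let ?d = "\<lambda>N j \<omega>. norm (drift_integral (grid T N (Suc j)) \<omega> - drift_integral (grid T N j) \<omega> - (T / real N) *\<^sub>R drift_at (grid T N j) \<omega>)"
  have g0: "0 \<le> grid T N j" for N j using T by (auto intro: grid_nonneg)
  have [measurable]: "drift_at (grid T N j) \<in> borel_measurable M" "drift_integral (grid T N j) \<in> borel_measurable M" for N j
    by (auto intro: measurable_F[OF drift_at_adapted] drift_integral_measurable g0)
  have dm[measurable]: "(\<lambda>\<omega>. ?d N j \<omega>) \<in> borel_measurable M" for N j by measurable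
  show le: "?d N j \<omega> \<le> 2 * K * T / real N" if \<omega>: "\<omega> \<in> space M" for N j \<omega>
  proof -
    have "norm (drift_integral (grid T N (Suc j)) \<omega> - drift_integral (grid T N j) \<omega>) \<le> K * (T / real N)"
      using drift_integral_diff(2)[OF \<omega> g0[of N j], of "grid T N (Suc j)"] T grid_mono[of T j "Suc j" N] by (simp add: grid_Suc)
    moreover have "norm ((T / real N) *\<^sub>R drift_at (grid T N j) \<omega>) \<le> (T / real N) * K"
      using drift_at_bounded[OF \<omega> g0] T by (auto intro!: divide_right_mono mult_left_mono)
    moreover note norm_triangle_ineq4[of "drift_integral (grid T N (Suc j)) \<omega> - drift_integral (grid T N j) \<omega>" "(T / real N) *\<^sub>R drift_at (grid T N j) \<omega>"]
      moreover have "2 * K * T / real N = K * (T / real N) + (T / real N) * K" by simp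
    ultimately show ?thesis by linarith
  qed
  show int: "integrable M (\<lambda>\<omega>. ?d N j \<omega>)" for N j
    by (rule integrable_const_bound[of _ "2 * K * T / real N"]) (use le in auto)
  have "(\<lambda>N. expectation (\<lambda>\<omega>. \<Sum>j<N. ?d N j \<omega>)) \<longlonglongrightarrow> expectation (\<lambda>_. 0)"
  proof (rule integral_dominated_convergence[where w = "\<lambda>_. 2 * K * T"])
    show "AE \<omega> in M. (\<lambda>N. \<Sum>j<N. ?d N j \<omega>) \<longlonglongrightarrow> 0" by (rule AE_I2) (rule drift_riemann[OF _ T])
    show "AE \<omega> in M. norm (\<Sum>j<N. ?d N j \<omega>) \<le> 2 * K * T" for N
    proof (rule AE_I2)
      fix \<omega> assume \<omega>: "\<omega> \<in> space M"
      have "(\<Sum>j<N. ?d N j \<omega>) \<le> (\<Sum>j<N. 2 * K * T / real N)" by (intro sum_mono le \<omega>)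
      also have "\<dots> \<le> 2 * K * T" using K_nonneg T by simp
      finally show "norm (\<Sum>j<N. ?d N j \<omega>) \<le> 2 * K * T" by (simp add: sum_nonneg)
    qed
  qed auto
  then show "(\<lambda>N. \<Sum>j<N. expectation (\<lambda>\<omega>. ?d N j \<omega>)) \<longlonglongrightarrow> 0"
    using int by (simp add: Bochner_Integration.integral_sum)
qed

text \<open>Freezing at the left end of each cell leaves an error governed by the energy
  \<open>\<Phi> N\<close> of \<open>diffusion_at - H\<close>. It tends to zero pathwise through the
  left limits and is at most \<open>(2 * K)\<^sup>2 * T\<close>, both almost surely, hence it tends
  to zero in mean.\<close>

lemma ito_residual_second_moment:
  assumes T: "0 < T"
  shows "(\<lambda>N. \<Sum>j<N. \<integral>\<^sup>+\<omega>. ennreal ((norm (ito_residual (grid T N j) (grid T N (Suc j)) \<omega>))\<^sup>2) \<partial>M) \<longlonglongrightarrow> 0"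
proof -
  have T0: "0 \<le> T" using T by simp
  let ?J = "\<lambda>N j. {grid T N j<..grid T N (Suc j)}"
  define \<Phi> where "\<Phi> N \<omega> = (\<Sum>j<N. \<integral>\<^sup>+u\<in>?J N j. ennreal ((norm (diffusion_at (grid T N j) \<omega> - H u \<omega>))\<^sup>2) \<partial>lborel)" for N \<omega>
  have g0: "0 \<le> grid T N j" for N j using T by (auto intro: grid_nonneg)
  have diffusion_m[measurable]: "diffusion_at (grid T N j) \<in> borel_measurable M" for N j
    by (rule measurable_F[OF diffusion_at_adapted[OF g0]])
  note pr = ito_progressive[OF ito T0 H_bounded]
  have piece[measurable]: "(\<lambda>\<omega>. \<integral>\<^sup>+u\<in>?J N j. ennreal ((norm (diffusion_at (grid T N j) \<omega> - H u \<omega>))\<^sup>2) \<partial>lborel) \<in> borel_measurable M" if "j < N" for N j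
  proof (rule distance_measurable(1)[OF pr T0 constant_joint_measurable[OF diffusion_m]])
    show "?J N j \<subseteq> {0..T}" using g0[of N j] grid_le[OF T0, of "Suc j" N] that by auto
  qed simp
  have "(\<lambda>N. \<integral>\<^sup>+\<omega>. \<Phi> N \<omega> \<partial>M) \<longlonglongrightarrow> (\<integral>\<^sup>+\<omega>. 0 \<partial>M)"
  proof (rule nn_integral_dominated_convergence[where w = "\<lambda>_. ennreal ((2 * K)\<^sup>2 * T)" and u' = "\<lambda>_. 0"])
    show "\<Phi> N \<in> borel_measurable M" for N unfolding \<Phi>_def[abs_def] by (intro borel_measurable_sum) auto
    show "AE \<omega> in M. \<Phi> N \<omega> \<le> ennreal ((2 * K)\<^sup>2 * T)" for N
      using H_bounded[of T] AE_space
    proof eventually_elim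
      case (elim \<omega>)
      have "(\<integral>\<^sup>+u\<in>?J N j. ennreal ((norm (diffusion_at (grid T N j) \<omega> - H u \<omega>))\<^sup>2) \<partial>lborel) \<le> ennreal ((2 * K)\<^sup>2 * (T / real N))" if j: "j < N" for j
      proof -
        have "(\<integral>\<^sup>+u\<in>?J N j. ennreal ((norm (diffusion_at (grid T N j) \<omega> - H u \<omega>))\<^sup>2) \<partial>lborel) \<le> (\<integral>\<^sup>+u. ennreal ((2 * K)\<^sup>2) * indicator (?J N j) u \<partial>lborel)"
        proof (rule nn_integral_mono)
          fix u
          have "norm (diffusion_at (grid T N j) \<omega> - H u \<omega>) \<le> 2 * K" if "u \<in> ?J N j"
          proof -
            have "u \<in> {0..T}" using that g0[of N j] grid_le[OF T0, of "Suc j" N] j by simp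
            then have "norm (H u \<omega>) \<le> K" by (rule bspec[OF elim(1)])
            then show ?thesis using diffusion_at_bounded[OF elim(2) g0[of N j]] norm_triangle_ineq4[of "diffusion_at (grid T N j) \<omega>" "H u \<omega>"] by simp
          qed
          then have "u \<in> ?J N j \<Longrightarrow> ennreal ((norm (diffusion_at (grid T N j) \<omega> - H u \<omega>))\<^sup>2) \<le> ennreal ((2 * K)\<^sup>2)"
            by (intro ennreal_leI power_mono) auto
          then show "ennreal ((norm (diffusion_at (grid T N j) \<omega> - H u \<omega>))\<^sup>2) * indicator (?J N j) u \<le> ennreal ((2 * K)\<^sup>2) * indicator (?J N j) u"
            by (cases "u \<in> ?J N j") simp_all
        qed
        also have "\<dots> = ennreal ((2 * K)\<^sup>2 * (T / real N))"
        proof -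
          have "emeasure lborel (?J N j) = ennreal (T / real N)"
            using grid_mono[OF T0, of j "Suc j" N] by (simp add: grid_Suc)
          then show ?thesis
            using T0 by (subst nn_integral_cmult_indicator, simp, subst ennreal_mult'') (simp, simp only:)
        qed
        finally show ?thesis .
      qed
      then have "\<Phi> N \<omega> \<le> (\<Sum>j<N. ennreal ((2 * K)\<^sup>2 * (T / real N)))" unfolding \<Phi>_def by (intro sum_mono) auto
      also have "\<dots> = ennreal (\<Sum>j<N. (2 * K)\<^sup>2 * (T / real N))" using T0 by (intro sum_ennreal) auto
      also have "\<dots> \<le> ennreal ((2 * K)\<^sup>2 * T)" using T0 by (intro ennreal_leI) auto
      finally show ?case .
    qed
    show "AE \<omega> in M. (\<lambda>N. \<Phi> N \<omega>) \<longlonglongrightarrow> 0"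
      using H_eq AE_space
    proof eventually_elim
      case (elim \<omega>)
      let ?\<phi> = "\<lambda>u. if ereal u \<le> e \<omega> then \<sigma> (X u \<omega>) else 0"
      have "(\<lambda>N. \<Sum>j<N. \<integral>\<^sup>+u\<in>?J N j. ennreal ((norm (diffusion_at (grid T N j) \<omega> - ?\<phi> u))\<^sup>2) \<partial>lborel) \<longlonglongrightarrow> 0"
      proof (rule grid_left_limit_integral(2)[OF T, where K = K and \<psi> = "\<lambda>s. diffusion_at s \<omega>"])
        show "((\<lambda>s. diffusion_at s \<omega>) \<longlongrightarrow> ?\<phi> u) (at_left u)" if "0 < u" for u
          unfolding diffusion_at_def by (rule left_limit[OF elim(2) that \<sigma>_cont])
        show "(\<lambda>u. ?\<phi> (max 0 (min T u))) \<in> borel_measurable borel"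
          by (rule stopped_path_measurable[OF elim(2) T0 \<sigma>_cont])
      qed (use diffusion_at_bounded[OF elim(2)] \<sigma>_bounded X_bounded[OF elim(2)] K_nonneg in auto)
      moreover have "(\<Sum>j<N. \<integral>\<^sup>+u\<in>?J N j. ennreal ((norm (diffusion_at (grid T N j) \<omega> - ?\<phi> u))\<^sup>2) \<partial>lborel) = \<Phi> N \<omega>" for N
      proof -
        have "0 \<le> u" if "u \<in> ?J N j" for u j using that g0[of N j] by auto
        then show ?thesis unfolding \<Phi>_def using elim(1)
          by (intro sum.cong refl nn_integral_cong) (auto simp: indicator_def)
      qed
      ultimately show ?case by simp
    qed
  qed (auto simp: emeasure_space_1)
  then have "(\<lambda>N. \<integral>\<^sup>+\<omega>. \<Phi> N \<omega> \<partial>M) \<longlonglongrightarrow> 0" by simp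
  from tendsto_mult_ennreal[OF tendsto_const this, of 2]
  have lim: "(\<lambda>N. 2 * (\<integral>\<^sup>+\<omega>. \<Phi> N \<omega> \<partial>M)) \<longlonglongrightarrow> 0" by simp
  show ?thesis
  proof (rule tendsto_sandwich[OF _ _ tendsto_const lim])
    show "\<forall>\<^sub>F N in sequentially. (\<Sum>j<N. \<integral>\<^sup>+\<omega>. ennreal ((norm (ito_residual (grid T N j) (grid T N (Suc j)) \<omega>))\<^sup>2) \<partial>M)
      \<le> 2 * (\<integral>\<^sup>+\<omega>. \<Phi> N \<omega> \<partial>M)"
    proof (rule always_eventually, rule allI)
      fix N
      have "(\<Sum>j<N. \<integral>\<^sup>+\<omega>. ennreal ((norm (ito_residual (grid T N j) (grid T N (Suc j)) \<omega>))\<^sup>2) \<partial>M)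
        \<le> (\<Sum>j<N. 2 * (\<integral>\<^sup>+\<omega>. (\<integral>\<^sup>+u\<in>?J N j. ennreal ((norm (diffusion_at (grid T N j) \<omega> - H u \<omega>))\<^sup>2) \<partial>lborel) \<partial>M))"
      proof (rule sum_mono)
        fix j assume "j \<in> {..<N}"
        then show "(\<integral>\<^sup>+\<omega>. ennreal ((norm (ito_residual (grid T N j) (grid T N (Suc j)) \<omega>))\<^sup>2) \<partial>M)
          \<le> 2 * (\<integral>\<^sup>+\<omega>. (\<integral>\<^sup>+u\<in>?J N j. ennreal ((norm (diffusion_at (grid T N j) \<omega> - H u \<omega>))\<^sup>2) \<partial>lborel) \<partial>M)"
          unfolding ito_residual_def
          by (intro ito_increment_second_moment[OF ito T0 H_bounded, of _ _ _ K] g0 grid_mono grid_le T0 diffusion_at_adapted diffusion_at_bounded) auto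
      qed
      also have "\<dots> = 2 * (\<integral>\<^sup>+\<omega>. \<Phi> N \<omega> \<partial>M)"
        unfolding \<Phi>_def by (subst nn_integral_sum) (auto simp: sum_distrib_left)
      finally show "(\<Sum>j<N. \<integral>\<^sup>+\<omega>. ennreal ((norm (ito_residual (grid T N j) (grid T N (Suc j)) \<omega>))\<^sup>2) \<partial>M)
      \<le> 2 * (\<integral>\<^sup>+\<omega>. \<Phi> N \<omega> \<partial>M)" .
    qed
  qed auto
qed

lemma stopped_increment:
  "stopped t \<omega> - stopped s \<omega> =
    diffusion_at s \<omega> *v (W t \<omega> - W s \<omega>) + (t - s) *\<^sub>R drift_at s \<omega> + ito_residual s t \<omega> + drift_residual s t \<omega>"
  by (simp add: stopped_def ito_residual_def drift_residual_def)

lemma I_measurable: "0 \<le> t \<Longrightarrow> I t \<in> borel_measurable M"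
  using ito measurable_F by (auto simp: has_ito_integral_def)

lemma ito_residual_measurable: "0 \<le> s \<Longrightarrow> 0 \<le> t \<Longrightarrow> ito_residual s t \<in> borel_measurable M"
  unfolding ito_residual_def[abs_def]
  by (intro borel_measurable_diff borel_measurable_matrix_vector_mult I_measurable W_measurable measurable_F[OF diffusion_at_adapted])

text \<open>Extended sums that tend to zero are eventually finite. From then on every residual is
  square integrable and the sums are real expectations; hence the first claim speaks of large
  \<open>N\<close>.\<close>

lemma ito_residual_tendsto:
  assumes T: "0 < T"
  shows "\<forall>\<^sub>F N in sequentially. \<forall>j<N. integrable M (\<lambda>\<omega>. (norm (ito_residual (grid T N j) (grid T N (Suc j)) \<omega>))\<^sup>2)"
    and "(\<lambda>N. \<Sum>j<N. expectation (\<lambda>\<omega>. (norm (ito_residual (grid T N j) (grid T N (Suc j)) \<omega>))\<^sup>2)) \<longlonglongrightarrow> 0"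
proof -
  let ?r = "\<lambda>N j \<omega>. (norm (ito_residual (grid T N j) (grid T N (Suc j)) \<omega>))\<^sup>2"
  let ?S = "\<lambda>N. \<Sum>j<N. \<integral>\<^sup>+\<omega>. ennreal (?r N j \<omega>) \<partial>M"
  have g0: "0 \<le> grid T N j" for N j using T by (auto intro: grid_nonneg)
  have [measurable]: "ito_residual (grid T N j) (grid T N (Suc j)) \<in> borel_measurable M" for N j
    by (intro ito_residual_measurable g0)
  have S: "?S \<longlonglongrightarrow> 0"
    by (rule ito_residual_second_moment[OF T])
  have ev: "\<forall>\<^sub>F N in sequentially. ?S N < \<infinity>"
    using order_tendstoD(2)[OF S, of \<infinity>] by simp
  have int: "integrable M (?r N j)" if "?S N < \<infinity>" "j < N" for N j
  proof -
    have "(\<integral>\<^sup>+\<omega>. ennreal (?r N j \<omega>) \<partial>M) < \<infinity>"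
    proof (rule le_less_trans[OF _ that(1)])
      show "(\<integral>\<^sup>+\<omega>. ennreal (?r N j \<omega>) \<partial>M) \<le> ?S N" using that(2) by (intro member_le_sum) auto
    qed
    then show ?thesis by (intro integrableI_bounded) auto
  qed
  show "\<forall>\<^sub>F N in sequentially. \<forall>j<N. integrable M (?r N j)"
    using ev by eventually_elim (use int in blast)
  have "?S \<longlonglongrightarrow> ennreal 0" using S by simp
  then have "(\<lambda>N. enn2real (?S N)) \<longlonglongrightarrow> 0" by (rule tendsto_enn2real) simp
  moreover have "\<forall>\<^sub>F N in sequentially. enn2real (?S N) = (\<Sum>j<N. expectation (?r N j))"
    using ev
  proof eventually_elim
    case (elim N)
    have "?S N = (\<Sum>j<N. ennreal (expectation (?r N j)))"
      using int[OF elim] by (intro sum.cong refl nn_integral_eq_integral) auto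
    also have "\<dots> = ennreal (\<Sum>j<N. expectation (?r N j))" by (rule sum_ennreal) auto
    finally show ?case by (simp only:) (simp add: sum_nonneg)
  qed
  ultimately show "(\<lambda>N. \<Sum>j<N. expectation (?r N j)) \<longlonglongrightarrow> 0"
    by (simp add: tendsto_cong)
qed

end

section \<open>Exit times of continuous paths\<close>

lemma continuous_on_halflineD:
  fixes \<phi> :: "real \<Rightarrow> real"
  assumes \<phi>: "continuous_on {0..} \<phi>" and t: "0 \<le> t" and e: "0 < e"
  obtains d where "0 < d" "\<And>s. 0 \<le> s \<Longrightarrow> \<bar>s - t\<bar> < d \<Longrightarrow> \<bar>\<phi> s - \<phi> t\<bar> < e"
proof -
  have "\<exists>d>0. \<forall>s\<in>{0..}. dist s t < d \<longrightarrow> dist (\<phi> s) (\<phi> t) < e"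
    using \<phi>[unfolded continuous_on_iff, THEN bspec, of t] t e by simp
  then show ?thesis using that by (auto simp: dist_real_def)
qed

context
  fixes x :: "real \<Rightarrow> real ^ 'd" and n :: nat
  assumes cont: "continuous_on {0..} x" and start: "norm (x 0) < real n"
begin

text \<open>If the norm is below \<open>n\<close> on the closed interval, continuity at
  \<open>t\<close> keeps it there a little longer, so the infimum exceeds \<open>t\<close> strictly.
  The infimum is \<open>exit_time\<close> for an infinite lifetime.\<close>

lemma below_exit_iff:
  assumes t: "0 \<le> t"
  shows "ereal t < Inf {ereal s |s. 0 \<le> s \<and> ereal s < \<infinity> \<and> real n \<le> norm (x s)} \<longleftrightarrow> (\<forall>s\<in>{0..t}. norm (x s) < real n)"
    (is "_ < Inf ?E \<longleftrightarrow> _")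
proof
  assume l: "ereal t < Inf ?E"
  show "\<forall>s\<in>{0..t}. norm (x s) < real n"
  proof (rule ballI, rule ccontr)
    fix s assume s: "s \<in> {0..t}" "\<not> norm (x s) < real n"
    then have "Inf ?E \<le> ereal s" by (intro Inf_lower) auto
    also have "\<dots> \<le> ereal t" using s by simp
    finally show False using l by simp
  qed
next
  assume l: "\<forall>s\<in>{0..t}. norm (x s) < real n"
  have "continuous_on {0..} (\<lambda>s. norm (x s))" by (intro continuous_intros cont)
  from continuous_on_halflineD[OF this t, of "real n - norm (x t)"] l t obtain d where d: "0 < d" "\<And>s. 0 \<le> s \<Longrightarrow> \<bar>s - t\<bar> < d \<Longrightarrow> \<bar>norm (x s) - norm (x t)\<bar> < real n - norm (x t)"
    by auto
  have "ereal (t + d) \<le> Inf ?E"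
  proof (rule Inf_greatest, clarify)
    fix s assume s: "0 \<le> s" "real n \<le> norm (x s)"
    have "\<not> s \<le> t" using l s by force
    moreover have "\<not> \<bar>s - t\<bar> < d" using d(2)[OF s(1)] s(2) by auto
    ultimately show "ereal (t + d) \<le> ereal s" by simp
  qed
  moreover have "ereal t < ereal (t + d)" using d by simp
  ultimately show "ereal t < Inf ?E" by (rule less_le_trans[rotated])
qed

text \<open>Exceeding \<open>n\<close> at \<open>t\<close> would by continuity put an earlier time
  into the exit set. The start inside the ball forces \<open>0 < t\<close>, so earlier times
  exist.\<close>

lemma norm_le_until_exit:
  assumes t: "0 \<le> t" "ereal t \<le> Inf {ereal s |s. 0 \<le> s \<and> ereal s < \<infinity> \<and> real n \<le> norm (x s)}"
  shows "norm (x t) \<le> real n"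
proof (rule ccontr)
  assume g: "\<not> norm (x t) \<le> real n"
  then have t0: "0 < t" using start t(1) by (cases "t = 0") auto
  have "continuous_on {0..} (\<lambda>s. norm (x s))" by (intro continuous_intros cont)
  from continuous_on_halflineD[OF this t(1), of "norm (x t) - real n"] g obtain d where d: "0 < d" "\<And>s. 0 \<le> s \<Longrightarrow> \<bar>s - t\<bar> < d \<Longrightarrow> \<bar>norm (x s) - norm (x t)\<bar> < norm (x t) - real n"
    by auto
  define s where "s = max 0 (t - d / 2)"
  have s: "0 \<le> s" "s < t" "\<bar>s - t\<bar> < d" using t0 d(1) by (auto simp: s_def)
  then have "real n \<le> norm (x s)" using d(2)[OF s(1) s(3)] by linarith
  then have "Inf {ereal s |s. 0 \<le> s \<and> ereal s < \<infinity> \<and> real n \<le> norm (x s)} \<le> ereal s"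
    using s by (intro Inf_lower) auto
  then have "ereal t \<le> ereal s" using t(2) by (rule order_trans[rotated])
  then show False using s by simp
qed

end

text \<open>Countably many times decide the condition, as measurability of the exit time requires.
  The gap comes from the maximum on a compact interval; conversely it keeps the inequality strict
  after passing to the closure of the rationals. Adding \<open>t\<close> covers
  \<open>t = 0\<close>, where the open interval is empty.\<close>

lemma continuous_less_on_interval_iff:
  fixes \<phi> :: "real \<Rightarrow> real"
  assumes \<phi>: "continuous_on {0..} \<phi>" and t: "0 \<le> t"
  shows "(\<forall>s\<in>{0..t}. \<phi> s < a) \<longleftrightarrow> (\<exists>k::nat. \<forall>q\<in>insert t ({0<..<t} \<inter> \<rat>). \<phi> q \<le> a - 1 / real (Suc k))"
proof
  assume l: "\<forall>s\<in>{0..t}. \<phi> s < a"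
  have "continuous_on {0..t} \<phi>" by (rule continuous_on_subset[OF \<phi>]) auto
  then obtain m where m: "m \<in> {0..t}" "\<And>s. s \<in> {0..t} \<Longrightarrow> \<phi> s \<le> \<phi> m"
    using continuous_attains_sup[of "{0..t}" \<phi>] t by auto
  then have "0 < a - \<phi> m" using l by auto
  then obtain k where "inverse (real (Suc k)) < a - \<phi> m" using reals_Archimedean by blast
  then have k: "\<phi> m \<le> a - 1 / real (Suc k)" by (simp add: inverse_eq_divide)
  have "\<phi> q \<le> a - 1 / real (Suc k)" if "q \<in> insert t ({0<..<t} \<inter> \<rat>)" for q
    using m(2)[of q] k that t by auto
  then show "\<exists>k::nat. \<forall>q\<in>insert t ({0<..<t} \<inter> \<rat>). \<phi> q \<le> a - 1 / real (Suc k)" by blast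
next
  assume "\<exists>k::nat. \<forall>q\<in>insert t ({0<..<t} \<inter> \<rat>). \<phi> q \<le> a - 1 / real (Suc k)"
  then obtain k :: nat where k: "\<And>q. q \<in> insert t ({0<..<t} \<inter> \<rat>) \<Longrightarrow> \<phi> q \<le> a - 1 / real (Suc k)" by blast
  show "\<forall>s\<in>{0..t}. \<phi> s < a"
  proof
    fix s assume s: "s \<in> {0..t}"
    have "\<phi> s \<le> a - 1 / real (Suc k)"
    proof (cases "s = t")
      case False
      then have t0: "0 < t" using s by auto
      have "{0<..<t} \<subseteq> closure ({0<..<t} \<inter> \<rat>)"
        using open_Int_closure_subset[of "{0<..<t}" \<rat>] by (simp add: Rats_closure_real)
      then have "closure {0<..<t} \<subseteq> closure ({0<..<t} \<inter> \<rat>)" by (intro closure_minimal) auto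
      then have s': "s \<in> closure ({0<..<t} \<inter> \<rat>)" using s t0 by auto
      have sub: "closure ({0<..<t} \<inter> \<rat>) \<subseteq> {0..}" by (intro closure_minimal) auto
      show ?thesis
        by (rule continuous_le_on_closure[OF continuous_on_subset[OF \<phi> sub] s']) (use k in auto)
    qed (use k in auto)
    then show "\<phi> s < a" by (smt (verit) divide_pos_pos of_nat_0_less_iff zero_less_Suc)
  qed
qed

lemma strong_solution_continuous:
  assumes sol: "strong_solution M W \<sigma> b x X \<zeta>" and life: "AE \<omega> in M. \<zeta> \<omega> = \<infinity>"
  shows "AE \<omega> in M. X 0 \<omega> = x \<and> continuous_on {0..} (\<lambda>t. X t \<omega>)"
proof -
  have "AE \<omega> in M. 0 < \<zeta> \<omega> \<and> X 0 \<omega> = x \<and>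
        continuous_on {t. 0 \<le> t \<and> ereal t < \<zeta> \<omega>} (\<lambda>t. X t \<omega>) \<and>
        (\<zeta> \<omega> < \<infinity> \<longrightarrow> filterlim (\<lambda>t. X t \<omega>) at_infinity (at_left (real_of_ereal (\<zeta> \<omega>))))"
    using sol unfolding strong_solution_def Let_def by blast
  then show ?thesis
    using life
  proof eventually_elim
    case (elim \<omega>)
    have "{t. 0 \<le> t \<and> ereal t < \<zeta> \<omega>} = {0..}" using elim(2) by auto
    then show ?case using elim by simp
  qed
qed

context brownian
begin

text \<open>All bad paths lie in one null set \<open>N\<close>, on which the process is made to rest
  at \<open>x\<^sub>0\<close> with exit time 0. Since every \<open>F t\<close> contains the null
  sets, adaptedness survives, while the pathwise conditions now hold everywhere.\<close>

lemma stopped_ito_of_strong_solution: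
  fixes \<sigma> :: "real ^ 'd \<Rightarrow> real ^ 'm ^ 'd"
  assumes sol: "strong_solution M W \<sigma> b x\<^sub>0 X \<zeta>" and life: "AE \<omega> in M. \<zeta> \<omega> = \<infinity>"
    and \<sigma>: "continuous_on UNIV \<sigma>" and b: "continuous_on UNIV b" and n: "norm x\<^sub>0 < real n"
    and K: "0 \<le> K" "\<And>x. norm x \<le> real n \<Longrightarrow> norm (\<sigma> x) \<le> K" "\<And>x. norm x \<le> real n \<Longrightarrow> norm (b x) \<le> K"
  obtains X' e H I where "stopped_ito M W \<sigma> b X' e H I x\<^sub>0 (real n) K"
    "AE \<omega> in M. X' 0 \<omega> = x\<^sub>0 \<and> 0 < e \<omega> \<and> continuous_on {0..} (\<lambda>t. X t \<omega>) \<and> (\<forall>t. X' t \<omega> = X t \<omega>) \<and>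
      (\<forall>t\<ge>0. (\<forall>s\<in>{0..t}. norm (X s \<omega>) < real n) \<longrightarrow> ereal t < e \<omega>)"
proof -
  define P where "P \<omega> \<longleftrightarrow> \<zeta> \<omega> = \<infinity> \<and> X 0 \<omega> = x\<^sub>0 \<and> continuous_on {0..} (\<lambda>t. X t \<omega>)" for \<omega>
  have X_meas: "X t \<in> borel_measurable (restrict_space (F t) {\<omega>\<in>space M. ereal t < \<zeta> \<omega>})" if "0 \<le> t" for t
    using sol that unfolding strong_solution_def Let_def by blast
  have "AE \<omega> in M. P \<omega>"
    using strong_solution_continuous[OF sol life] life by eventually_elim (simp add: P_def)
  then obtain N where N: "N \<in> null_sets M" "{\<omega> \<in> space M. \<not> P \<omega>} \<subseteq> N" by (auto simp: eventually_ae_filter)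
  have NP: "P \<omega>" if "\<omega> \<in> space M" "\<omega> \<notin> N" for \<omega> using N(2) that by blast
  have AEN: "AE \<omega> in M. \<omega> \<notin> N" using N(1) by (rule AE_not_in)
  obtain I where I: "has_ito_integral M F W (\<lambda>s \<omega>. if ereal s \<le> exit_time X \<zeta> n \<omega> then \<sigma> (X s \<omega>) else 0) I"
    and eq: "AE \<omega> in M. \<forall>t\<ge>0. X (real_of_ereal (min (ereal t) (exit_time X \<zeta> n \<omega>))) \<omega> =
      x\<^sub>0 + I t \<omega> + (LINT s:{0..real_of_ereal (min (ereal t) (exit_time X \<zeta> n \<omega>))}|lborel. b (X s \<omega>))"
    using sol unfolding strong_solution_def Let_def by blast
  define X' where "X' t \<omega> = (if \<omega> \<in> N then x\<^sub>0 else X t \<omega>)" for t \<omega>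
  define e where "e \<omega> = (if \<omega> \<in> N then 0 else exit_time X \<zeta> n \<omega>)" for \<omega>
  have exit: "exit_time X \<zeta> n \<omega> = Inf {ereal s |s. 0 \<le> s \<and> ereal s < \<infinity> \<and> real n \<le> norm (X s \<omega>)}" if "P \<omega>" for \<omega>
    using that by (simp add: exit_time_def P_def)
  have X'_cont: "continuous_on {0..} (\<lambda>t. X' t \<omega>)" if "\<omega> \<in> space M" for \<omega>
    using NP[OF that] by (cases "\<omega> \<in> N") (auto simp: X'_def P_def)
  have X'_meas: "X' t \<in> borel_measurable (F t)" if t: "0 \<le> t" for t
  proof -
    have Nt: "N \<in> sets (F t)" by (rule null_sets_F[OF N(1)])
    let ?S = "{\<omega> \<in> space M. \<omega> \<notin> N}"
    have S: "?S \<inter> space (F t) \<in> sets (F t)"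
    proof -
      have "?S \<inter> space (F t) = space (F t) - N" by auto
      then show ?thesis using sets.compl_sets[OF Nt] by simp
    qed
    \<comment> \<open>\<open>X t\<close> is known to be measurable only where
      \<open>t < \<zeta>\<close>; off \<open>N\<close> the lifetime is infinite, so the complement
      of \<open>N\<close> lies in that domain.\<close>
    have XS: "X t \<in> borel_measurable (restrict_space (F t) ?S)"
    proof (rule measurable_restrict_mono[OF X_meas[OF t]])
      show "?S \<subseteq> {\<omega>\<in>space M. ereal t < \<zeta> \<omega>}" using NP by (auto simp: P_def)
    qed
    have "(\<lambda>\<omega>. if \<omega> \<in> N then x\<^sub>0 else X t \<omega>) \<in> borel_measurable (F t)"
    proof (rule measurableI)
      fix A :: "(real ^ 'd) set" assume A: "A \<in> sets borel"
      have "X t -` A \<inter> space (restrict_space (F t) ?S) \<in> sets (restrict_space (F t) ?S)"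
        by (rule measurable_sets[OF XS A])
      then have 1: "X t -` A \<inter> ?S \<in> sets (F t)"
      proof -
        assume a: "X t -` A \<inter> space (restrict_space (F t) ?S) \<in> sets (restrict_space (F t) ?S)"
        have "X t -` A \<inter> space (restrict_space (F t) ?S) = X t -` A \<inter> ?S" by (auto simp: space_restrict_space)
        then show ?thesis using a S by (simp add: sets_restrict_space_iff)
      qed
      have "(\<lambda>\<omega>. if \<omega> \<in> N then x\<^sub>0 else X t \<omega>) -` A \<inter> space (F t) = (if x\<^sub>0 \<in> A then N else {}) \<union> (X t -` A \<inter> ?S)"
        using sets.sets_into_space[OF Nt] by (auto split: if_splits)
      then show "(\<lambda>\<omega>. if \<omega> \<in> N then x\<^sub>0 else X t \<omega>) -` A \<inter> space (F t) \<in> sets (F t)" using 1 Nt by auto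
    qed simp
    then show ?thesis by (simp add: X'_def[abs_def])
  qed
  have e_iff: "ereal t < e \<omega> \<longleftrightarrow> \<omega> \<notin> N \<and> (\<forall>s\<in>{0..t}. norm (X' s \<omega>) < real n)" if "\<omega> \<in> space M" "0 \<le> t" for t \<omega>
  proof (cases "\<omega> \<in> N")
    case False
    then have p: "P \<omega>" using NP that by blast
    have "ereal t < exit_time X \<zeta> n \<omega> \<longleftrightarrow> (\<forall>s\<in>{0..t}. norm (X s \<omega>) < real n)"
      unfolding exit[OF p] by (rule below_exit_iff) (use p n that in \<open>auto simp: P_def\<close>)
    then show ?thesis using False by (simp add: e_def X'_def)
  qed (use that in \<open>simp add: e_def\<close>)
  have e_meas: "{\<omega>\<in>space M. ereal t < e \<omega>} \<in> sets (F t)" if t: "0 \<le> t" for t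
  proof -
    let ?D = "insert t ({0<..<t} \<inter> \<rat>)"
    have cD: "countable ?D" by (intro countable_insert countable_Int2 countable_rat)
    have "{\<omega>\<in>space M. ereal t < e \<omega>} = (space M - N) \<inter> {\<omega> \<in> space M. \<exists>k::nat. \<forall>q\<in>?D. norm (X' q \<omega>) \<le> real n - 1 / real (Suc k)}"
    proof -
      have "(\<forall>s\<in>{0..t}. norm (X' s \<omega>) < real n) \<longleftrightarrow> (\<exists>k::nat. \<forall>q\<in>?D. norm (X' q \<omega>) \<le> real n - 1 / real (Suc k))" if "\<omega> \<in> space M" for \<omega>
        by (rule continuous_less_on_interval_iff[OF _ t]) (intro continuous_intros X'_cont[OF that])
      then show ?thesis using e_iff[OF _ t] by blast
    qed
    moreover have "{\<omega> \<in> space M. \<exists>k::nat. \<forall>q\<in>?D. norm (X' q \<omega>) \<le> real n - 1 / real (Suc k)} \<in> sets (F t)"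
    proof -
      have [measurable]: "X' q \<in> borel_measurable (F t)" if "q \<in> ?D" for q
        using that t by (intro measurable_F_mono[OF X'_meas]) auto
      have m: "{\<omega> \<in> space (F t). norm (X' q \<omega>) \<le> real n - 1 / real (Suc k)} \<in> sets (F t)" if "q \<in> ?D" for q k
        using that by measurable
      have "{\<omega> \<in> space (F t). \<exists>k::nat. \<forall>q\<in>?D. norm (X' q \<omega>) \<le> real n - 1 / real (Suc k)} \<in> sets (F t)"
        by (intro sets.sets_Collect_countable_Ex sets.sets_Collect_countable_All' m cD)
      then show ?thesis by simp
    qed
    moreover have "space M - N \<in> sets (F t)" using sets.compl_sets[OF null_sets_F[OF N(1)], of t] by simp
    ultimately show ?thesis by auto
  qed
  show ?thesis
  proof (rule that[of X' e])
    show "stopped_ito M W \<sigma> b X' e (\<lambda>s \<omega>. if ereal s \<le> exit_time X \<zeta> n \<omega> then \<sigma> (X s \<omega>) else 0) I x\<^sub>0 (real n) K"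
    proof (unfold_locales, goal_cases)
      case 1 show ?case by (rule \<sigma>)
    next
      case 2 show ?case by (rule b)
    next
      case (3 t) then show ?case by (rule X'_meas)
    next
      case (4 \<omega>) then show ?case by (rule X'_cont)
    next
      case (5 t) then show ?case by (rule e_meas)
    next
      case (6 \<omega>)
      have "0 \<le> exit_time X \<zeta> n \<omega>" unfolding exit_time_def by (rule Inf_greatest) auto
      then show ?case by (simp add: e_def)
    next
      case (7 \<omega> t)
      show ?case
      proof (cases "\<omega> \<in> N")
        case True then show ?thesis using n by (simp add: X'_def)
      next
        case False
        then have p: "P \<omega>" using NP 7(1) by blast
        have "norm (X t \<omega>) \<le> real n"
          by (rule norm_le_until_exit) (use p n 7 False in \<open>auto simp: P_def e_def exit[OF p]\<close>)
        then show ?thesis using False by (simp add: X'_def)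
      qed
    next
      case 8 show ?case by (rule K)
    next
      case (9 x) then show ?case by (rule K)
    next
      case (10 x) then show ?case by (rule K)
    next
      case 11 show ?case by (rule I)
    next
      case 12 show ?case using AEN by eventually_elim (simp add: e_def X'_def)
    next
      case 13 show ?case using AEN eq by eventually_elim (simp add: e_def X'_def)
    qed
    show "AE \<omega> in M. X' 0 \<omega> = x\<^sub>0 \<and> 0 < e \<omega> \<and> continuous_on {0..} (\<lambda>t. X t \<omega>) \<and> (\<forall>t. X' t \<omega> = X t \<omega>) \<and>
      (\<forall>t\<ge>0. (\<forall>s\<in>{0..t}. norm (X s \<omega>) < real n) \<longrightarrow> ereal t < e \<omega>)"
      using AEN AE_space
    proof eventually_elim
      case (elim \<omega>)
      then have p: "P \<omega>" using NP by blast
      have X': "X' t \<omega> = X t \<omega>" for t using elim by (simp add: X'_def)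
      have "ereal 0 < e \<omega>" using e_iff[OF elim(2), of 0] elim p n by (simp add: P_def X')
      then have "0 < e \<omega>" by (simp add: zero_ereal_def)
      then show ?case using e_iff[OF elim(2)] elim p X' by (auto simp: P_def)
    qed
  qed
qed

end

section \<open>Test functions\<close>

text \<open>At the kink the difference quotient is at most \<open>|h|\<close>. This makes the
  quadratic cutoff of the test function continuously differentiable.\<close>

lemma DERIV_power2_pos_part: "((\<lambda>x::real. (max 0 x)\<^sup>2) has_real_derivative 2 * max 0 x) (at x)"
proof -
  consider "x < 0" | "x = 0" | "0 < x" by linarith
  then show ?thesis
  proof cases
    case 1
    have "((\<lambda>x. 0) has_real_derivative 2 * max 0 x) (at x)" using 1 by auto
    then show ?thesis
      by (rule has_field_derivative_transform_within_open[where S="{..<0}"]) (use 1 in auto)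
  next
    case 2
    have "(\<lambda>h::real. (max 0 h)\<^sup>2 / h) \<midarrow>0\<rightarrow> 0"
    proof (rule Lim_null_comparison[where g="\<lambda>h. \<bar>h\<bar>"])
      show "\<forall>\<^sub>F h in at 0. norm ((max 0 h)\<^sup>2 / h) \<le> \<bar>h\<bar>"
        by (rule always_eventually) (auto simp: max_def power2_eq_square)
      show "(\<lambda>h. \<bar>h\<bar>) \<midarrow>0\<rightarrow> (0::real)" by (rule tendsto_rabs_zero) auto
    qed
    then show ?thesis using 2 by (simp add: DERIV_def)
  next
    case 3
    have "((\<lambda>x. x\<^sup>2) has_real_derivative 2 * max 0 x) (at x)" using 3 by (auto intro!: derivative_eq_intros)
    then show ?thesis
      by (rule has_field_derivative_transform_within_open[where S="{0<..}"]) (use 3 in auto)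
  qed
qed

text \<open>
  Used on \<open>u = |X t - Y t|\<^sup>2\<close>; the last two conjuncts bound the drift of \<open>g u\<close> by a constant that
  does not depend on \<open>g 0\<close>.
\<close>

definition test_function ::
    "(real \<Rightarrow> real) \<Rightarrow> real \<Rightarrow> (real \<Rightarrow> real) \<Rightarrow> (real \<Rightarrow> real) \<Rightarrow> (real \<Rightarrow> real) \<Rightarrow> bool" where
  "test_function r c g g1 g2 \<longleftrightarrow>
     (\<forall>u\<ge>0. (g has_real_derivative g1 u) (at u)) \<and> (\<forall>u\<ge>0. (g1 has_real_derivative g2 u) (at u)) \<and>
     continuous_on {0..} g2 \<and> (\<forall>u\<ge>c. g1 u = 0 \<and> g2 u = 0) \<and> (\<forall>u\<ge>0. g1 u \<le> 0 \<and> 0 \<le> g u) \<and>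
     (\<forall>u. 0 < u \<longrightarrow> u < c \<longrightarrow> - g1 u * (u * r u) \<le> 1 \<and> g2 u * (u\<^sup>2 * r u) \<le> 4)"

lemma antiderivative_from:
  fixes p :: "real \<Rightarrow> real"
  assumes p: "continuous_on {l..} p" and u: "l < u"
  shows "((\<lambda>u. integral {l..u} p) has_real_derivative p u) (at u)"
proof -
  have "((\<lambda>u. integral {l..u} p) has_vector_derivative p u) (at u within {l..u + 1})"
    using u by (intro integral_has_vector_derivative continuous_on_subset[OF p]) auto
  then show ?thesis
    using u by (subst (asm) at_within_interior) (auto simp: has_real_derivative_iff_has_vector_derivative)
qed

context
  fixes r r' :: "real \<Rightarrow> real" and \<delta> :: real
  assumes \<delta>: "0 < \<delta>" "\<delta> \<le> 1"
    and r_pos: "\<And>s. s \<in> {0<..\<delta>} \<Longrightarrow> r s > 0"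
    and r_deriv: "\<And>s. s \<in> {0<..\<delta>} \<Longrightarrow> (r has_real_derivative r' s) (at s within {0<..\<delta>})"
    and r'_cont: "continuous_on {0<..\<delta>} r'"
    and r_int: "(\<integral>\<^sup>+ s\<in>{0<..\<delta>}. ennreal (1 / (s * r s)) \<partial>lborel) = \<infinity>"
    and r_slow: "((\<lambda>s. s * r' s / r s) \<longlongrightarrow> 0) (at_right 0)"
begin

lemma r_cont: "continuous_on {0<..\<delta>} r"
  by (rule DERIV_continuous_on[OF r_deriv])

text \<open>Divergence can occur only at 0, the integrand being continuous on
  \<open>[c, \<delta>]\<close>. If all integrals over \<open>[\<epsilon>, c]\<close> stayed below
  \<open>L\<close>, Fatou along \<open>v n\<close> would bound the integral over
  \<open>(0, c]\<close>.\<close>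

lemma scale_integral_unbounded:
  assumes c: "0 < c" "c \<le> \<delta>"
  shows "\<exists>\<epsilon>. 0 < \<epsilon> \<and> \<epsilon> < c \<and> L \<le> integral {\<epsilon>..c} (\<lambda>s. 1 / (s * r s))"
proof (rule ccontr)
  let ?a = "\<lambda>s. 1 / (s * r s)"
  assume "\<not> ?thesis"
  then have less: "\<And>\<epsilon>. 0 < \<epsilon> \<Longrightarrow> \<epsilon> < c \<Longrightarrow> integral {\<epsilon>..c} ?a < L" by force
  have a_cont: "continuous_on {0<..\<delta>} ?a"
    using r_pos by (intro continuous_intros r_cont) force
  have nn: "(\<integral>\<^sup>+s\<in>{x..y}. ennreal (?a s) \<partial>lborel) = ennreal (integral {x..y} ?a)" if "0 < x" "y \<le> \<delta>" for x y
  proof -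
    have ac: "continuous_on {x..y} ?a" using that by (intro continuous_on_subset[OF a_cont]) auto
    have si: "set_integrable lborel {x..y} ?a"
      unfolding set_integrable_def by (rule borel_integrable_atLeastAtMost'[OF ac, unfolded set_integrable_def])
    have "(\<integral>\<^sup>+s\<in>{x..y}. ennreal (?a s) \<partial>lborel) = (\<integral>\<^sup>+s. ennreal (indicator {x..y} s *\<^sub>R ?a s) \<partial>lborel)"
      by (intro nn_integral_cong) (auto simp: indicator_def)
    also have "\<dots> = ennreal (LINT s:{x..y}|lborel. ?a s)"
      unfolding set_lebesgue_integral_def
    proof (rule nn_integral_eq_integral)
      show "integrable lborel (\<lambda>s. indicator {x..y} s *\<^sub>R ?a s)" using si by (simp add: set_integrable_def)
      show "AE s in lborel. 0 \<le> indicator {x..y} s *\<^sub>R ?a s"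
        using r_pos that by (intro AE_I2) (auto simp: indicator_def less_imp_le)
    qed
    also have "(LINT s:{x..y}|lborel. ?a s) = integral {x..y} ?a" by (rule set_borel_integral_eq_integral(2)[OF si])
    finally show ?thesis .
  qed
  \<comment> \<open>The offset 2 keeps \<open>v n\<close> strictly below \<open>c\<close>, where the
    assumed bound is available.\<close>
  define v where "v n = c / real (n + 2)" for n
  have v: "0 < v n" "v n < c" for n
  proof -
    have "c / real (n + 2) \<le> c / 2" using c by (intro divide_left_mono) auto
    moreover have "c / 2 < c" "0 < c / real (n + 2)" using c by auto
    ultimately show "0 < v n" "v n < c" unfolding v_def by linarith+
  qed
  have v0: "v \<longlonglongrightarrow> 0" unfolding v_def[abs_def] by (rule LIMSEQ_ignore_initial_segment) (rule lim_const_over_n)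
  let ?h = "\<lambda>n s. ennreal (?a s) * indicator {v n..c} s"
  have "(\<integral>\<^sup>+s\<in>{0<..c}. ennreal (?a s) \<partial>lborel) = (\<integral>\<^sup>+s. liminf (\<lambda>n. ?h n s) \<partial>lborel)"
  proof (rule nn_integral_cong)
    fix s :: real
    have "\<forall>\<^sub>F n in sequentially. ?h n s = ennreal (?a s) * indicator {0<..c} s"
    proof (cases "0 < s")
      case True
      then have "\<forall>\<^sub>F n in sequentially. v n < s" using order_tendstoD(2)[OF v0] by simp
      then show ?thesis by eventually_elim (use True in \<open>auto simp: indicator_def\<close>)
    next
      case False
      then have "?h n s = ennreal (?a s) * indicator {0<..c} s" for n using v(1)[of n] by (auto simp: indicator_def)
      then show ?thesis by simp
    qed
    then have "(\<lambda>n. ?h n s) \<longlonglongrightarrow> ennreal (?a s) * indicator {0<..c} s" by (rule tendsto_eventually)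
    then show "ennreal (?a s) * indicator {0<..c} s = liminf (\<lambda>n. ?h n s)"
      by (rule lim_imp_Liminf[rotated, symmetric]) simp
  qed
  also have "\<dots> \<le> liminf (\<lambda>n. \<integral>\<^sup>+s. ?h n s \<partial>lborel)"
  proof (rule nn_integral_liminf)
    fix n
    have "(\<lambda>s. indicator {v n..c} s *\<^sub>R ?a s) \<in> borel_measurable borel"
      using v[of n] c by (intro borel_measurable_continuous_on_indicator continuous_on_subset[OF a_cont]) auto
    then have "(\<lambda>s. ennreal (indicator {v n..c} s *\<^sub>R ?a s)) \<in> borel_measurable lborel" by simp
    also have "(\<lambda>s. ennreal (indicator {v n..c} s *\<^sub>R ?a s)) = ?h n" by (auto simp: fun_eq_iff indicator_def)
    finally show "?h n \<in> borel_measurable lborel" .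
  qed
  also have "\<dots> \<le> ennreal L"
  proof (rule Liminf_le)
    show "\<forall>\<^sub>F n in sequentially. (\<integral>\<^sup>+s. ?h n s \<partial>lborel) \<le> ennreal L"
      unfolding nn[OF v(1) c(2)] by (intro always_eventually allI ennreal_leI less_imp_le less[OF v])
  qed simp
  finally have 1: "(\<integral>\<^sup>+s\<in>{0<..c}. ennreal (?a s) \<partial>lborel) < \<infinity>" by (simp add: le_less_trans)
  have "(\<integral>\<^sup>+s\<in>{0<..\<delta>}. ennreal (?a s) \<partial>lborel) \<le> (\<integral>\<^sup>+s. ennreal (?a s) * indicator {0<..c} s + ennreal (?a s) * indicator {c..\<delta>} s \<partial>lborel)"
    by (intro nn_integral_mono) (auto simp: indicator_def)
  also have "\<dots> = (\<integral>\<^sup>+s\<in>{0<..c}. ennreal (?a s) \<partial>lborel) + (\<integral>\<^sup>+s\<in>{c..\<delta>}. ennreal (?a s) \<partial>lborel)"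
  proof (rule nn_integral_add)
    have m: "(\<lambda>s. ennreal (?a s) * indicator A s) \<in> borel_measurable lborel" if "A \<subseteq> {0<..\<delta>}" "A \<in> sets borel" for A
    proof -
      have "(\<lambda>s. indicator A s *\<^sub>R ?a s) \<in> borel_measurable borel"
        using that by (intro borel_measurable_continuous_on_indicator continuous_on_subset[OF a_cont]) auto
      then have "(\<lambda>s. ennreal (indicator A s *\<^sub>R ?a s)) \<in> borel_measurable lborel" by simp
      also have "(\<lambda>s. ennreal (indicator A s *\<^sub>R ?a s)) = (\<lambda>s. ennreal (?a s) * indicator A s)" by (auto simp: fun_eq_iff indicator_def)
      finally show ?thesis .
    qed
    show "(\<lambda>s. ennreal (?a s) * indicator {0<..c} s) \<in> borel_measurable lborel" using c by (intro m) auto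
    show "(\<lambda>s. ennreal (?a s) * indicator {c..\<delta>} s) \<in> borel_measurable lborel" using c by (intro m) auto
  qed
  also have "\<dots> < \<infinity>" using 1 nn[OF c(1) order_refl] by simp
  finally show False using r_int by simp
qed

text \<open>The order of the quantifiers matters: \<open>c\<close> is chosen before
  \<open>u\<^sub>0\<close>, and \<open>B\<close> before \<open>L\<close>. So the value at 0 can grow
  while the value at the start and the drift bounds stay put.\<close>

lemma test_functions:
  obtains c where "0 < c" "c \<le> \<delta>\<^sup>2"
    "\<forall>u\<^sub>0>0. \<exists>B. \<forall>L. \<exists>g g1 g2. test_function r c g g1 g2 \<and> L \<le> g 0 \<and> g u\<^sub>0 \<le> B"
proof -
  have "\<forall>\<^sub>F s in at_right 0. norm (s * r' s / r s) < 1"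
    using tendstoD[OF r_slow, of 1] by simp
  then obtain b where b: "0 < b" "\<And>s. 0 < s \<Longrightarrow> s < b \<Longrightarrow> \<bar>s * r' s / r s\<bar> < 1"
    unfolding eventually_at_right_field by (auto simp: real_norm_def)
  \<comment> \<open>The factor 4 leaves room for shifted arguments
    \<open>u + \<epsilon> \<le> 2 * c\<close>, at which \<open>r\<close> is given and slow variation
    holds. The bound by \<open>\<delta>\<^sup>2\<close> ensures distance at most
    \<open>\<delta>\<close> whenever the squared distance is below \<open>c\<close>.\<close>
  define c where "c = min (b / 4) (\<delta>\<^sup>2 / 4)"
  have c: "0 < c" "2 * c < b" "2 * c < \<delta>\<^sup>2" using b \<delta> by (auto simp: c_def min_def)
  have \<delta>2: "\<delta>\<^sup>2 \<le> \<delta>" using \<delta> by (simp add: power2_eq_square mult_left_le_one_le)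
  have c\<delta>: "2 * c < \<delta>" "c \<le> 1" using c \<delta>2 \<delta> by auto
  have slow: "\<bar>s * r' s / r s\<bar> \<le> 1" if "0 < s" "s \<le> 2 * c" for s using b(2)[of s] that c by auto
  define a where "a s = 1 / (s * r s)" for s
  \<comment> \<open>The derivative of \<open>a\<close>, written so that slow variation confines
    \<open>1 + s * r' s / r s\<close> to \<open>[0, 2]\<close>. This yields both that
    \<open>a\<close> decreases and that \<open>- a' s \<le> 2 * a s / s\<close>.\<close>
  define a' where "a' s = - (1 + s * r' s / r s) * a s / s" for s
  have rp: "0 < r s" if "0 < s" "s \<le> 2 * c" for s using r_pos that c\<delta> by auto
  have ap: "0 < a s" if "0 < s" "s \<le> 2 * c" for s using rp that by (simp add: a_def)
  have rD: "(r has_real_derivative r' s) (at s)" if "0 < s" "s \<le> 2 * c" for s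
  proof -
    have "s \<in> interior {0<..\<delta>}"
      using that c\<delta> by (intro interiorI[of "{0<..<\<delta>}"]) auto
    moreover have "(r has_real_derivative r' s) (at s within {0<..\<delta>})"
      using that c\<delta> by (intro r_deriv) simp
    ultimately show ?thesis by (simp only: at_within_interior)
  qed
  have aD: "(a has_real_derivative a' s) (at s)" if "0 < s" "s \<le> 2 * c" for s
  proof -
    have D: "((\<lambda>s. s * r s) has_real_derivative r s + s * r' s) (at s)"
      using DERIV_mult[OF DERIV_ident rD[OF that]] by (simp add: add.commute mult.commute)
    have nz: "s * r s \<noteq> 0" using that rp[OF that] by simp
    have "- ((r s + s * r' s) / (s * r s)\<^sup>2) = a' s"
      using that rp[OF that] by (simp add: a'_def a_def divide_simps) (simp add: power2_eq_square algebra_simps)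
    then show ?thesis
      using DERIV_inverse_fun[OF D nz] unfolding a_def[abs_def]
      by (simp add: inverse_eq_divide power2_eq_square)
  qed
  have a'_le: "a' s \<le> 0" "- a' s \<le> 2 * a s / s" if "0 < s" "s \<le> 2 * c" for s
  proof -
    define k where "k = 1 + s * r' s / r s"
    have k: "0 \<le> k" "k \<le> 2" using slow[OF that] unfolding k_def by linarith+
    have eq: "a' s = - (k * a s / s)" unfolding a'_def k_def by (simp only: mult_minus_left minus_divide_left)
    show "a' s \<le> 0" using k(1) ap[OF that] that unfolding eq by simp
    have "k * a s / s \<le> 2 * a s / s" using k ap[OF that] that by (intro divide_right_mono mult_right_mono) auto
    then show "- a' s \<le> 2 * a s / s" unfolding eq by simp
  qed
  have a_anti: "a t \<le> a s" if "0 < s" "s \<le> t" "t \<le> 2 * c" for s t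
  proof (rule DERIV_nonpos_imp_nonincreasing[OF that(2)])
    fix x assume "s \<le> x" "x \<le> t"
    then have "0 < x" "x \<le> 2 * c" using that by auto
    then show "\<exists>y. (a has_real_derivative y) (at x) \<and> y \<le> 0" using aD a'_le(1) by blast
  qed
  have a_cont: "continuous_on {0<..2 * c} a"
    using aD by (intro DERIV_continuous_on) (auto intro: has_field_derivative_at_within)
  have a'_cont: "continuous_on {0<..2 * c} a'"
    unfolding a'_def[abs_def] using c\<delta> rp
    by (intro continuous_intros a_cont continuous_on_subset[OF r_cont] continuous_on_subset[OF r'_cont]) force+
  show ?thesis
  proof (rule that[of c], goal_cases)
    case 1 show ?case using c by simp
  next
    case 2 show ?case using c by simp
  next
    case 3
    show ?case
    proof (intro allI impI)
      fix u\<^sub>0 :: real assume u0: "0 < u\<^sub>0"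
      show "\<exists>B. \<forall>L. \<exists>g g1 g2. test_function r c g g1 g2 \<and> L \<le> g 0 \<and> g u\<^sub>0 \<le> B"
      \<comment> \<open>By the mean value theorem \<open>g u\<^sub>0\<close> is at most
        \<open>c\<close> times a value of \<open>p\<close> to the right of \<open>u\<^sub>0\<close>,
        where \<open>p\<close> is at most \<open>a u\<^sub>0\<close>. The minimum covers starts
        beyond \<open>c\<close>, at which \<open>g\<close> vanishes.\<close>
      proof (intro exI[of _ "c * a (min u\<^sub>0 c)"] allI)
        fix L :: real
        \<comment> \<open>On \<open>[0, c / 2]\<close> the cutoff is at least
          \<open>c\<^sup>2 / 4\<close>; the factor \<open>4 / c\<^sup>2\<close> compensates for it
          in advance.\<close>
        obtain \<epsilon> where \<epsilon>: "0 < \<epsilon>" "\<epsilon> < c / 2" "4 * \<bar>L\<bar> / c\<^sup>2 \<le> integral {\<epsilon>..c / 2} a"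
          using scale_integral_unbounded[of "c / 2" "4 * \<bar>L\<bar> / c\<^sup>2"] c c\<delta> unfolding a_def[abs_def] by auto
        \<comment> \<open>\<open>g' = - p\<close>. The shift by \<open>\<epsilon>\<close> makes \<open>g 0\<close> finite, and \<open>(c - u)\<^sub>+\<^sup>2\<close> is a \<open>C\<^sup>1\<close> cutoff. As \<open>a\<close>
          decreases near \<open>0\<close>, \<open>a (u + \<epsilon>) \<le> a u\<close>, so the drift bounds do not depend on \<open>\<epsilon>\<close>.\<close>
        define p where "p u = (if u \<le> c then a (u + \<epsilon>) * (max 0 (c - u))\<^sup>2 else 0)" for u
        define p' where "p' u = (if u \<le> c then a' (u + \<epsilon>) * (max 0 (c - u))\<^sup>2 - a (u + \<epsilon>) * (2 * max 0 (c - u)) else 0)" for u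
        have pD: "(p has_real_derivative p' u) (at u)" if u: "- \<epsilon> < u" for u
        proof (cases "u \<le> c")
          case True
          have "((\<lambda>u. a (u + \<epsilon>) * (max 0 (c - u))\<^sup>2) has_real_derivative a' (u + \<epsilon>) * (max 0 (c - u))\<^sup>2 + (2 * max 0 (c - u) * (-1)) * a (u + \<epsilon>)) (at u)"
          proof (rule DERIV_mult)
            show "((\<lambda>u. a (u + \<epsilon>)) has_real_derivative a' (u + \<epsilon>)) (at u)"
              by (subst DERIV_shift[symmetric], rule aD) (use u True \<epsilon> c in auto)
            show "((\<lambda>u. (max 0 (c - u))\<^sup>2) has_real_derivative 2 * max 0 (c - u) * (-1)) (at u)"
              by (rule DERIV_chain2[OF DERIV_power2_pos_part]) (auto intro!: derivative_eq_intros)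
          qed
          moreover have "a' (u + \<epsilon>) * (max 0 (c - u))\<^sup>2 + (2 * max 0 (c - u) * (-1)) * a (u + \<epsilon>) = p' u"
            using True by (simp add: p'_def algebra_simps)
          ultimately have "((\<lambda>u. a (u + \<epsilon>) * (max 0 (c - u))\<^sup>2) has_real_derivative p' u) (at u)"
            by (simp only:)
          then show ?thesis
            by (rule has_field_derivative_transform_within_open[where S=UNIV]) (auto simp: p_def)
        next
          case False
          have "((\<lambda>u. 0) has_real_derivative p' u) (at u)" using False by (simp add: p'_def)
          then show ?thesis
            by (rule has_field_derivative_transform_within_open[where S="{c<..}"]) (use False in \<open>auto simp: p_def\<close>)
        qed
        have p_cont: "continuous_on {- (\<epsilon> / 2)..} p"
        proof (rule DERIV_continuous_on)
          fix u assume "u \<in> {- (\<epsilon> / 2)..}"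
          then show "(p has_real_derivative p' u) (at u within {- (\<epsilon> / 2)..})"
            using \<epsilon>(1) by (intro has_field_derivative_at_within[OF pD]) auto
        qed
        have p'_cont: "continuous_on {0..} p'"
        proof -
          have "continuous_on ({0..c} \<union> {c..}) p'"
          proof (rule continuous_on_closed_Un)
            have "continuous_on {0..c} (\<lambda>u. a' (u + \<epsilon>) * (max 0 (c - u))\<^sup>2 - a (u + \<epsilon>) * (2 * max 0 (c - u)))"
              using \<epsilon> c by (intro continuous_intros continuous_on_compose2[OF a'_cont] continuous_on_compose2[OF a_cont]) auto
            then show "continuous_on {0..c} p'" by (rule continuous_on_eq) (simp add: p'_def)
            have "continuous_on {c..} (\<lambda>u. 0 :: real)" by simp
            then show "continuous_on {c..} p'" by (rule continuous_on_eq) (auto simp: p'_def)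
          qed auto
          moreover have "{0..c} \<union> {c..} = {0..}" using c by auto
          ultimately show ?thesis by simp
        qed
        have p_nonneg: "0 \<le> p u" if "0 \<le> u" for u using ap[of "u + \<epsilon>"] that \<epsilon> c by (auto simp: p_def)
        \<comment> \<open>Integrating from \<open>- (\<epsilon> / 2)\<close> makes 0 an interior
          point, so that \<open>P\<close> has a two-sided derivative there; the shifted argument of
          \<open>a\<close> is still at least \<open>\<epsilon> / 2\<close>.\<close>
        define P where "P u = integral {- (\<epsilon> / 2)..u} p" for u
        have PD: "(P has_real_derivative p u) (at u)" if "0 \<le> u" for u
          unfolding P_def using that \<epsilon>(1) by (intro antiderivative_from[OF p_cont]) auto
        define g where "g u = P c - P u" for u
        have gD: "(g has_real_derivative - p u) (at u)" if "0 \<le> u" for u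
          unfolding g_def using PD[OF that] by (auto intro!: derivative_eq_intros)
        have g_anti: "g t \<le> g s" if "0 \<le> s" "s \<le> t" for s t
        proof (rule DERIV_nonpos_imp_nonincreasing[OF that(2)])
          fix x assume "s \<le> x"
          then have "0 \<le> x" using that by simp
          then show "\<exists>y. (g has_real_derivative y) (at x) \<and> y \<le> 0"
            using gD[of x] p_nonneg[of x] by (intro exI[of _ "- p x"]) simp
        qed
        have gc: "g c = 0" by (simp add: g_def)
        have g_nonneg: "0 \<le> g u" if "0 \<le> u" for u
        proof (cases "u \<le> c")
          case True then show ?thesis using g_anti[of u c] that gc by simp
        next
          case False
          then obtain z where "c < z" "g u - g c = (u - c) * - p z"
          proof -
            have "\<exists>z>c. z < u \<and> g u - g c = (u - c) * - p z"
              using False c by (intro MVT2 gD) auto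
            then show ?thesis using that by blast
          qed
          then show ?thesis using gc by (auto simp: p_def)
        qed
        have g0: "L \<le> g 0"
        proof -
          have a_cont': "continuous_on {\<epsilon> / 2..c * 3 / 2} a" using \<epsilon> c by (intro continuous_on_subset[OF a_cont]) auto
          define A where "A u = integral {\<epsilon> / 2..u} a" for u
          have AD: "(A has_real_derivative a u) (at u)" if "\<epsilon> / 2 < u" "u < c * 3 / 2" for u
          proof -
            have "(A has_vector_derivative a u) (at u within {\<epsilon> / 2..c * 3 / 2})"
              unfolding A_def using that by (intro integral_has_vector_derivative a_cont') auto
            then show ?thesis
              using that by (subst (asm) at_within_interior) (auto simp: has_real_derivative_iff_has_vector_derivative)
          qed
          \<comment> \<open>\<open>D\<close> is nondecreasing on \<open>[0, c / 2]\<close> because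
            \<open>p u \<ge> c\<^sup>2 / 4 * a (u + \<epsilon>)\<close> there: two integrals are
            compared through their derivatives.\<close>
          define D where "D u = P u - c\<^sup>2 / 4 * A (u + \<epsilon>)" for u
          have "D 0 \<le> D (c / 2)"
          proof (rule DERIV_nonneg_imp_nondecreasing[where f = D and a = 0 and b = "c / 2"])
            fix u assume u: "0 \<le> u" "u \<le> c / 2"
            have "((\<lambda>u. A (u + \<epsilon>)) has_real_derivative a (u + \<epsilon>)) (at u)"
              by (subst DERIV_shift[symmetric], rule AD) (use u \<epsilon> c in auto)
            then have 1: "(D has_real_derivative p u - c\<^sup>2 / 4 * a (u + \<epsilon>)) (at u)"
              unfolding D_def using PD[OF u(1)] by (auto intro!: derivative_eq_intros)
            have "(c / 2)\<^sup>2 \<le> (max 0 (c - u))\<^sup>2" using u c by (intro power_mono) auto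
            then have "a (u + \<epsilon>) * (c\<^sup>2 / 4) \<le> a (u + \<epsilon>) * (max 0 (c - u))\<^sup>2"
              using ap[of "u + \<epsilon>"] u \<epsilon> c by (intro mult_left_mono) (auto simp: power_divide)
            then have "0 \<le> p u - c\<^sup>2 / 4 * a (u + \<epsilon>)" using u c by (simp add: p_def mult.commute)
            then show "\<exists>y. (D has_real_derivative y) (at u) \<and> 0 \<le> y" using 1 by blast
          qed (use c in simp)
          then have "c\<^sup>2 / 4 * (A (c / 2 + \<epsilon>) - A \<epsilon>) \<le> P (c / 2) - P 0" by (simp add: D_def algebra_simps)
          also have "\<dots> \<le> g 0" using g_nonneg[of "c / 2"] c by (simp add: g_def)
          finally have 2: "c\<^sup>2 / 4 * (A (c / 2 + \<epsilon>) - A \<epsilon>) \<le> g 0" .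
          have "A (c / 2) \<le> A (c / 2 + \<epsilon>)"
          proof (rule DERIV_nonneg_imp_nondecreasing[where f = A and a = "c / 2" and b = "c / 2 + \<epsilon>"])
            fix x assume "c / 2 \<le> x" "x \<le> c / 2 + \<epsilon>"
            then have "\<epsilon> / 2 < x" "x < c * 3 / 2" "0 < x" "x \<le> 2 * c" using \<epsilon> c by auto
            then show "\<exists>y. (A has_real_derivative y) (at x) \<and> 0 \<le> y" using AD[of x] ap[of x] by (intro exI[of _ "a x"]) simp
          qed (use \<epsilon> in simp)
          moreover have "A (c / 2) - A \<epsilon> = integral {\<epsilon>..c / 2} a"
          proof -
            have "integral {\<epsilon> / 2..\<epsilon>} a + integral {\<epsilon>..c / 2} a = integral {\<epsilon> / 2..c / 2} a"
              using \<epsilon> c by (intro Henstock_Kurzweil_Integration.integral_combine integrable_continuous_real continuous_on_subset[OF a_cont']) auto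
            then show ?thesis by (simp add: A_def)
          qed
          ultimately have "4 * \<bar>L\<bar> / c\<^sup>2 \<le> A (c / 2 + \<epsilon>) - A \<epsilon>" using \<epsilon>(3) by linarith
          then have "c\<^sup>2 / 4 * (4 * \<bar>L\<bar> / c\<^sup>2) \<le> c\<^sup>2 / 4 * (A (c / 2 + \<epsilon>) - A \<epsilon>)" by (intro mult_left_mono) auto
          then show ?thesis using 2 c by simp
        qed
        have gB: "g u\<^sub>0 \<le> c * a (min u\<^sub>0 c)"
        proof (cases "u\<^sub>0 < c")
          case True
          then obtain z where z: "u\<^sub>0 < z" "z < c" "g c - g u\<^sub>0 = (c - u\<^sub>0) * - p z"
          proof -
            have "\<exists>z>u\<^sub>0. z < c \<and> g c - g u\<^sub>0 = (c - u\<^sub>0) * - p z"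
              using True u0 by (intro MVT2 gD) auto
            then show ?thesis using that by blast
          qed
          have "p z \<le> a (z + \<epsilon>) * 1"
            unfolding p_def using z u0 c\<delta> c \<epsilon> ap[of "z + \<epsilon>"] by (auto intro!: mult_left_mono power_le_one)
          also have "\<dots> \<le> a u\<^sub>0" using a_anti[of u\<^sub>0 "z + \<epsilon>"] z u0 \<epsilon> c by simp
          finally have "(c - u\<^sub>0) * p z \<le> c * a u\<^sub>0"
            using True u0 p_nonneg[of z] z c by (intro mult_mono) auto
          then show ?thesis using z gc True by (simp add: min_def)
        next
          case False
          then have "g u\<^sub>0 \<le> g c" using c by (intro g_anti) auto
          also have "\<dots> \<le> c * a (min u\<^sub>0 c)" using gc ap[of c] c False by (simp add: min_def)
          finally show ?thesis .
        qed
        \<comment> \<open>Both bounds rest on \<open>a (u + \<epsilon>) \<le> a u\<close>. The 4 is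
          2 from the derivative of \<open>a\<close> plus 2 from that of the cutoff, the latter
          because \<open>u \<le> 1\<close>.\<close>
        have drift: "p u * (u * r u) \<le> 1 \<and> - p' u * (u\<^sup>2 * r u) \<le> 4" if u: "0 < u" "u < c" for u
        proof -
          have ru: "0 < r u" using rp u c by auto
          have aa: "a (u + \<epsilon>) \<le> a u" using a_anti[of u "u + \<epsilon>"] u \<epsilon> c by simp
          have pa: "0 < a (u + \<epsilon>)" using ap[of "u + \<epsilon>"] u \<epsilon> c by simp
          have m1: "(max 0 (c - u))\<^sup>2 \<le> 1" "max 0 (c - u) \<le> 1" "0 \<le> max 0 (c - u)" using u c\<delta> by (auto intro!: power_le_one)
          have "p u \<le> a (u + \<epsilon>) * 1" unfolding p_def using u m1 pa by (auto intro!: mult_left_mono)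
          then have "p u \<le> a u" using aa by simp
          then have "p u * (u * r u) \<le> a u * (u * r u)" using u ru by (intro mult_right_mono) auto
          also have "\<dots> = 1" using u ru by (simp add: a_def)
          finally have 1: "p u * (u * r u) \<le> 1" .
          have "- a' (u + \<epsilon>) \<le> 2 * a (u + \<epsilon>) / (u + \<epsilon>)" using a'_le(2)[of "u + \<epsilon>"] u \<epsilon> c by simp
          also have "\<dots> \<le> 2 * a u / u" using aa pa u \<epsilon> by (intro frac_le) auto
          finally have "- a' (u + \<epsilon>) \<le> 2 * a u / u" .
          moreover have "0 \<le> - a' (u + \<epsilon>)" using a'_le(1)[of "u + \<epsilon>"] u \<epsilon> c by simp
          ultimately have "- a' (u + \<epsilon>) * (max 0 (c - u))\<^sup>2 \<le> (2 * a u / u) * 1"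
            using m1 by (intro mult_mono) auto
          moreover have "a (u + \<epsilon>) * (2 * max 0 (c - u)) \<le> a u * 2" using aa pa m1 by (intro mult_mono) auto
          moreover have "a u * 2 \<le> 2 * a u / u"
          proof -
            have "0 \<le> a u" using aa pa by simp
            then have "a u * u \<le> a u" using u c\<delta> by (simp add: mult_left_le)
            then show ?thesis using u by (simp add: field_simps)
          qed
          ultimately have "- p' u \<le> 4 * a u / u" using u by (simp add: p'_def)
          then have "- p' u * (u\<^sup>2 * r u) \<le> 4 * a u / u * (u\<^sup>2 * r u)" using u ru by (intro mult_right_mono) auto
          also have "\<dots> = 4" using u ru by (simp add: a_def power2_eq_square)
          finally show ?thesis using 1 by simp
        qed
        show "\<exists>g g1 g2. test_function r c g g1 g2 \<and> L \<le> g 0 \<and> g u\<^sub>0 \<le> c * a (min u\<^sub>0 c)"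
          unfolding test_function_def
        proof (rule exI[of _ g], rule exI[of _ "\<lambda>u. - p u"], rule exI[of _ "\<lambda>u. - p' u"], intro conjI allI impI)
          show "((\<lambda>u. - p u) has_real_derivative - p' u) (at u)" if "0 \<le> u" for u
            using pD[of u] that \<epsilon> by (auto intro!: derivative_eq_intros)
          show "continuous_on {0..} (\<lambda>u. - p' u)" by (intro continuous_intros p'_cont)
          show "- p u = 0" "- p' u = 0" if "c \<le> u" for u using that by (auto simp: p_def p'_def)
        qed (use gD p_nonneg g_nonneg g0 gB drift in auto)
      qed
    qed
  qed
qed

end

text \<open>Because of the margin 1 in the radius, two points at distance at most 1/2 either both
  lie in the larger ball, where compactness applies, or both lie where \<open>h\<close>
  vanishes.\<close>

lemma uniform_continuity_compact_support:
  fixes h :: "'a::euclidean_space \<Rightarrow> 'b::real_normed_vector"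
  assumes h: "continuous_on UNIV h" and 0: "\<And>y. R < norm y \<Longrightarrow> h y = 0" and e: "0 < e"
  obtains \<rho> where "0 < \<rho>" "\<And>y z. norm (y - z) \<le> \<rho> \<Longrightarrow> norm (h y - h z) \<le> e"
proof -
  have "uniformly_continuous_on (cball 0 (R + 1)) h"
    by (intro compact_uniformly_continuous continuous_on_subset[OF h]) auto
  then obtain d where d: "0 < d" "\<And>y z. y \<in> cball 0 (R + 1) \<Longrightarrow> z \<in> cball 0 (R + 1) \<Longrightarrow> dist z y < d \<Longrightarrow> dist (h z) (h y) < e"
    using e unfolding uniformly_continuous_on_def by metis
  show ?thesis
  proof (rule that[of "min (d / 2) (1 / 2)"])
    fix y z :: 'a assume yz: "norm (y - z) \<le> min (d / 2) (1 / 2)"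
    show "norm (h y - h z) \<le> e"
    proof (cases "norm y \<le> R + 1 \<and> norm z \<le> R + 1")
      case True
      then show ?thesis using d(2)[of z y] yz d(1) by (auto simp: dist_norm)
    next
      case False
      have "R < norm y" "R < norm z"
        using False yz norm_triangle_ineq2[of y z] norm_triangle_ineq2[of z y] by (auto simp: norm_minus_commute)
      then show ?thesis using 0 e by simp
    qed
  qed (use d in auto)
qed

lemma bounded_compact_support:
  fixes h :: "'a::euclidean_space \<Rightarrow> 'b::real_normed_vector"
  assumes h: "continuous_on UNIV h" and 0: "\<And>y. R < norm y \<Longrightarrow> h y = 0"
  obtains B where "0 \<le> B" "\<And>y. norm (h y) \<le> B"
proof -
  have "bounded (h ` cball 0 R)"
    by (intro compact_imp_bounded compact_continuous_image continuous_on_subset[OF h]) auto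
  then obtain B where "\<forall>x\<in>cball 0 R. norm (h x) \<le> B" by (auto simp: bounded_iff)
  then have "\<And>y. norm y \<le> R \<Longrightarrow> norm (h y) \<le> B" by simp
  then have "norm (h y) \<le> \<bar>B\<bar>" for y using 0[of y] by (cases "norm y \<le> R") (auto intro: order_trans[OF _ abs_ge_self])
  then show ?thesis by (intro that[of "\<bar>B\<bar>"]) auto
qed

section \<open>Radial functions and their second order expansion\<close>

locale radial =
  fixes g g1 g2 :: "real \<Rightarrow> real" and c :: real
  assumes g1: "\<And>u. 0 \<le> u \<Longrightarrow> (g has_real_derivative g1 u) (at u)"
    and g2: "\<And>u. 0 \<le> u \<Longrightarrow> (g1 has_real_derivative g2 u) (at u)"
    and g2_cont: "continuous_on {0..} g2"
    and g1_supp: "\<And>u. c \<le> u \<Longrightarrow> g1 u = 0" and g2_supp: "\<And>u. c \<le> u \<Longrightarrow> g2 u = 0"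
begin

definition f :: "real ^ 'd \<Rightarrow> real" where "f z = g ((norm z)\<^sup>2)"

definition Df :: "real ^ 'd \<Rightarrow> real ^ 'd" where "Df z = (2 * g1 ((norm z)\<^sup>2)) *\<^sub>R z"

text \<open>The Hessian form of \<open>f\<close> at \<open>z\<close> in direction \<open>w\<close>,
  by the chain rule.\<close>

definition D2f :: "real ^ 'd \<Rightarrow> real ^ 'd \<Rightarrow> real" where
  "D2f z w = 4 * g2 ((norm z)\<^sup>2) * (z \<bullet> w)\<^sup>2 + 2 * g1 ((norm z)\<^sup>2) * (norm w)\<^sup>2"

lemma g_cont: "continuous_on {0..} g"
  using g1 by (intro DERIV_continuous_on) (auto intro: has_field_derivative_at_within)

lemma g1_cont: "continuous_on {0..} g1"
  using g2 by (intro DERIV_continuous_on) (auto intro: has_field_derivative_at_within)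

lemma f_cont: "continuous_on UNIV f"
  unfolding f_def[abs_def] by (rule continuous_on_compose2[OF g_cont]) (auto intro!: continuous_intros)

lemma g1_norm_cont: "continuous_on UNIV (\<lambda>z :: real ^ 'd. g1 ((norm z)\<^sup>2))"
  by (rule continuous_on_compose2[OF g1_cont]) (auto intro!: continuous_intros)

lemma g2_norm_cont: "continuous_on UNIV (\<lambda>z :: real ^ 'd. g2 ((norm z)\<^sup>2))"
  by (rule continuous_on_compose2[OF g2_cont]) (auto intro!: continuous_intros)

lemma Df_cont: "continuous_on UNIV Df"
  unfolding Df_def[abs_def] by (intro continuous_intros g1_norm_cont)

text \<open>Lagrange remainder on the line through \<open>z\<close> in direction \<open>w\<close>,
  along which the squared norm is a polynomial. The line may pass through the origin, which is why
  \<open>radial\<close> asks for two-sided derivatives at 0.\<close>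

lemma Taylor2:
  obtains \<theta> where "0 < \<theta>" "\<theta> < 1" "f (z + w) = f z + Df z \<bullet> w + D2f (z + \<theta> *\<^sub>R w) w / 2"
proof -
  define y where "y t = z + t *\<^sub>R w" for t
  define n where "n t = (norm (y t))\<^sup>2" for t
  have n: "(n has_real_derivative 2 * (y t \<bullet> w)) (at t)" for t
  proof -
    have "n = (\<lambda>t. z \<bullet> z + t * (2 * (z \<bullet> w)) + t\<^sup>2 * (w \<bullet> w))"
      unfolding n_def y_def power2_norm_eq_inner
      by (rule ext) (simp add: power2_norm_eq_inner inner_add_left inner_add_right inner_commute power2_eq_square algebra_simps)
    then show ?thesis
      by (auto intro!: derivative_eq_intros simp: y_def inner_add_left algebra_simps)
  qed
  have n0: "0 \<le> n t" for t by (simp add: n_def)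
  have yw: "((\<lambda>t. y t \<bullet> w) has_real_derivative (norm w)\<^sup>2) (at t)" for t
    by (auto intro!: derivative_eq_intros simp: y_def inner_add_left power2_norm_eq_inner)
  let ?diff = "\<lambda>m. if m = 0 then (\<lambda>t. g (n t)) else if m = (1::nat) then (\<lambda>t. g1 (n t) * (2 * (y t \<bullet> w)))
    else (\<lambda>t. D2f (y t) w)"
  have d1: "((\<lambda>t. g (n t)) has_real_derivative g1 (n t) * (2 * (y t \<bullet> w))) (at t)" for t
    by (rule DERIV_chain2[OF g1[OF n0] n])
  have d2: "((\<lambda>t. g1 (n t) * (2 * (y t \<bullet> w))) has_real_derivative D2f (y t) w) (at t)" for t
    using DERIV_mult[OF DERIV_chain2[OF g2[OF n0[of t]] n[of t]] DERIV_cmult[OF yw[of t], of 2]]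
    by (simp add: D2f_def n_def power2_eq_square algebra_simps)
  have "\<exists>t>0. t < 1 \<and> g (n 1) = (\<Sum>m<2. ?diff m 0 / fact m * 1 ^ m) + ?diff 2 t / fact 2 * 1 ^ 2"
    by (rule Maclaurin[of 1 2 ?diff]) (use d1 d2 in \<open>auto simp: less_2_cases_iff\<close>)
  then obtain \<theta> where "0 < \<theta>" "\<theta> < 1" "g (n 1) = g (n 0) + g1 (n 0) * (2 * (y 0 \<bullet> w)) + D2f (y \<theta>) w / 2"
    by (auto simp: lessThan_Suc numeral_2_eq_2)
  then show ?thesis
    by (intro that[of \<theta>]) (auto simp: f_def Df_def n_def y_def)
qed

text \<open>The \<open>g2\<close> part of the Hessian without its factor 4. The \<open>g1\<close>
  part is a multiple of the identity and is estimated as a scalar.\<close>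

definition hess :: "real ^ 'd \<Rightarrow> real ^ 'd ^ 'd" where
  "hess z = g2 ((norm z)\<^sup>2) *\<^sub>R (\<chi> i j. z $ i * z $ j)"

lemma hess_mult: "(hess z *v w) \<bullet> v = g2 ((norm z)\<^sup>2) * (z \<bullet> w) * (z \<bullet> v)"
proof -
  have "hess z *v w = (g2 ((norm z)\<^sup>2) * (z \<bullet> w)) *\<^sub>R z"
    by (simp add: vec_eq_iff hess_def matrix_vector_mult_def inner_vec_def sum_distrib_left sum_distrib_right mult_ac)
  then show ?thesis by simp
qed

text \<open>The absolute value gives a usable radius for either sign of \<open>c\<close>, which
  \<open>radial\<close> leaves open.\<close>

lemma sqrt_less_norm_imp_le: "sqrt \<bar>c\<bar> < norm z \<Longrightarrow> c \<le> (norm z)\<^sup>2"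
  by (smt (verit) norm_ge_zero real_less_lsqrt real_sqrt_less_iff real_sqrt_pow2 sqrt_le_D)

lemma hess_cont: "continuous_on UNIV (hess :: real ^ 'd \<Rightarrow> _)"
  unfolding hess_def[abs_def] by (intro continuous_intros g2_norm_cont continuous_on_vec_lambda)

lemma D2f_eq: "D2f z w = 4 * ((hess z *v w) \<bullet> w) + 2 * g1 ((norm z)\<^sup>2) * (norm w)\<^sup>2"
  by (simp add: hess_mult D2f_def power2_eq_square)

text \<open>
  In \<open>z + v + e\<close>, \<open>v\<close> will be a Gaussian increment with a fourth moment of order \<open>dt\<^sup>2\<close>, and \<open>e\<close> an error of which
  only the second moment is known.
\<close>

lemma Taylor_bound:
  obtains L where "0 \<le> L"
    "\<And>z v e :: real ^ 'd. f (z + v + e) \<le> f z + Df z \<bullet> (v + e) + D2f z v / 2 + (norm v)\<^sup>2 + L * ((norm v) ^ 4 + (norm e)\<^sup>2)"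
proof -
  have hs: "hess z = 0" "g1 ((norm z)\<^sup>2) = 0" if "sqrt \<bar>c\<bar> < norm z" for z :: "real ^ 'd"
    using g1_supp[OF sqrt_less_norm_imp_le[OF that]] g2_supp[OF sqrt_less_norm_imp_le[OF that]] by (auto simp: hess_def)
  obtain B1 where B1: "0 \<le> B1" "\<And>z :: real ^ 'd. norm (hess z) \<le> B1"
    using bounded_compact_support[OF hess_cont hs(1)] by blast
  obtain B2 where B2: "0 \<le> B2" "\<And>z :: real ^ 'd. norm (g1 ((norm z)\<^sup>2)) \<le> B2"
    using bounded_compact_support[OF g1_norm_cont hs(2)] by blast
  \<comment> \<open>The tolerances 1/16 here and 1/8 below change \<open>D2f\<close> by at most
    \<open>(4/16 + 2/8) * (norm w)\<^sup>2\<close>, that is by half of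
    \<open>(norm w)\<^sup>2\<close>.\<close>
  obtain \<rho>1 where \<rho>1: "0 < \<rho>1" "\<And>y z :: real ^ 'd. norm (y - z) \<le> \<rho>1 \<Longrightarrow> norm (hess y - hess z) \<le> 1 / 16"
    by (rule uniform_continuity_compact_support[where e = "1 / 16", OF hess_cont hs(1)]) auto
  obtain \<rho>2 where \<rho>2: "0 < \<rho>2" "\<And>y z :: real ^ 'd. norm (y - z) \<le> \<rho>2 \<Longrightarrow> norm (g1 ((norm y)\<^sup>2) - g1 ((norm z)\<^sup>2)) \<le> 1 / 8"
    by (rule uniform_continuity_compact_support[where e = "1 / 8", OF g1_norm_cont hs(2)]) auto
  define \<rho> where "\<rho> = min \<rho>1 \<rho>2"
  define K where "K = 4 * B1 + 2 * B2"
  have \<rho>: "0 < \<rho>" using \<rho>1 \<rho>2 by (simp add: \<rho>_def)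
  have K: "0 \<le> K" using B1 B2 by (simp add: K_def)
  have bil: "\<bar>4 * ((hess z *v v) \<bullet> w) + 2 * g1 ((norm z)\<^sup>2) * (v \<bullet> w)\<bar> \<le> K * norm v * norm w" for z v w :: "real ^ 'd"
  proof -
    have "\<bar>(hess z *v v) \<bullet> w\<bar> \<le> norm (hess z *v v) * norm w" by (rule Cauchy_Schwarz_ineq2)
    also have "\<dots> \<le> (B1 * norm v) * norm w"
      using norm_matrix_vector_mult_le[of "hess z" v] B1(2)[of z] mult_right_mono[of "norm (hess z)" B1 "norm v"]
      by (intro mult_right_mono) auto
    finally have 1: "\<bar>(hess z *v v) \<bullet> w\<bar> \<le> B1 * (norm v * norm w)" by simp
    have "\<bar>g1 ((norm z)\<^sup>2)\<bar> * \<bar>v \<bullet> w\<bar> \<le> B2 * (norm v * norm w)"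
      using B2(2)[of z] Cauchy_Schwarz_ineq2[of v w] B2(1) by (intro mult_mono) auto
    then have 2: "\<bar>g1 ((norm z)\<^sup>2) * (v \<bullet> w)\<bar> \<le> B2 * (norm v * norm w)" by (simp add: abs_mult)
    show ?thesis using 1 2 by (simp add: K_def algebra_simps)
  qed
  have D2_bound: "\<bar>D2f z w\<bar> \<le> K * (norm w)\<^sup>2" for z w :: "real ^ 'd"
    using bil[of z w w] by (simp add: D2f_eq power2_norm_eq_inner[symmetric]) (simp add: power2_eq_square mult.assoc)
  have D2_near: "D2f y w - D2f z w \<le> (norm w)\<^sup>2 / 2" if "norm (y - z) \<le> \<rho>" for y z w :: "real ^ 'd"
  proof -
    have "\<bar>((hess y - hess z) *v w) \<bullet> w\<bar> \<le> norm ((hess y - hess z) *v w) * norm w" by (rule Cauchy_Schwarz_ineq2)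
    also have "\<dots> \<le> (1 / 16 * norm w) * norm w"
      using norm_matrix_vector_mult_le[of "hess y - hess z" w] \<rho>1(2)[of y z] that mult_right_mono[of "norm (hess y - hess z)" "1/16" "norm w"]
      by (intro mult_right_mono) (auto simp: \<rho>_def)
    finally have 1: "((hess y - hess z) *v w) \<bullet> w \<le> (norm w)\<^sup>2 / 16" by (simp add: power2_eq_square)
    have "g1 ((norm y)\<^sup>2) - g1 ((norm z)\<^sup>2) \<le> 1 / 8" using \<rho>2(2)[of y z] that unfolding \<rho>_def real_norm_def by linarith
    then have 2: "(g1 ((norm y)\<^sup>2) - g1 ((norm z)\<^sup>2)) * (norm w)\<^sup>2 \<le> 1 / 8 * (norm w)\<^sup>2" by (intro mult_right_mono) auto
    have "D2f y w - D2f z w = 4 * (((hess y - hess z) *v w) \<bullet> w) + 2 * ((g1 ((norm y)\<^sup>2) - g1 ((norm z)\<^sup>2)) * (norm w)\<^sup>2)"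
      by (simp add: D2f_eq matrix_vector_mult_diff_rdistrib inner_diff_left algebra_simps)
    then show ?thesis using 1 2 by simp
  qed
  have D2_add: "D2f z (v + e) \<le> D2f z v + 2 * (K * norm v * norm e) + K * (norm e)\<^sup>2" for z v e :: "real ^ 'd"
  proof -
    have nve: "(norm (v + e))\<^sup>2 = (norm v)\<^sup>2 + 2 * (v \<bullet> e) + (norm e)\<^sup>2"
      by (simp add: power2_norm_eq_inner inner_add_left inner_add_right inner_commute)
    have "D2f z (v + e) = D2f z v + 2 * (4 * ((hess z *v v) \<bullet> e) + 2 * g1 ((norm z)\<^sup>2) * (v \<bullet> e)) + D2f z e"
      unfolding D2f_def hess_mult nve by (simp add: inner_add_right power2_eq_square algebra_simps)
    moreover have "x \<le> y + 2 * k + r" if "x = y + 2 * p + q" "\<bar>p\<bar> \<le> k" "\<bar>q\<bar> \<le> r" for x y p q k r :: real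
      using that by linarith
    ultimately show ?thesis using bil[of z v e] D2_bound[of z e] by blast
  qed
  \<comment> \<open>\<open>K + K\<^sup>2 + 1\<close> pays for increments of length at most
    \<open>\<rho>\<close>; the terms \<open>4 * K\<close> and \<open>8 * K / \<rho>\<^sup>2\<close>
    are added for longer ones.\<close>
  define L where "L = K + K\<^sup>2 + 1 + 4 * K + 8 * K / \<rho>\<^sup>2"
  have L: "0 \<le> L" using K by (simp add: L_def)
  show ?thesis
  proof (rule that[OF L])
    fix z v e :: "real ^ 'd"
    define w where "w = v + e"
    define a where "a = norm v"
    define b where "b = norm e"
    have ab: "0 \<le> a" "0 \<le> b" by (auto simp: a_def b_def)
    have w_le: "norm w \<le> a + b" unfolding w_def a_def b_def by (rule norm_triangle_ineq)
    have w2: "(norm w)\<^sup>2 \<le> 2 * a\<^sup>2 + 2 * b\<^sup>2"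
      using power_mono[OF w_le, of 2] power2_sum_le[of a b] by simp
    obtain \<theta> where \<theta>: "0 < \<theta>" "\<theta> < 1" "f (z + w) = f z + Df z \<bullet> w + D2f (z + \<theta> *\<^sub>R w) w / 2"
      by (rule Taylor2)
    \<comment> \<open>Young's inequality: twice the mixed term costs \<open>a\<^sup>2\<close>.
      Another \<open>a\<^sup>2\<close> comes from \<open>(norm w)\<^sup>2 / 2\<close>; halved, the
      two give the slack \<open>(norm v)\<^sup>2\<close> of the statement.\<close>
    have am: "K * a * b \<le> a\<^sup>2 / 2 + K\<^sup>2 * b\<^sup>2 / 2"
      using sum_squares_bound[of a "K * b"] by (simp add: power_mult_distrib mult_ac)
    have "D2f (z + \<theta> *\<^sub>R w) w \<le> D2f z v + 2 * a\<^sup>2 + 2 * (L * (a ^ 4 + b\<^sup>2))"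
    proof (cases "norm w \<le> \<rho>")
      case True
      have "norm ((z + \<theta> *\<^sub>R w) - z) \<le> norm w" using \<theta> by (simp add: mult_left_le_one_le)
      then have "D2f (z + \<theta> *\<^sub>R w) w \<le> D2f z w + (norm w)\<^sup>2 / 2" using D2_near[of "z + \<theta> *\<^sub>R w" z w] True by linarith
      also have "\<dots> \<le> D2f z v + 2 * (K * a * b) + K * b\<^sup>2 + (a\<^sup>2 + b\<^sup>2)"
        using D2_add[of z v e] w2 unfolding w_def a_def b_def by linarith
      also have "\<dots> \<le> D2f z v + 2 * a\<^sup>2 + (K + K\<^sup>2 + 1) * b\<^sup>2"
        using am by (simp add: algebra_simps)
      also have "\<dots> \<le> D2f z v + 2 * a\<^sup>2 + 2 * (L * (a ^ 4 + b\<^sup>2))"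
      proof -
        have "(K + K\<^sup>2 + 1) * b\<^sup>2 \<le> L * (a ^ 4 + b\<^sup>2)"
          using K L ab \<rho> by (intro mult_mono) (auto simp: L_def)
        moreover have "0 \<le> L * (a ^ 4 + b\<^sup>2)" using L ab by simp
        ultimately show ?thesis by simp
      qed
      finally show ?thesis .
    next
      case False
      have "D2f (z + \<theta> *\<^sub>R w) w \<le> D2f z w + 2 * (K * (norm w)\<^sup>2)"
        using D2_bound[of "z + \<theta> *\<^sub>R w" w] D2_bound[of z w] by linarith
      also have "\<dots> \<le> D2f z v + 2 * (K * a * b) + K * b\<^sup>2 + 2 * (K * (2 * a\<^sup>2 + 2 * b\<^sup>2))"
        using D2_add[of z v e] mult_left_mono[OF w2 K] unfolding w_def a_def b_def by linarith
      also have "\<dots> \<le> D2f z v + a\<^sup>2 + (K + K\<^sup>2 + 4 * K) * b\<^sup>2 + 4 * K * a\<^sup>2"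
        using am by (simp add: algebra_simps)
      \<comment> \<open>For a long increment the larger of \<open>a\<close> and \<open>b\<close> is
        at least \<open>\<rho> / 2\<close>. If it is \<open>a\<close>, then
        \<open>a\<^sup>2 \<le> 4 * a ^ 4 / \<rho>\<^sup>2\<close>; otherwise
        \<open>a\<^sup>2 \<le> b\<^sup>2\<close>. Here the fourth power of \<open>norm v\<close>
        arises.\<close>
      also have "4 * K * a\<^sup>2 \<le> 4 * K * b\<^sup>2 + 16 * K / \<rho>\<^sup>2 * a ^ 4"
      proof (cases "a \<le> b")
        case True
        then have "4 * K * a\<^sup>2 \<le> 4 * K * b\<^sup>2" using K ab by (intro mult_left_mono power_mono) auto
        moreover have "0 \<le> 16 * K / \<rho>\<^sup>2 * a ^ 4" using K ab by simp
        ultimately show ?thesis by simp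
      next
        case F: False
        then have "\<rho> \<le> 2 * a" using False w_le by simp
        then have "\<rho>\<^sup>2 \<le> (2 * a)\<^sup>2" using \<rho> by (intro power_mono) auto
        then have "1 \<le> 4 * a\<^sup>2 / \<rho>\<^sup>2" using \<rho> by (simp add: power_mult_distrib)
        then have "4 * K * a\<^sup>2 * 1 \<le> 4 * K * a\<^sup>2 * (4 * a\<^sup>2 / \<rho>\<^sup>2)" using K by (intro mult_left_mono) auto
        also have "\<dots> = 16 * K / \<rho>\<^sup>2 * a ^ 4" by (simp add: power4_eq_xxxx power2_eq_square)
        finally have "4 * K * a\<^sup>2 \<le> 16 * K / \<rho>\<^sup>2 * a ^ 4" by simp
        moreover have "0 \<le> 4 * K * b\<^sup>2" using K by simp
        ultimately show ?thesis by simp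
      qed
      finally have *: "D2f (z + \<theta> *\<^sub>R w) w \<le> D2f z v + a\<^sup>2 + (K + K\<^sup>2 + 8 * K) * b\<^sup>2 + 16 * K / \<rho>\<^sup>2 * a ^ 4"
        by (simp add: algebra_simps)
      have "(K + K\<^sup>2 + 8 * K) * b\<^sup>2 \<le> 2 * L * b\<^sup>2"
        using K \<rho> by (intro mult_right_mono) (auto simp: L_def)
      moreover have "16 * K / \<rho>\<^sup>2 * a ^ 4 \<le> 2 * L * a ^ 4"
        using K \<rho> ab by (intro mult_right_mono) (auto simp: L_def)
      moreover have "0 \<le> a\<^sup>2" by simp
      ultimately have "D2f (z + \<theta> *\<^sub>R w) w \<le> D2f z v + 2 * a\<^sup>2 + (2 * L * b\<^sup>2 + 2 * L * a ^ 4)" using * by linarith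
      then show ?thesis by (simp add: algebra_simps)
    qed
    then show "f (z + v + e) \<le> f z + Df z \<bullet> (v + e) + D2f z v / 2 + (norm v)\<^sup>2 + L * ((norm v) ^ 4 + (norm e)\<^sup>2)"
      using \<theta>(3) by (simp add: w_def a_def b_def add.assoc)
  qed
qed

lemma Df_bounded:
  obtains B where "0 \<le> B" "\<And>z :: real ^ 'd. norm (Df z) \<le> B"
proof -
  have "Df z = 0" if "sqrt \<bar>c\<bar> < norm z" for z :: "real ^ 'd"
    using g1_supp[OF sqrt_less_norm_imp_le[OF that]] by (simp add: Df_def)
  then show ?thesis using bounded_compact_support[OF Df_cont] that by blast
qed

end

section \<open>Two solutions driven by the same Brownian motion\<close>

text \<open>\<open>drift_bound\<close> controls what Ito's formula would give as the drift of
  \<open>f (X - Y)\<close>: the gradient term plus half the trace of the Hessian against the squared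
  diffusion difference.\<close>

locale coupled =
  SX: stopped_ito M W \<sigma> b X e\<^sub>X H\<^sub>X I\<^sub>X x\<^sub>0 R K + SY: stopped_ito M W \<sigma> b Y e\<^sub>Y H\<^sub>Y I\<^sub>Y y\<^sub>0 R K + radial g g1 g2 c
  for M :: "'w measure" and W :: "real \<Rightarrow> 'w \<Rightarrow> real ^ 'm"
    and \<sigma> :: "real ^ 'd \<Rightarrow> real ^ 'm ^ 'd" and b :: "real ^ 'd \<Rightarrow> real ^ 'd"
    and X e\<^sub>X H\<^sub>X I\<^sub>X x\<^sub>0 Y e\<^sub>Y H\<^sub>Y I\<^sub>Y y\<^sub>0 R K g g1 g2 c +
  fixes \<kappa> :: real
  assumes g_bounds: "\<And>u. 0 \<le> u \<Longrightarrow> 0 \<le> g u" "\<And>u. 0 \<le> u \<Longrightarrow> g u \<le> g 0"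
    and \<kappa>: "0 \<le> \<kappa>"
    and drift_bound: "\<And>x y. norm x \<le> R \<Longrightarrow> norm y \<le> R \<Longrightarrow>
      Df (x - y) \<bullet> (b x - b y) + 2 * g2 ((norm (x - y))\<^sup>2) * (norm ((x - y) v* (\<sigma> x - \<sigma> y)))\<^sup>2
        + g1 ((norm (x - y))\<^sup>2) * (norm (\<sigma> x - \<sigma> y))\<^sup>2 \<le> \<kappa>"
    and start: "AE \<omega> in M. X 0 \<omega> = x\<^sub>0 \<and> Y 0 \<omega> = y\<^sub>0 \<and> 0 < e\<^sub>X \<omega> \<and> 0 < e\<^sub>Y \<omega>"
begin

definition \<eta> :: "real \<Rightarrow> 'w \<Rightarrow> real ^ 'd" where "\<eta> t \<omega> = SX.stopped t \<omega> - SY.stopped t \<omega>"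

lemma \<eta>_measurable: "0 \<le> t \<Longrightarrow> \<eta> t \<in> borel_measurable M"
  unfolding \<eta>_def[abs_def] by (intro borel_measurable_diff SX.stopped_measurable SY.stopped_measurable)

lemma f_bounds: "0 \<le> f (z :: real ^ 'd)" "f z \<le> f (0 :: real ^ 'd)"
  using g_bounds[of "(norm z)\<^sup>2"] by (auto simp: f_def)

lemma f_measurable: "f \<in> borel_measurable borel"
  by (rule borel_measurable_continuous_onI[OF f_cont])

text \<open>
  One step of a discrete Ito formula. The term \<open>4 * K\<^sup>2\<close> pays for \<open>(norm v)\<^sup>2\<close> in \<open>Taylor_bound\<close>. It need not
  be small: what matters is that it does not depend on \<open>g\<close>, so that \<open>g 0\<close> can tend to infinity.
\<close>

lemma step_bound:
  fixes N j :: nat and A :: "'w set" and T B L :: real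
  defines "s \<equiv> grid T N j" and "t \<equiv> grid T N (Suc j)" and "dt \<equiv> T / real N"
  assumes T: "0 < T" and j: "j < N"
    and B: "0 \<le> B" "\<And>z :: real ^ 'd. norm (Df z) \<le> B"
    and L: "0 \<le> L" "\<And>z v e :: real ^ 'd. f (z + v + e) \<le> f z + Df z \<bullet> (v + e) + D2f z v / 2 + (norm v)\<^sup>2 + L * ((norm v) ^ 4 + (norm e)\<^sup>2)"
    and A: "A \<in> sets (SX.F s)" "\<And>\<omega>. \<omega> \<in> A \<Longrightarrow> ereal s < e\<^sub>X \<omega> \<and> ereal s < e\<^sub>Y \<omega>"
    and rX: "integrable M (\<lambda>\<omega>. (norm (SX.ito_residual s t \<omega>))\<^sup>2)" and rY: "integrable M (\<lambda>\<omega>. (norm (SY.ito_residual s t \<omega>))\<^sup>2)"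
  shows "SX.expectation (\<lambda>\<omega>. indicator A \<omega> * (f (\<eta> t \<omega>) - f (\<eta> s \<omega>))) \<le>
    B * (SX.expectation (\<lambda>\<omega>. norm (SX.drift_residual s t \<omega>)) + SX.expectation (\<lambda>\<omega>. norm (SY.drift_residual s t \<omega>)))
    + dt * (\<kappa> + 4 * K\<^sup>2)
    + L * (3 * SX.expectation (\<lambda>\<omega>. (norm (SX.ito_residual s t \<omega>))\<^sup>2) + 3 * SX.expectation (\<lambda>\<omega>. (norm (SY.ito_residual s t \<omega>))\<^sup>2)
      + (48 * K ^ 4 * (real CARD('m))\<^sup>2 + 108 * K\<^sup>2) * dt\<^sup>2)"
proof -
  have T0: "0 \<le> T" using T by simp
  have dt: "t - s = dt" "0 \<le> dt" using T by (auto simp: s_def t_def dt_def grid_Suc)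
  have st: "0 \<le> s" "s \<le> t" "t \<le> T" using T j dt grid_nonneg[of T N j] grid_le[of T "Suc j" N] by (auto simp: s_def t_def)
  have t: "0 \<le> t" using st by simp
  have AM: "A \<in> sets M" using A(1) SX.sets_F_subset[of s] by auto
  have As: "A \<subseteq> space M" using AM by (rule sets.sets_into_space)
  define Z where "Z \<omega> = X s \<omega> - Y s \<omega>" for \<omega>
  define D where "D \<omega> = W t \<omega> - W s \<omega>" for \<omega>
  \<comment> \<open>The coefficients carry the indicator of \<open>A\<close>, which is known at
    \<open>s\<close>: they vanish on paths already stopped and remain admissible in the moment
    formulas.\<close>
  define h where "h \<omega> = indicator A \<omega> *\<^sub>R (SX.diffusion_at s \<omega> - SY.diffusion_at s \<omega>)" for \<omega>
  \<comment> \<open>By transposition \<open>Z \<bullet> (h *v D) = \<zeta> \<bullet> D\<close>,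
    which gives the curvature term the form treated in \<open>increment_quadratic\<close>.\<close>
  define \<zeta> where "\<zeta> \<omega> = Z \<omega> v* h \<omega>" for \<omega>
  define G where "G \<omega> = indicator A \<omega> *\<^sub>R Df (Z \<omega>)" for \<omega>
  define c1 where "c1 \<omega> = G \<omega> \<bullet> (SX.drift_at s \<omega> - SY.drift_at s \<omega>)" for \<omega>
  define c2 where "c2 \<omega> = indicator A \<omega> * (2 * g2 ((norm (Z \<omega>))\<^sup>2))" for \<omega>
  define c3 where "c3 \<omega> = indicator A \<omega> * g1 ((norm (Z \<omega>))\<^sup>2)" for \<omega>
  have supp0: "g1 ((norm z)\<^sup>2) = 0" "g2 ((norm z)\<^sup>2) = 0" if "sqrt \<bar>c\<bar> < norm z" for z :: "real ^ 'd"
    using g1_supp[OF sqrt_less_norm_imp_le[OF that]] g2_supp[OF sqrt_less_norm_imp_le[OF that]] by auto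
  obtain B1 where B1: "\<And>z :: real ^ 'd. norm (g1 ((norm z)\<^sup>2)) \<le> B1"
    using bounded_compact_support[OF g1_norm_cont supp0(1)] by blast
  obtain B2 where B2: "\<And>z :: real ^ 'd. norm (g2 ((norm z)\<^sup>2)) \<le> B2"
    using bounded_compact_support[OF g2_norm_cont supp0(2)] by blast
  note [measurable] = A(1) SX.X_adapted[OF st(1)] SY.X_adapted[OF st(1)] SX.diffusion_at_adapted[OF st(1)] SY.diffusion_at_adapted[OF st(1)]
    SX.drift_at_adapted[OF st(1)] SY.drift_at_adapted[OF st(1)]
  have [measurable]: "Df \<in> borel_measurable borel" "(\<lambda>z :: real ^ 'd. g1 ((norm z)\<^sup>2)) \<in> borel_measurable borel"
      "(\<lambda>z :: real ^ 'd. g2 ((norm z)\<^sup>2)) \<in> borel_measurable borel"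
    by (auto intro!: borel_measurable_continuous_onI Df_cont g1_norm_cont g2_norm_cont)
  have Zm[measurable]: "Z \<in> borel_measurable (SX.F s)" unfolding Z_def[abs_def] by measurable
  have hm[measurable]: "h \<in> borel_measurable (SX.F s)" unfolding h_def[abs_def] by measurable
  have \<zeta>m[measurable]: "\<zeta> \<in> borel_measurable (SX.F s)" unfolding \<zeta>_def[abs_def] by measurable
  have Gm[measurable]: "G \<in> borel_measurable (SX.F s)" unfolding G_def[abs_def] by measurable
  have c1m[measurable]: "c1 \<in> borel_measurable (SX.F s)" unfolding c1_def[abs_def] by measurable
  have c2m[measurable]: "c2 \<in> borel_measurable (SX.F s)"
    unfolding c2_def[abs_def] by (intro borel_measurable_times borel_measurable_indicator A(1) measurable_compose[OF Zm]) auto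
  have c3m[measurable]: "c3 \<in> borel_measurable (SX.F s)"
    unfolding c3_def[abs_def] by (intro borel_measurable_times borel_measurable_indicator A(1) measurable_compose[OF Zm]) auto
  have K: "0 \<le> K" by (rule SX.K_nonneg)
  have hB: "norm (h \<omega>) \<le> 2 * K" if "\<omega> \<in> space M" for \<omega>
    using SX.diffusion_at_bounded[OF that st(1)] SY.diffusion_at_bounded[OF that st(1)] norm_triangle_ineq4[of "SX.diffusion_at s \<omega>" "SY.diffusion_at s \<omega>"] K
    by (auto simp: h_def indicator_def)
  have drB: "norm (SX.drift_at s \<omega> - SY.drift_at s \<omega>) \<le> 2 * K" if "\<omega> \<in> space M" for \<omega>
    using SX.drift_at_bounded[OF that st(1)] SY.drift_at_bounded[OF that st(1)] norm_triangle_ineq4[of "SX.drift_at s \<omega>" "SY.drift_at s \<omega>"] by simp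
  have ZB: "norm (Z \<omega>) \<le> 2 * R" if "\<omega> \<in> A" for \<omega>
  proof -
    have "norm (X s \<omega>) \<le> R" "norm (Y s \<omega>) \<le> R"
      using A(2)[OF that] SX.X_bounded[of \<omega> s] SY.X_bounded[of \<omega> s] st(1) that As by auto
    then show ?thesis using norm_triangle_ineq4[of "X s \<omega>" "Y s \<omega>"] by (simp add: Z_def)
  qed
  have \<zeta>B: "norm (\<zeta> \<omega>) \<le> \<bar>2 * R\<bar> * (2 * K)" if "\<omega> \<in> space M" for \<omega>
  proof (cases "\<omega> \<in> A")
    case True
    have "norm (\<zeta> \<omega>) \<le> norm (Z \<omega>) * norm (h \<omega>)" unfolding \<zeta>_def by (rule norm_vector_matrix_mult_le)
    also have "\<dots> \<le> \<bar>2 * R\<bar> * (2 * K)" using ZB[OF True] hB[OF that] by (intro mult_mono) auto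
    finally show ?thesis .
  next
    case False
    then have "\<zeta> \<omega> = 0" by (simp add: \<zeta>_def h_def)
    then show ?thesis using K by simp
  qed
  have GB: "norm (G \<omega>) \<le> B" for \<omega> using B by (simp add: G_def indicator_def)
  have c1B: "\<bar>c1 \<omega>\<bar> \<le> B * (2 * K)" if "\<omega> \<in> space M" for \<omega>
  proof -
    have "\<bar>c1 \<omega>\<bar> \<le> norm (G \<omega>) * norm (SX.drift_at s \<omega> - SY.drift_at s \<omega>)" unfolding c1_def by (rule Cauchy_Schwarz_ineq2)
    also have "\<dots> \<le> B * (2 * K)" using GB[of \<omega>] drB[OF that] B(1) by (intro mult_mono) auto
    finally show ?thesis .
  qed
  have c2B: "\<bar>c2 \<omega>\<bar> \<le> 2 * \<bar>B2\<bar>" for \<omega> using B2[of "Z \<omega>"] by (auto simp: c2_def indicator_def abs_mult)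
  have c3B: "\<bar>c3 \<omega>\<bar> \<le> \<bar>B1\<bar>" for \<omega> using B1[of "Z \<omega>"] by (auto simp: c3_def indicator_def)
  let ?rX = "\<lambda>\<omega>. (norm (SX.ito_residual s t \<omega>))\<^sup>2" and ?rY = "\<lambda>\<omega>. (norm (SY.ito_residual s t \<omega>))\<^sup>2"
  let ?qX = "\<lambda>\<omega>. norm (SX.drift_residual s t \<omega>)" and ?qY = "\<lambda>\<omega>. norm (SY.drift_residual s t \<omega>)"
  have qB: "?qX \<omega> \<le> 2 * K * dt" "?qY \<omega> \<le> 2 * K * dt" if "\<omega> \<in> space M" for \<omega>
    using SX.drift_residual_tendsto(3)[OF T that, of N j] SY.drift_residual_tendsto(3)[OF T that, of N j]
    by (simp_all add: s_def t_def dt_def)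
  have qi: "integrable M ?qX" "integrable M ?qY"
    using SX.drift_residual_tendsto(2)[OF T, of N j] SY.drift_residual_tendsto(2)[OF T, of N j] by (simp_all add: s_def t_def)
  \<comment> \<open>A majorant whose expectation can be evaluated term by term. Against
    \<open>G\<close> it contains the whole Ito increments instead of their residuals, because only
    the former have a known mean.\<close>
  define rhs where "rhs \<omega> = (G \<omega> \<bullet> (I\<^sub>X t \<omega> - I\<^sub>X s \<omega>) - G \<omega> \<bullet> (I\<^sub>Y t \<omega> - I\<^sub>Y s \<omega>)) + (B * (?qX \<omega> + ?qY \<omega>) + (dt * c1 \<omega> +
    (c2 \<omega> * (\<zeta> \<omega> \<bullet> D \<omega>)\<^sup>2 + (c3 \<omega> * (norm (h \<omega> *v D \<omega>))\<^sup>2 + (1 * (norm (h \<omega> *v D \<omega>))\<^sup>2 +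
    L * (16 * K ^ 4 * (norm (D \<omega>)) ^ 4 + (3 * ?rX \<omega> + (3 * ?rY \<omega> + 108 * K\<^sup>2 * dt\<^sup>2))))))))" for \<omega>
  have hbW4: "has_bochner_integral M (\<lambda>\<omega>. (norm (D \<omega>)) ^ 4) (SX.expectation (\<lambda>\<omega>. (norm (D \<omega>)) ^ 4))"
    using SX.increment_norm4(1)[OF st(1,2)] unfolding D_def by (rule has_bochner_integral_integrable)
  have rhs_int: "has_bochner_integral M rhs ((0 - 0) + (B * (SX.expectation ?qX + SX.expectation ?qY) + (dt * SX.expectation c1 +
    (dt * SX.expectation (\<lambda>\<omega>. c2 \<omega> * (norm (\<zeta> \<omega>))\<^sup>2) + (dt * SX.expectation (\<lambda>\<omega>. c3 \<omega> * (norm (h \<omega>))\<^sup>2) +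
    (dt * SX.expectation (\<lambda>\<omega>. 1 * (norm (h \<omega>))\<^sup>2) +
    L * (16 * K ^ 4 * SX.expectation (\<lambda>\<omega>. (norm (D \<omega>)) ^ 4) + (3 * SX.expectation ?rX + (3 * SX.expectation ?rY + 108 * K\<^sup>2 * dt\<^sup>2)))))))))"
    unfolding rhs_def
  proof (intro has_bochner_integral_add has_bochner_integral_diff has_bochner_integral_mult_right)
    show "has_bochner_integral M (\<lambda>\<omega>. G \<omega> \<bullet> (I\<^sub>X t \<omega> - I\<^sub>X s \<omega>)) 0"
      by (rule SX.ito_increment_mean[OF SX.ito T0 SX.H_bounded st Gm GB])
    show "has_bochner_integral M (\<lambda>\<omega>. G \<omega> \<bullet> (I\<^sub>Y t \<omega> - I\<^sub>Y s \<omega>)) 0"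
      by (rule SX.ito_increment_mean[OF SY.ito T0 SY.H_bounded st Gm GB])
    show "has_bochner_integral M ?qX (SX.expectation ?qX)" "has_bochner_integral M ?qY (SX.expectation ?qY)"
      "has_bochner_integral M ?rX (SX.expectation ?rX)" "has_bochner_integral M ?rY (SX.expectation ?rY)"
      by (intro has_bochner_integral_integrable qi rX rY)+
    show "has_bochner_integral M c1 (SX.expectation c1)"
      by (intro has_bochner_integral_integrable SX.integrable_bounded_F[OF c1m]) (use c1B in auto)
    show "has_bochner_integral M (\<lambda>\<omega>. c2 \<omega> * (\<zeta> \<omega> \<bullet> D \<omega>)\<^sup>2) (dt * SX.expectation (\<lambda>\<omega>. c2 \<omega> * (norm (\<zeta> \<omega>))\<^sup>2))"
      unfolding D_def dt(1)[symmetric] by (rule SX.increment_quadratic[OF st(1,2) \<zeta>m \<zeta>B c2m c2B])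
    show "has_bochner_integral M (\<lambda>\<omega>. c3 \<omega> * (norm (h \<omega> *v D \<omega>))\<^sup>2) (dt * SX.expectation (\<lambda>\<omega>. c3 \<omega> * (norm (h \<omega>))\<^sup>2))"
      unfolding D_def dt(1)[symmetric] by (rule SX.increment_matrix_quadratic[OF st(1,2) hm hB c3m c3B])
    show "has_bochner_integral M (\<lambda>\<omega>. 1 * (norm (h \<omega> *v D \<omega>))\<^sup>2) (dt * SX.expectation (\<lambda>\<omega>. 1 * (norm (h \<omega>))\<^sup>2))"
      unfolding D_def dt(1)[symmetric] by (rule SX.increment_matrix_quadratic[OF st(1,2) hm hB, where B' = 1]) auto
    show "has_bochner_integral M (\<lambda>\<omega>. (norm (D \<omega>)) ^ 4) (SX.expectation (\<lambda>\<omega>. (norm (D \<omega>)) ^ 4))" by (rule hbW4)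
    show "has_bochner_integral M (\<lambda>\<omega>. dt\<^sup>2) (dt\<^sup>2)" by (simp add: has_bochner_integral_iff SX.prob_space)
  qed
  have le: "AE \<omega> in M. indicator A \<omega> * (f (\<eta> t \<omega>) - f (\<eta> s \<omega>)) \<le> rhs \<omega>"
    using SX.stopped_eq SY.stopped_eq AE_space
  proof eventually_elim
    case (elim \<omega>)
    have L3: "0 \<le> L * (16 * K ^ 4 * (norm (D \<omega>)) ^ 4 + (3 * ?rX \<omega> + (3 * ?rY \<omega> + 108 * K\<^sup>2 * dt\<^sup>2)))"
      using L(1) K by (intro mult_nonneg_nonneg add_nonneg_nonneg) auto
    show ?case
    proof (cases "\<omega> \<in> A")
      case False
      have "0 \<le> B * (?qX \<omega> + ?qY \<omega>)" using B(1) by simp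
      then show ?thesis using False L3 by (simp add: rhs_def G_def c1_def c2_def c3_def h_def)
    next
      case True
      have al: "ereal s < e\<^sub>X \<omega>" "ereal s < e\<^sub>Y \<omega>" using A(2)[OF True] by auto
      have \<eta>s: "\<eta> s \<omega> = Z \<omega>" using elim al st(1) by (simp add: \<eta>_def Z_def)
      define v where "v = h \<omega> *v D \<omega>"
      define e where "e = dt *\<^sub>R (SX.drift_at s \<omega> - SY.drift_at s \<omega>) + (SX.ito_residual s t \<omega> - SY.ito_residual s t \<omega>)
        + (SX.drift_residual s t \<omega> - SY.drift_residual s t \<omega>)"
      have \<eta>t: "\<eta> t \<omega> = Z \<omega> + v + e"
      proof -
        have "\<eta> t \<omega> - \<eta> s \<omega> = (SX.stopped t \<omega> - SX.stopped s \<omega>) - (SY.stopped t \<omega> - SY.stopped s \<omega>)" by (simp add: \<eta>_def)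
        also have "\<dots> = v + e"
          unfolding SX.stopped_increment SY.stopped_increment dt(1)
          using True by (simp add: v_def e_def h_def D_def matrix_vector_mult_diff_rdistrib scaleR_diff_right)
        finally show ?thesis using \<eta>s by (simp add: algebra_simps)
      qed
      \<comment> \<open>The Ito residuals recombine with \<open>v\<close>: the gradient term then
        contains only full Ito increments, of mean zero against \<open>G\<close>, and drift
        quantities. The residuals survive only squared, where their second moments suffice.\<close>
      have ve: "v + e = (I\<^sub>X t \<omega> - I\<^sub>X s \<omega>) - (I\<^sub>Y t \<omega> - I\<^sub>Y s \<omega>) + dt *\<^sub>R (SX.drift_at s \<omega> - SY.drift_at s \<omega>) + (SX.drift_residual s t \<omega> - SY.drift_residual s t \<omega>)"
        using True by (simp add: v_def e_def h_def D_def SX.ito_residual_def SY.ito_residual_def matrix_vector_mult_diff_rdistrib)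
      have GZ: "Df (Z \<omega>) = G \<omega>" using True by (simp add: G_def)
      have 1: "Df (Z \<omega>) \<bullet> (v + e) \<le> (G \<omega> \<bullet> (I\<^sub>X t \<omega> - I\<^sub>X s \<omega>) - G \<omega> \<bullet> (I\<^sub>Y t \<omega> - I\<^sub>Y s \<omega>)) + dt * c1 \<omega> + B * (?qX \<omega> + ?qY \<omega>)"
      proof -
        have "G \<omega> \<bullet> (SX.drift_residual s t \<omega> - SY.drift_residual s t \<omega>) \<le> norm (G \<omega>) * norm (SX.drift_residual s t \<omega> - SY.drift_residual s t \<omega>)"
          by (rule norm_cauchy_schwarz)
        also have "\<dots> \<le> B * (?qX \<omega> + ?qY \<omega>)"
          using GB[of \<omega>] B(1) by (intro mult_mono norm_triangle_ineq4) auto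
        finally show ?thesis unfolding GZ ve c1_def by (simp add: inner_add_right inner_diff_right)
      qed
      have 2: "D2f (Z \<omega>) v / 2 = c2 \<omega> * (\<zeta> \<omega> \<bullet> D \<omega>)\<^sup>2 + c3 \<omega> * (norm (h \<omega> *v D \<omega>))\<^sup>2"
      proof -
        have "Z \<omega> \<bullet> v = \<zeta> \<omega> \<bullet> D \<omega>" by (simp add: v_def \<zeta>_def dot_lmul_matrix)
        then show ?thesis using True by (simp add: D2f_def c2_def c3_def v_def)
      qed
      have 3: "(norm v) ^ 4 \<le> 16 * K ^ 4 * (norm (D \<omega>)) ^ 4"
      proof -
        have "norm v \<le> 2 * K * norm (D \<omega>)"
          unfolding v_def using norm_matrix_vector_mult_le[of "h \<omega>" "D \<omega>"] mult_right_mono[OF hB[OF elim(3)], of "norm (D \<omega>)"] by simp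
        then have "(norm v) ^ 4 \<le> (2 * K * norm (D \<omega>)) ^ 4" by (intro power_mono) auto
        then show ?thesis by (simp add: power_mult_distrib)
      qed
      \<comment> \<open>The drift difference and the two drift residuals contribute
        \<open>2 * K * dt\<close> each, together \<open>6 * K * dt\<close>; the square of a sum of
        three terms turns this into \<open>3 * 36 = 108\<close>.\<close>
      have 4: "(norm e)\<^sup>2 \<le> 3 * ?rX \<omega> + (3 * ?rY \<omega> + 108 * K\<^sup>2 * dt\<^sup>2)"
      proof -
        have a: "norm (dt *\<^sub>R (SX.drift_at s \<omega> - SY.drift_at s \<omega>)) \<le> dt * (2 * K)"
          using drB[OF elim(3)] dt(2) by (simp add: mult_left_mono)
        have "norm e \<le> norm (dt *\<^sub>R (SX.drift_at s \<omega> - SY.drift_at s \<omega>)) + (norm (SX.ito_residual s t \<omega>) + norm (SY.ito_residual s t \<omega>)) + (?qX \<omega> + ?qY \<omega>)"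
          unfolding e_def by (intro norm_triangle_le add_mono norm_triangle_ineq4 order_refl)
        also have "\<dots> \<le> norm (SX.ito_residual s t \<omega>) + norm (SY.ito_residual s t \<omega>) + 6 * K * dt"
          using a qB[OF elim(3)] by (simp add: algebra_simps)
        finally have "(norm e)\<^sup>2 \<le> (norm (SX.ito_residual s t \<omega>) + norm (SY.ito_residual s t \<omega>) + 6 * K * dt)\<^sup>2" by (intro power_mono) auto
        also have "\<dots> \<le> 3 * ?rX \<omega> + 3 * ?rY \<omega> + 3 * (6 * K * dt)\<^sup>2"
        proof -
          have "(a + b + c)\<^sup>2 \<le> 3 * a\<^sup>2 + 3 * b\<^sup>2 + 3 * c\<^sup>2" for a b c :: real
            using sum_squares_bound[of a b] sum_squares_bound[of a c] sum_squares_bound[of b c]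
            by (simp add: power2_eq_square algebra_simps)
          then show ?thesis .
        qed
        finally show ?thesis by (simp add: power_mult_distrib)
      qed
      have "f (\<eta> t \<omega>) - f (\<eta> s \<omega>) \<le> Df (Z \<omega>) \<bullet> (v + e) + D2f (Z \<omega>) v / 2 + (norm v)\<^sup>2 + L * ((norm v) ^ 4 + (norm e)\<^sup>2)"
        using L(2)[of "Z \<omega>" v e] unfolding \<eta>s \<eta>t by simp
      also have "L * ((norm v) ^ 4 + (norm e)\<^sup>2) \<le> L * (16 * K ^ 4 * (norm (D \<omega>)) ^ 4 + (3 * ?rX \<omega> + (3 * ?rY \<omega> + 108 * K\<^sup>2 * dt\<^sup>2)))"
        using 3 4 L(1) by (intro mult_left_mono add_mono) auto
      finally show ?thesis using 1 2 True unfolding rhs_def v_def by simp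
    qed
  qed
  have fm: "f \<circ> \<eta> u \<in> borel_measurable M" if "0 \<le> u" for u
    using measurable_comp[OF \<eta>_measurable[OF that] f_measurable] .
  have lhs_int: "integrable M (\<lambda>\<omega>. indicator A \<omega> * (f (\<eta> t \<omega>) - f (\<eta> s \<omega>)))"
  proof (rule SX.integrable_const_bound[of _ "f (0 :: real ^ 'd)"])
    show "AE \<omega> in M. norm (indicator A \<omega> * (f (\<eta> t \<omega>) - f (\<eta> s \<omega>))) \<le> f (0 :: real ^ 'd)"
    proof (rule AE_I2)
      fix \<omega>
      show "norm (indicator A \<omega> * (f (\<eta> t \<omega>) - f (\<eta> s \<omega>))) \<le> f (0 :: real ^ 'd)"
        using f_bounds[of "\<eta> t \<omega>"] f_bounds[of "\<eta> s \<omega>"] by (auto simp: indicator_def)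
    qed
    show "(\<lambda>\<omega>. indicator A \<omega> * (f (\<eta> t \<omega>) - f (\<eta> s \<omega>))) \<in> borel_measurable M"
      using fm[OF t] fm[OF st(1)] AM by (auto simp: comp_def)
  qed
  have "SX.expectation (\<lambda>\<omega>. indicator A \<omega> * (f (\<eta> t \<omega>) - f (\<eta> s \<omega>))) \<le> SX.expectation rhs"
    by (rule integral_mono_AE[OF lhs_int _ le]) (use rhs_int in \<open>simp add: has_bochner_integral_iff\<close>)
  also have "\<dots> = B * (SX.expectation ?qX + SX.expectation ?qY) + dt * (SX.expectation c1 + SX.expectation (\<lambda>\<omega>. c2 \<omega> * (norm (\<zeta> \<omega>))\<^sup>2)
      + SX.expectation (\<lambda>\<omega>. c3 \<omega> * (norm (h \<omega>))\<^sup>2) + SX.expectation (\<lambda>\<omega>. (norm (h \<omega>))\<^sup>2))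
      + L * (16 * K ^ 4 * SX.expectation (\<lambda>\<omega>. (norm (D \<omega>)) ^ 4) + (3 * SX.expectation ?rX + (3 * SX.expectation ?rY + 108 * K\<^sup>2 * dt\<^sup>2)))"
    using has_bochner_integral_integral_eq[OF rhs_int] by (simp add: distrib_left)
  also have "\<dots> \<le> B * (SX.expectation ?qX + SX.expectation ?qY) + dt * (\<kappa> + 4 * K\<^sup>2)
      + L * (16 * K ^ 4 * (3 * (real CARD('m))\<^sup>2 * dt\<^sup>2) + (3 * SX.expectation ?rX + (3 * SX.expectation ?rY + 108 * K\<^sup>2 * dt\<^sup>2)))"
  proof -
    have sq: "\<bar>(norm (h \<omega>))\<^sup>2\<bar> \<le> (2 * K)\<^sup>2" if "\<omega> \<in> space M" for \<omega>
      using power_mono[OF hB[OF that] norm_ge_zero, of 2] by simp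
    have i0: "integrable M (\<lambda>\<omega>. (norm (h \<omega>))\<^sup>2)"
      by (rule SX.integrable_bounded_F[where s = s and B = "(2 * K)\<^sup>2"]) (use sq in auto)
    have "SX.expectation (\<lambda>\<omega>. (norm (h \<omega>))\<^sup>2) \<le> SX.expectation (\<lambda>\<omega>. (2 * K)\<^sup>2)"
      by (rule integral_mono[OF i0]) (use sq in auto)
    then have e0: "SX.expectation (\<lambda>\<omega>. (norm (h \<omega>))\<^sup>2) \<le> 4 * K\<^sup>2" by (simp add: SX.prob_space)
    have i1: "integrable M c1" by (rule SX.integrable_bounded_F[OF c1m]) (use c1B in auto)
    have i2: "integrable M (\<lambda>\<omega>. c2 \<omega> * (norm (\<zeta> \<omega>))\<^sup>2)"
    proof (rule SX.integrable_bounded_F[where s = s and B = "2 * \<bar>B2\<bar> * (\<bar>2 * R\<bar> * (2 * K))\<^sup>2"])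
      fix \<omega> assume w: "\<omega> \<in> space M"
      have "\<bar>c2 \<omega>\<bar> * (norm (\<zeta> \<omega>))\<^sup>2 \<le> 2 * \<bar>B2\<bar> * (\<bar>2 * R\<bar> * (2 * K))\<^sup>2"
        using c2B[of \<omega>] \<zeta>B[OF w] by (intro mult_mono power_mono) auto
      then show "norm (c2 \<omega> * (norm (\<zeta> \<omega>))\<^sup>2) \<le> 2 * \<bar>B2\<bar> * (\<bar>2 * R\<bar> * (2 * K))\<^sup>2" by (simp add: abs_mult)
    qed measurable
    have i3: "integrable M (\<lambda>\<omega>. c3 \<omega> * (norm (h \<omega>))\<^sup>2)"
    proof (rule SX.integrable_bounded_F[where s = s and B = "\<bar>B1\<bar> * (2 * K)\<^sup>2"])
      fix \<omega> assume w: "\<omega> \<in> space M"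
      have "\<bar>c3 \<omega>\<bar> * (norm (h \<omega>))\<^sup>2 \<le> \<bar>B1\<bar> * (2 * K)\<^sup>2"
        using c3B[of \<omega>] hB[OF w] by (intro mult_mono power_mono) auto
      then show "norm (c3 \<omega> * (norm (h \<omega>))\<^sup>2) \<le> \<bar>B1\<bar> * (2 * K)\<^sup>2" by (simp add: abs_mult)
    qed measurable
    have "SX.expectation c1 + SX.expectation (\<lambda>\<omega>. c2 \<omega> * (norm (\<zeta> \<omega>))\<^sup>2) + SX.expectation (\<lambda>\<omega>. c3 \<omega> * (norm (h \<omega>))\<^sup>2)
      = SX.expectation (\<lambda>\<omega>. c1 \<omega> + c2 \<omega> * (norm (\<zeta> \<omega>))\<^sup>2 + c3 \<omega> * (norm (h \<omega>))\<^sup>2)"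
      using i1 i2 i3 by simp
    also have "\<dots> \<le> SX.expectation (\<lambda>\<omega>. \<kappa>)"
    proof (rule integral_mono)
      fix \<omega> assume w: "\<omega> \<in> space M"
      show "c1 \<omega> + c2 \<omega> * (norm (\<zeta> \<omega>))\<^sup>2 + c3 \<omega> * (norm (h \<omega>))\<^sup>2 \<le> \<kappa>"
      proof (cases "\<omega> \<in> A")
        case True
        have al: "ereal s < e\<^sub>X \<omega>" "ereal s < e\<^sub>Y \<omega>" using A(2)[OF True] by auto
        have "norm (X s \<omega>) \<le> R" "norm (Y s \<omega>) \<le> R"
          using al SX.X_bounded[OF w st(1)] SY.X_bounded[OF w st(1)] by auto
        from drift_bound[OF this] show ?thesis using True al
          by (simp add: c1_def G_def c2_def c3_def h_def \<zeta>_def Z_def SX.diffusion_at_def SY.diffusion_at_def SX.drift_at_def SY.drift_at_def)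
      qed (use \<kappa> in \<open>simp add: c1_def G_def c2_def c3_def\<close>)
    qed (use i1 i2 i3 in auto)
    finally have d1: "SX.expectation c1 + SX.expectation (\<lambda>\<omega>. c2 \<omega> * (norm (\<zeta> \<omega>))\<^sup>2)
      + SX.expectation (\<lambda>\<omega>. c3 \<omega> * (norm (h \<omega>))\<^sup>2) + SX.expectation (\<lambda>\<omega>. (norm (h \<omega>))\<^sup>2) \<le> \<kappa> + 4 * K\<^sup>2"
      using e0 by (simp add: SX.prob_space)
    have d2: "SX.expectation (\<lambda>\<omega>. (norm (D \<omega>)) ^ 4) \<le> 3 * (real CARD('m))\<^sup>2 * dt\<^sup>2"
      using SX.increment_norm4(2)[OF st(1,2)] unfolding D_def dt(1) .
    show ?thesis
      by (rule add_mono[OF add_mono[OF order_refl mult_left_mono[OF d1 dt(2)]]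
            mult_left_mono[OF add_mono[OF mult_left_mono[OF d2] order_refl] L(1)]]) (use K in simp)
  qed
  finally show ?thesis by (simp add: algebra_simps)
qed

end

text \<open>Discrete stopping: \<open>P\<close> never recovers after its first failure, so the
  retained increments telescope to the value at that index, or at \<open>N\<close> if it comes
  first.\<close>

lemma telescope_until:
  fixes F :: "nat \<Rightarrow> real" and P :: "nat \<Rightarrow> bool"
  assumes P: "\<And>i j. i \<le> j \<Longrightarrow> P j \<Longrightarrow> P i"
  shows "F 0 + (\<Sum>j<N. of_bool (P j) * (F (Suc j) - F j)) = F (LEAST j. j = N \<or> \<not> P j)"
proof (induction N)
  case 0
  have "(LEAST j. j = 0 \<or> \<not> P j) = 0" by (rule Least_equality) auto
  then show ?case by simp
next
  case (Suc N)
  show ?case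
  proof (cases "\<forall>i\<le>N. P i")
    case True
    have "(LEAST j. j = N \<or> \<not> P j) = N"
      by (rule Least_equality) (use True in \<open>auto simp: not_le intro: ccontr\<close>)
    moreover have "(LEAST j. j = Suc N \<or> \<not> P j) = Suc N"
      by (rule Least_equality) (use True in \<open>auto simp: not_less_eq_eq\<close>)
    ultimately show ?thesis using Suc True by simp
  next
    case False
    then have nN: "\<not> P N" using P by blast
    have "(LEAST j. j = Suc N \<or> \<not> P j) = (LEAST j. j = N \<or> \<not> P j)"
    proof (rule Least_equality)
      let ?J = "LEAST j. j = N \<or> \<not> P j"
      have "?J = N \<or> \<not> P ?J" by (rule LeastI[of _ N]) simp
      then show "?J = Suc N \<or> \<not> P ?J" using nN by auto
      have "?J \<le> N" by (rule Least_le) simp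
      then show "?J \<le> y" if "y = Suc N \<or> \<not> P y" for y
        using that by (auto intro: Least_le)
    qed
    then show ?thesis using Suc nN by simp
  qed
qed

section \<open>A maximal inequality along grids\<close>

context coupled
begin

text \<open>If the paths meet at \<open>s\<close> before leaving the ball, \<open>f\<close> is
  \<open>g 0 > a\<close> there, hence above \<open>a\<close> at the grid points just left of
  \<open>s\<close>. So for all large \<open>N\<close> the process has stopped with a value of at
  least \<open>a\<close>. As its mean is at most a constant plus a vanishing error, Markov's
  inequality and Fatou's lemma give the bound.\<close>

lemma coincidence_bound:
  assumes T: "0 < T" and a: "0 < a" "a < g 0" and xy: "x\<^sub>0 \<noteq> y\<^sub>0"
  obtains E where "E \<in> sets M"
    "AE \<omega> in M. (\<exists>s\<in>{0..T}. ereal s < e\<^sub>X \<omega> \<and> ereal s < e\<^sub>Y \<omega> \<and> X s \<omega> = Y s \<omega>) \<longrightarrow> \<omega> \<in> E"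
    "a * SX.prob E \<le> g ((norm (x\<^sub>0 - y\<^sub>0))\<^sup>2) + T * (\<kappa> + 4 * K\<^sup>2)"
proof -
  have T0: "0 \<le> T" using T by simp
  obtain B where B: "0 \<le> B" "\<And>z :: real ^ 'd. norm (Df z) \<le> B" by (rule Df_bounded) blast
  obtain L where L: "0 \<le> L" "\<And>z v e :: real ^ 'd. f (z + v + e) \<le> f z + Df z \<bullet> (v + e) + D2f z v / 2 + (norm v)\<^sup>2 + L * ((norm v) ^ 4 + (norm e)\<^sup>2)"
    by (rule Taylor_bound) blast
  have g0: "0 \<le> grid T N j" for N j using T by (auto intro: grid_nonneg)
  define ok where "ok N \<omega> i \<longleftrightarrow> ereal (grid T N i) < e\<^sub>X \<omega> \<and> ereal (grid T N i) < e\<^sub>Y \<omega> \<and> f (X (grid T N i) \<omega> - Y (grid T N i) \<omega>) < a" for N \<omega> i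
  define A where "A N j = {\<omega> \<in> space M. \<forall>i\<in>{..j}. ok N \<omega> i}" for N j
  have A_sets: "A N j \<in> sets (SX.F (grid T N j))" for N j
  proof -
    have "{\<omega> \<in> space (SX.F (grid T N j)). ok N \<omega> i} \<in> sets (SX.F (grid T N j))" if i: "i \<in> {..j}" for i
    proof -
      have le: "grid T N i \<le> grid T N j" using i T0 by (intro grid_mono) auto
      have 1: "{\<omega> \<in> space M. ereal (grid T N i) < e\<^sub>X \<omega>} \<in> sets (SX.F (grid T N j))" "{\<omega> \<in> space M. ereal (grid T N i) < e\<^sub>Y \<omega>} \<in> sets (SX.F (grid T N j))"
        using SX.e_adapted[OF g0] SY.e_adapted[OF g0] SX.sets_F_mono[OF le] by blast+
      have [measurable]: "X (grid T N i) \<in> borel_measurable (SX.F (grid T N j))" "Y (grid T N i) \<in> borel_measurable (SX.F (grid T N j))"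
        using le by (auto intro: SX.measurable_F_mono[OF SX.X_adapted[OF g0]] SX.measurable_F_mono[OF SY.X_adapted[OF g0]])
      have [measurable]: "(f :: real ^ 'd \<Rightarrow> real) \<in> borel_measurable borel" by (rule f_measurable)
      have "{\<omega> \<in> space (SX.F (grid T N j)). f (X (grid T N i) \<omega> - Y (grid T N i) \<omega>) < a} \<in> sets (SX.F (grid T N j))" by measurable
      then show ?thesis using 1 unfolding ok_def by (intro sets.sets_Collect_conj) auto
    qed
    then have "{\<omega> \<in> space (SX.F (grid T N j)). \<forall>i\<in>{..j}. ok N \<omega> i} \<in> sets (SX.F (grid T N j))"
      by (rule sets.sets_Collect_finite_All') auto
    then show ?thesis by (simp add: A_def)
  qed
  have A_M: "A N j \<in> sets M" for N j using A_sets SX.sets_F_subset by blast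
  have A_alive: "ereal (grid T N j) < e\<^sub>X \<omega> \<and> ereal (grid T N j) < e\<^sub>Y \<omega>" if "\<omega> \<in> A N j" for N j \<omega>
    using that by (auto simp: A_def ok_def)
  define step where "step N j \<omega> = indicator (A N j) \<omega> * (f (\<eta> (grid T N (Suc j)) \<omega>) - f (\<eta> (grid T N j) \<omega>))" for N j \<omega>
  \<comment> \<open>\<open>f (\<eta> t)\<close> stopped at the first grid time at which \<open>X\<close> or \<open>Y\<close> has left the ball or \<open>f (\<eta> t)\<close> has reached \<open>a\<close>\<close>
  define Yv where "Yv N \<omega> = f (\<eta> 0 \<omega>) + (\<Sum>j<N. step N j \<omega>)" for N \<omega>
  have fm[measurable]: "(\<lambda>\<omega>. f (\<eta> u \<omega>)) \<in> borel_measurable M" if "0 \<le> u" for u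
    by (rule measurable_compose[OF \<eta>_measurable[OF that] f_measurable])
  have fi: "integrable M (\<lambda>\<omega>. f (\<eta> u \<omega>))" if "0 \<le> u" for u
    by (rule SX.integrable_const_bound[of _ "f (0 :: real ^ 'd)"]) (use f_bounds fm[OF that] in auto)
  have step_int: "integrable M (step N j)" for N j
    unfolding step_def[abs_def] real_scaleR_def[symmetric]
    by (intro integrable_mult_indicator A_M Bochner_Integration.integrable_diff fi g0)
  have Yv_int: "integrable M (Yv N)" for N
    unfolding Yv_def[abs_def] by (intro Bochner_Integration.integrable_add fi Bochner_Integration.integrable_sum step_int) simp
  have Yv_eq: "Yv N \<omega> = f (\<eta> (grid T N (LEAST j. j = N \<or> \<not> (\<forall>i\<in>{..j}. ok N \<omega> i))) \<omega>)" if "\<omega> \<in> space M" for N \<omega>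
  proof -
    have "step N j \<omega> = of_bool (\<forall>i\<in>{..j}. ok N \<omega> i) * (f (\<eta> (grid T N (Suc j)) \<omega>) - f (\<eta> (grid T N j) \<omega>))" for j
      using that by (simp add: step_def A_def indicator_def)
    then have "Yv N \<omega> = f (\<eta> (grid T N 0) \<omega>) + (\<Sum>j<N. of_bool (\<forall>i\<in>{..j}. ok N \<omega> i) * (f (\<eta> (grid T N (Suc j)) \<omega>) - f (\<eta> (grid T N j) \<omega>)))"
      by (simp add: Yv_def)
    also have "\<dots> = f (\<eta> (grid T N (LEAST j. j = N \<or> \<not> (\<forall>i\<in>{..j}. ok N \<omega> i))) \<omega>)"
      by (rule telescope_until) auto
    finally show ?thesis .
  qed
  have Yv_nonneg: "0 \<le> Yv N \<omega>" if "\<omega> \<in> space M" for N \<omega>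
    unfolding Yv_eq[OF that] by (rule f_bounds)
  define Q where "Q = g ((norm (x\<^sub>0 - y\<^sub>0))\<^sup>2) + T * (\<kappa> + 4 * K\<^sup>2)"
  have init: "SX.expectation (\<lambda>\<omega>. f (\<eta> 0 \<omega>)) = g ((norm (x\<^sub>0 - y\<^sub>0))\<^sup>2)"
  proof -
    have "AE \<omega> in M. f (\<eta> 0 \<omega>) = g ((norm (x\<^sub>0 - y\<^sub>0))\<^sup>2)"
      using start SX.stopped_eq SY.stopped_eq
      by eventually_elim (auto simp: \<eta>_def f_def zero_ereal_def)
    then have "SX.expectation (\<lambda>\<omega>. f (\<eta> 0 \<omega>)) = SX.expectation (\<lambda>\<omega>. g ((norm (x\<^sub>0 - y\<^sub>0))\<^sup>2))"
      using fm[of 0] by (intro integral_cong_AE) auto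
    then show ?thesis by (simp add: SX.prob_space)
  qed
  define rX where "rX N j = SX.expectation (\<lambda>\<omega>. (norm (SX.ito_residual (grid T N j) (grid T N (Suc j)) \<omega>))\<^sup>2)" for N j
  define rY where "rY N j = SX.expectation (\<lambda>\<omega>. (norm (SY.ito_residual (grid T N j) (grid T N (Suc j)) \<omega>))\<^sup>2)" for N j
  define qX where "qX N j = SX.expectation (\<lambda>\<omega>. norm (SX.drift_residual (grid T N j) (grid T N (Suc j)) \<omega>))" for N j
  define qY where "qY N j = SX.expectation (\<lambda>\<omega>. norm (SY.drift_residual (grid T N j) (grid T N (Suc j)) \<omega>))" for N j
  define C where "C = 48 * K ^ 4 * (real CARD('m))\<^sup>2 + 108 * K\<^sup>2"
  \<comment> \<open>The \<open>dt\<^sup>2\<close> of the \<open>N\<close> cells add up to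
    \<open>T\<^sup>2 / N\<close>. Everything collected here vanishes as the grid is refined; the
    drift part \<open>T * (\<kappa> + 4 * K\<^sup>2)\<close> is kept apart.\<close>
  define err where "err N = B * ((\<Sum>j<N. qX N j) + (\<Sum>j<N. qY N j)) + L * (3 * (\<Sum>j<N. rX N j) + 3 * (\<Sum>j<N. rY N j) + C * (T\<^sup>2 / real N))" for N
  have err: "err \<longlonglongrightarrow> 0"
  proof -
    have "(\<lambda>N. \<Sum>j<N. qX N j) \<longlonglongrightarrow> 0" "(\<lambda>N. \<Sum>j<N. qY N j) \<longlonglongrightarrow> 0" "(\<lambda>N. \<Sum>j<N. rX N j) \<longlonglongrightarrow> 0" "(\<lambda>N. \<Sum>j<N. rY N j) \<longlonglongrightarrow> 0"
      unfolding qX_def qY_def rX_def rY_def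
      by (rule SX.drift_residual_tendsto(1)[OF T] SY.drift_residual_tendsto(1)[OF T] SX.ito_residual_tendsto(2)[OF T] SY.ito_residual_tendsto(2)[OF T])+
    then have "err \<longlonglongrightarrow> B * (0 + 0) + L * (3 * 0 + 3 * 0 + C * 0)"
      unfolding err_def[abs_def] by (intro tendsto_add tendsto_mult tendsto_const lim_const_over_n)
    then show ?thesis by simp
  qed
  have EYv: "\<forall>\<^sub>F N in sequentially. SX.expectation (Yv N) \<le> Q + err N"
    using SX.ito_residual_tendsto(1)[OF T] SY.ito_residual_tendsto(1)[OF T] eventually_gt_at_top[of 0]
  proof eventually_elim
    case (elim N)
    have 1: "SX.expectation (Yv N) = SX.expectation (\<lambda>\<omega>. f (\<eta> 0 \<omega>)) + (\<Sum>j<N. SX.expectation (step N j))"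
      unfolding Yv_def[abs_def] using fi[of 0] step_int by (subst Bochner_Integration.integral_add) auto
    have 2: "(\<Sum>j<N. SX.expectation (step N j)) \<le> (\<Sum>j<N. B * (qX N j + qY N j) + T / real N * (\<kappa> + 4 * K\<^sup>2) + L * (3 * rX N j + 3 * rY N j + C * (T / real N)\<^sup>2))"
    proof (rule sum_mono)
      fix j assume "j \<in> {..<N}"
      then have j: "j < N" by simp
      show "SX.expectation (step N j) \<le> B * (qX N j + qY N j) + T / real N * (\<kappa> + 4 * K\<^sup>2) + L * (3 * rX N j + 3 * rY N j + C * (T / real N)\<^sup>2)"
        unfolding step_def[abs_def] qX_def qY_def rX_def rY_def C_def
        by (rule step_bound[OF T j B L A_sets A_alive]) (use elim j in auto)
    qed
    have 3: "(\<Sum>j<N. B * (qX N j + qY N j) + T / real N * (\<kappa> + 4 * K\<^sup>2) + L * (3 * rX N j + 3 * rY N j + C * (T / real N)\<^sup>2)) = T * (\<kappa> + 4 * K\<^sup>2) + err N"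
    proof -
      have sum_eq: "(\<Sum>j<N. B * (qX N j + qY N j) + p + L * (3 * rX N j + 3 * rY N j + q)) =
        B * ((\<Sum>j<N. qX N j) + (\<Sum>j<N. qY N j)) + real N * p
          + L * (3 * (\<Sum>j<N. rX N j) + 3 * (\<Sum>j<N. rY N j) + real N * q)" for p q
        by (simp add: sum.distrib flip: sum_distrib_left)
      have e1: "real N * (C * (T / real N)\<^sup>2) = C * (T\<^sup>2 / real N)" using elim(3) by (simp add: power2_eq_square)
      have e2: "real N * (T / real N * (\<kappa> + 4 * K\<^sup>2)) = T * (\<kappa> + 4 * K\<^sup>2)" using elim(3) by simp
      show ?thesis unfolding sum_eq err_def e1 e2 by simp
    qed
    show ?case using 2 unfolding 1 3 init Q_def by simp
  qed
  define lm where "lm \<omega> = liminf (\<lambda>N. ennreal (Yv N \<omega>))" for \<omega>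
  have [measurable]: "Yv N \<in> borel_measurable M" for N using Yv_int by auto
  have lm[measurable]: "lm \<in> borel_measurable M" unfolding lm_def[abs_def] by measurable
  \<comment> \<open>A measurable event that contains the meetings up to a null set, so measurability
    of the meeting event itself is not at issue.\<close>
  define E where "E = {\<omega> \<in> space M. ennreal a \<le> lm \<omega>}"
  have E: "E \<in> sets M" unfolding E_def by measurable
  have Q0: "0 \<le> Q" using g_bounds(1)[of "(norm (x\<^sub>0 - y\<^sub>0))\<^sup>2"] T0 \<kappa> by (simp add: Q_def)
  have "ennreal a * emeasure M E = (\<integral>\<^sup>+\<omega>. ennreal a * indicator E \<omega> \<partial>M)" using E by (simp add: nn_integral_cmult_indicator)
  also have "\<dots> \<le> (\<integral>\<^sup>+\<omega>. lm \<omega> \<partial>M)" by (intro nn_integral_mono) (auto simp: E_def indicator_def)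
  also have "\<dots> \<le> liminf (\<lambda>N. \<integral>\<^sup>+\<omega>. ennreal (Yv N \<omega>) \<partial>M)" unfolding lm_def by (rule nn_integral_liminf) measurable
  also have "\<dots> \<le> ennreal Q"
  proof (rule ennreal_le_epsilon)
    fix \<epsilon> :: real assume \<epsilon>: "0 < \<epsilon>"
    have "\<forall>\<^sub>F N in sequentially. (\<integral>\<^sup>+\<omega>. ennreal (Yv N \<omega>) \<partial>M) \<le> ennreal (Q + \<epsilon>)"
      using EYv order_tendstoD(2)[OF err \<epsilon>]
    proof eventually_elim
      case (elim N)
      have "(\<integral>\<^sup>+\<omega>. ennreal (Yv N \<omega>) \<partial>M) = ennreal (SX.expectation (Yv N))"
        using Yv_nonneg by (intro nn_integral_eq_integral Yv_int AE_I2) auto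
      also have "\<dots> \<le> ennreal (Q + \<epsilon>)" using elim by (intro ennreal_leI) simp
      finally show ?case .
    qed
    then show "liminf (\<lambda>N. \<integral>\<^sup>+\<omega>. ennreal (Yv N \<omega>) \<partial>M) \<le> ennreal Q + ennreal \<epsilon>"
      using Q0 \<epsilon> by (subst ennreal_plus[symmetric]) (auto intro!: Liminf_le)
  qed
  finally have "ennreal (a * SX.prob E) \<le> ennreal Q"
    using a by (simp add: SX.emeasure_eq_measure ennreal_mult)
  then have EQ: "a * SX.prob E \<le> Q" using Q0 by simp
  have "AE \<omega> in M. (\<exists>s\<in>{0..T}. ereal s < e\<^sub>X \<omega> \<and> ereal s < e\<^sub>Y \<omega> \<and> X s \<omega> = Y s \<omega>) \<longrightarrow> \<omega> \<in> E"
    using SX.stopped_eq SY.stopped_eq start AE_space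
  proof eventually_elim
    case (elim \<omega>)
    show ?case
    proof
      assume "\<exists>s\<in>{0..T}. ereal s < e\<^sub>X \<omega> \<and> ereal s < e\<^sub>Y \<omega> \<and> X s \<omega> = Y s \<omega>"
      then obtain s where s: "0 \<le> s" "s \<le> T" "ereal s < e\<^sub>X \<omega>" "ereal s < e\<^sub>Y \<omega>" "X s \<omega> = Y s \<omega>" by auto
      have s0: "0 < s" using s(1,5) elim(3) xy by (cases "s = 0") auto
      let ?\<phi> = "\<lambda>u. f (X u \<omega> - Y u \<omega>)"
      have "continuous_on {0..} ?\<phi>"
        by (rule continuous_on_compose2[OF f_cont]) (auto intro!: continuous_intros SX.X_cont SY.X_cont elim)
      then have "isCont ?\<phi> s" using continuous_on_interior[of "{0..}" ?\<phi> s] s0 by auto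
      then have "(?\<phi> \<longlongrightarrow> ?\<phi> s) (at_left s)" by (auto simp: isCont_def intro: tendsto_within_subset)
      from filterlim_compose[OF this grid_floor_tendsto[OF T]]
      have "(\<lambda>N. ?\<phi> (grid_floor T N s)) \<longlonglongrightarrow> ?\<phi> s" .
      moreover have "a < ?\<phi> s" using s(5) a(2) by (simp add: f_def)
      ultimately have ev: "\<forall>\<^sub>F N in sequentially. a < ?\<phi> (grid_floor T N s)" by (rule order_tendstoD)
      have "\<forall>\<^sub>F N in sequentially. ennreal a \<le> ennreal (Yv N \<omega>)"
        using ev eventually_gt_at_top[of 0]
      proof eventually_elim
        case N: (elim N)
        define j where "j = nat (\<lceil>s * real N / T\<rceil> - 1)"
        have "0 < s * real N / T" using s0 N T by simp
        then have c: "0 \<le> \<lceil>s * real N / T\<rceil> - 1" by (simp add: int_one_le_iff_zero_less)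
        have gf: "grid_floor T N s = grid T N j" using c by (simp add: grid_floor_def grid_def j_def)
        have js: "grid T N j < s" using grid_floor_bounds(1)[OF T N(2), of s] by (simp add: gf)
        have jN: "j < N"
        proof (rule ccontr)
          assume "\<not> j < N"
          then have "grid T N N \<le> grid T N j" using T0 by (intro grid_mono) auto
          then show False using js s(2) N(2) by simp
        qed
        have nj: "\<not> ok N \<omega> j" using N(1) by (simp add: ok_def gf)
        define J where "J = (LEAST j. j = N \<or> \<not> (\<forall>i\<in>{..j}. ok N \<omega> i))"
        have Jj: "J \<le> j" unfolding J_def by (rule Least_le) (use nj in auto)
        have "J = N \<or> \<not> (\<forall>i\<in>{..J}. ok N \<omega> i)" unfolding J_def by (rule LeastI[of _ N]) simp
        then obtain i where i: "i \<le> J" "\<not> ok N \<omega> i" using Jj jN by auto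
        have "i = J"
        proof (rule ccontr)
          assume "i \<noteq> J"
          then have "i < J" using i by simp
          then have "\<not> (i = N \<or> \<not> (\<forall>i'\<in>{..i}. ok N \<omega> i'))" unfolding J_def by (rule not_less_Least)
          then show False using i by auto
        qed
        \<comment> \<open>At index \<open>J\<close> the time is still before \<open>s\<close>, so
          neither path has reached its exit time; failure of \<open>ok\<close> can only mean that
          \<open>f\<close> has reached \<open>a\<close>.\<close>
        have "grid T N J < s" using grid_mono[OF T0 Jj, of N] js by simp
        then have al: "ereal (grid T N J) < e\<^sub>X \<omega>" "ereal (grid T N J) < e\<^sub>Y \<omega>"
          using s by (auto intro: less_trans[of _ "ereal s"])
        then have "a \<le> ?\<phi> (grid T N J)" using i \<open>i = J\<close> by (auto simp: ok_def)
        also have "\<dots> = Yv N \<omega>"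
          unfolding Yv_eq[OF elim(4)] J_def[symmetric] using elim(1,2) al g0 by (simp add: \<eta>_def)
        finally show ?case by (rule ennreal_leI)
      qed
      then have "ennreal a \<le> lm \<omega>" unfolding lm_def by (rule Liminf_bounded)
      then show "\<omega> \<in> E" using elim by (simp add: E_def)
    qed
  qed
  then show ?thesis using E EQ unfolding Q_def by (intro that) auto
qed

end

section \<open>Localisation and conclusion\<close>

theorem theorem1p1:
  fixes M :: "'w measure"
    and W :: "real \<Rightarrow> 'w \<Rightarrow> real ^ 'm"
    and \<sigma> :: "real ^ 'd \<Rightarrow> real ^ 'm ^ 'd"
    and b :: "real ^ 'd \<Rightarrow> real ^ 'd"
    and r r' :: "real \<Rightarrow> real"
    and C \<delta> :: real
    and x\<^sub>0 y\<^sub>0 :: "real ^ 'd"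
    and X Y :: "real \<Rightarrow> 'w \<Rightarrow> real ^ 'd"
    and \<zeta>\<^sub>X \<zeta>\<^sub>Y :: "'w \<Rightarrow> ereal"
  assumes "std_brownian_motion M W"
    and "continuous_on UNIV \<sigma>" and "continuous_on UNIV b"
    and "C > 0" and "0 < \<delta>" and "\<delta> \<le> 1"
    and "\<And>s. s \<in> {0<..\<delta>} \<Longrightarrow> r s > 0"
    and "\<And>s. s \<in> {0<..\<delta>} \<Longrightarrow> (r has_real_derivative r' s) (at s within {0<..\<delta>})"
    and "continuous_on {0<..\<delta>} r'"
    and "filterlim r at_top (at_right 0)"
    and "(\<integral>\<^sup>+ s\<in>{0<..\<delta>}. ennreal (1 / (s * r s)) \<partial>lborel) = \<infinity>"
    and "((\<lambda>s. s * r' s / r s) \<longlongrightarrow> 0) (at_right 0)"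
    and "\<And>x y. x \<noteq> y \<Longrightarrow> norm (x - y) \<le> \<delta> \<Longrightarrow>
           (norm (\<sigma> x - \<sigma> y))\<^sup>2 \<le> C * (norm (x - y))\<^sup>2 * r ((norm (x - y))\<^sup>2)"
    and "\<And>x y. x \<noteq> y \<Longrightarrow> norm (x - y) \<le> \<delta> \<Longrightarrow>
           norm (b x - b y) \<le> C * norm (x - y) * r ((norm (x - y))\<^sup>2)"
    and "no_explosion M W \<sigma> b"
    and "strong_solution M W \<sigma> b x\<^sub>0 X \<zeta>\<^sub>X"
    and "strong_solution M W \<sigma> b y\<^sub>0 Y \<zeta>\<^sub>Y"
    and "x\<^sub>0 \<noteq> y\<^sub>0"
  shows "AE \<omega> in M. \<forall>t>0. X t \<omega> \<noteq> Y t \<omega>"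
proof -
  note \<sigma>_cont = assms(2) and b_cont = assms(3) and C = assms(4) and \<delta> = assms(5,6) and \<sigma>_mod = assms(13) and b_mod = assms(14)
  have "prob_space M" using assms(1) by (simp add: std_brownian_motion_def)
  then interpret prob_space M .
  interpret brownian M W by unfold_locales (rule assms(1))
  have lifeX: "AE \<omega> in M. \<zeta>\<^sub>X \<omega> = \<infinity>" using assms(15,16) unfolding no_explosion_def by blast
  have lifeY: "AE \<omega> in M. \<zeta>\<^sub>Y \<omega> = \<infinity>" using assms(15,17) unfolding no_explosion_def by blast
  define u\<^sub>0 where "u\<^sub>0 = (norm (x\<^sub>0 - y\<^sub>0))\<^sup>2"
  have u0: "0 < u\<^sub>0" using assms(18) by (simp add: u\<^sub>0_def)
  obtain c where c: "0 < c" "c \<le> \<delta>\<^sup>2"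
    and tests: "\<forall>u\<^sub>0>0. \<exists>B. \<forall>L. \<exists>g g1 g2. test_function r c g g1 g2 \<and> L \<le> g 0 \<and> g u\<^sub>0 \<le> B"
    by (rule test_functions[OF assms(5-9,11,12)]) (assumption | erule (2) that)+
  obtain B where B: "\<And>L. \<exists>g g1 g2. test_function r c g g1 g2 \<and> L \<le> g 0 \<and> g u\<^sub>0 \<le> B"
    using tests u0 by blast
  \<comment> \<open>Meetings up to time \<open>T\<close> while both paths are inside the ball of
    radius \<open>n\<close>, where the coefficients are bounded. Countably many \<open>n\<close> and
    \<open>T\<close> exhaust all meetings.\<close>
  have local: "AE \<omega> in M. \<forall>s\<in>{0..T}. (\<forall>u\<in>{0..s}. norm (X u \<omega>) < real n \<and> norm (Y u \<omega>) < real n) \<longrightarrow> X s \<omega> \<noteq> Y s \<omega>"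
    if n: "norm x\<^sub>0 < real n" "norm y\<^sub>0 < real n" and T: "0 < T" for n :: nat and T :: real
  proof -
    have "compact (\<sigma> ` cball 0 (real n))" "compact (b ` cball 0 (real n))"
      using \<sigma>_cont b_cont by (auto intro!: compact_continuous_image intro: continuous_on_subset)
    then obtain K1 K2 where K12: "\<forall>x\<in>cball 0 (real n). norm (\<sigma> x) \<le> K1" "\<forall>x\<in>cball 0 (real n). norm (b x) \<le> K2"
      by (auto dest!: compact_imp_bounded simp: bounded_iff)
    define K where "K = max 0 (max K1 K2)"
    have K: "0 \<le> K" "\<And>x. norm x \<le> real n \<Longrightarrow> norm (\<sigma> x) \<le> K" "\<And>x. norm x \<le> real n \<Longrightarrow> norm (b x) \<le> K"
      using K12 by (auto simp: K_def le_max_iff_disj)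
    obtain X' e\<^sub>X H\<^sub>X I\<^sub>X where SX: "stopped_ito M W \<sigma> b X' e\<^sub>X H\<^sub>X I\<^sub>X x\<^sub>0 (real n) K"
      and X': "AE \<omega> in M. X' 0 \<omega> = x\<^sub>0 \<and> 0 < e\<^sub>X \<omega> \<and> continuous_on {0..} (\<lambda>t. X t \<omega>) \<and> (\<forall>t. X' t \<omega> = X t \<omega>) \<and>
        (\<forall>t\<ge>0. (\<forall>s\<in>{0..t}. norm (X s \<omega>) < real n) \<longrightarrow> ereal t < e\<^sub>X \<omega>)"
      by (rule stopped_ito_of_strong_solution[OF assms(16) lifeX \<sigma>_cont b_cont n(1) K]) (assumption | erule (1) that)+
    obtain Y' e\<^sub>Y H\<^sub>Y I\<^sub>Y where SY: "stopped_ito M W \<sigma> b Y' e\<^sub>Y H\<^sub>Y I\<^sub>Y y\<^sub>0 (real n) K"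
      and Y': "AE \<omega> in M. Y' 0 \<omega> = y\<^sub>0 \<and> 0 < e\<^sub>Y \<omega> \<and> continuous_on {0..} (\<lambda>t. Y t \<omega>) \<and> (\<forall>t. Y' t \<omega> = Y t \<omega>) \<and>
        (\<forall>t\<ge>0. (\<forall>s\<in>{0..t}. norm (Y s \<omega>) < real n) \<longrightarrow> ereal t < e\<^sub>Y \<omega>)"
      by (rule stopped_ito_of_strong_solution[OF assms(17) lifeY \<sigma>_cont b_cont n(2) K]) (assumption | erule (1) that)+
    \<comment> \<open>Independent of \<open>k\<close>: \<open>B\<close> and \<open>K\<close> are
      fixed before the test function is chosen, and \<open>10 * C\<close> bounds the drift for all
      of them.\<close>
    define Q where "Q = B + T * (10 * C + 4 * K\<^sup>2)"
    define bad where "bad E \<longleftrightarrow> (AE \<omega> in M. (\<exists>s\<in>{0..T}. ereal s < e\<^sub>X \<omega> \<and> ereal s < e\<^sub>Y \<omega> \<and> X' s \<omega> = Y' s \<omega>) \<longrightarrow> \<omega> \<in> E)" for E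
    have "\<exists>E. E \<in> sets M \<and> bad E \<and> real (Suc k) * prob E \<le> Q" for k
    proof -
      \<comment> \<open>One more than \<open>Suc k\<close>, so that the level \<open>Suc k\<close>
        lies strictly below \<open>g 0\<close>.\<close>
      obtain g g1 g2 where test: "test_function r c g g1 g2" and g0: "real (Suc (Suc k)) \<le> g 0" "g u\<^sub>0 \<le> B"
        using B[of "real (Suc (Suc k))"] by blast
      have g: "\<And>u. 0 \<le> u \<Longrightarrow> (g has_real_derivative g1 u) (at u)" "\<And>u. 0 \<le> u \<Longrightarrow> (g1 has_real_derivative g2 u) (at u)"
        "continuous_on {0..} g2" "\<And>u. c \<le> u \<Longrightarrow> g1 u = 0" "\<And>u. c \<le> u \<Longrightarrow> g2 u = 0" "\<And>u. 0 \<le> u \<Longrightarrow> g1 u \<le> 0" "\<And>u. 0 \<le> u \<Longrightarrow> 0 \<le> g u"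
        and g_drift: "\<And>u. 0 < u \<Longrightarrow> u < c \<Longrightarrow> - g1 u * (u * r u) \<le> 1" "\<And>u. 0 < u \<Longrightarrow> u < c \<Longrightarrow> g2 u * (u\<^sup>2 * r u) \<le> 4"
        using test unfolding test_function_def by simp_all
      have rad: "radial g g1 g2 c" by unfold_locales (use g in auto)
      have g_anti: "g u \<le> g 0" if "0 \<le> u" for u
        by (rule DERIV_nonpos_imp_nonincreasing[OF that]) (use g(1,6) in blast)
      \<comment> \<open>\<open>10 * C\<close> is \<open>2 * C\<close> from the gradient plus
        \<open>2 * (4 * C)\<close> from \<open>g2\<close>; the last term is nonpositive because
        \<open>g1\<close> is.\<close>
      have drift: "radial.Df g1 (x - y) \<bullet> (b x - b y) + 2 * g2 ((norm (x - y))\<^sup>2) * (norm ((x - y) v* (\<sigma> x - \<sigma> y)))\<^sup>2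
        + g1 ((norm (x - y))\<^sup>2) * (norm (\<sigma> x - \<sigma> y))\<^sup>2 \<le> 10 * C" for x y :: "real ^ 'd"
      proof -
        let ?z = "x - y"
        define u where "u = (norm ?z)\<^sup>2"
        have u: "0 \<le> u" by (simp add: u_def)
        have Df: "radial.Df g1 ?z = (2 * g1 u) *\<^sub>R ?z" by (simp add: radial.Df_def[OF rad] u_def)
        consider "u = 0" | "c \<le> u" | "0 < u" "u < c" using u by linarith
        then show ?thesis
        proof cases
          case 1
          then have "x = y" by (simp add: u_def)
          then show ?thesis using C unfolding Df by simp
        next
          case 2
          then show ?thesis using g(4,5)[OF 2] C unfolding Df u_def[symmetric] by simp
        next
          case 3
          have xy: "x \<noteq> y" using 3(1) by (auto simp: u_def)
          have nz: "norm ?z \<le> \<delta>"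
          proof (rule power2_le_imp_le)
            show "(norm ?z)\<^sup>2 \<le> \<delta>\<^sup>2" using 3(2) c(2) unfolding u_def by linarith
          qed (use \<delta>(1) in simp)
          have g1u: "0 \<le> - g1 u" using g(6)[OF u] by simp
          have "- (?z \<bullet> (b x - b y)) \<le> norm ?z * norm (b x - b y)" using Cauchy_Schwarz_ineq2[of ?z "b x - b y"] by linarith
          also have "\<dots> \<le> norm ?z * (C * norm ?z * r u)" using b_mod[OF xy nz] by (intro mult_left_mono) (auto simp: u_def)
          also have "\<dots> = C * (u * r u)" by (simp add: u_def power2_eq_square)
          finally have "- g1 u * - (?z \<bullet> (b x - b y)) \<le> - g1 u * (C * (u * r u))" by (intro mult_left_mono g1u)
          also have "\<dots> = C * (- g1 u * (u * r u))" by simp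
          also have "\<dots> \<le> C * 1" using g_drift(1)[OF 3] C by (intro mult_left_mono) auto
          finally have 1: "(2 * g1 u) * (?z \<bullet> (b x - b y)) \<le> 2 * C" by simp
          have \<sigma>u: "(norm (\<sigma> x - \<sigma> y))\<^sup>2 \<le> C * u * r u" using \<sigma>_mod[OF xy nz] by (simp add: u_def)
          have "g2 u * (norm (?z v* (\<sigma> x - \<sigma> y)))\<^sup>2 \<le> 4 * C"
          \<comment> \<open>\<open>g2\<close> is bounded from above only; where it is negative the
            term has the favourable sign.\<close>
          proof (cases "0 \<le> g2 u")
            case True
            have "(norm (?z v* (\<sigma> x - \<sigma> y)))\<^sup>2 \<le> (norm ?z * norm (\<sigma> x - \<sigma> y))\<^sup>2"
              by (intro power_mono norm_vector_matrix_mult_le) auto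
            also have "\<dots> = u * (norm (\<sigma> x - \<sigma> y))\<^sup>2" by (simp add: u_def power_mult_distrib)
            also have "\<dots> \<le> u * (C * u * r u)" using \<sigma>u u by (rule mult_left_mono)
            finally have "g2 u * (norm (?z v* (\<sigma> x - \<sigma> y)))\<^sup>2 \<le> g2 u * (u * (C * u * r u))" using True by (rule mult_left_mono)
            also have "\<dots> = C * (g2 u * (u\<^sup>2 * r u))" by (simp add: power2_eq_square)
            also have "\<dots> \<le> C * 4" using g_drift(2)[OF 3] C by (intro mult_left_mono) auto
            finally show ?thesis by simp
          next
            case False
            then have "g2 u * (norm (?z v* (\<sigma> x - \<sigma> y)))\<^sup>2 \<le> 0" by (intro mult_nonpos_nonneg) auto
            then show ?thesis using C by simp
          qed
          moreover have "g1 u * (norm (\<sigma> x - \<sigma> y))\<^sup>2 \<le> 0" using g(6)[OF u] by (intro mult_nonpos_nonneg) auto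
          ultimately show ?thesis using 1 unfolding Df u_def[symmetric] by simp
        qed
      qed
      have st: "AE \<omega> in M. X' 0 \<omega> = x\<^sub>0 \<and> Y' 0 \<omega> = y\<^sub>0 \<and> 0 < e\<^sub>X \<omega> \<and> 0 < e\<^sub>Y \<omega>"
        using X' Y' by eventually_elim auto
      interpret coupled M W \<sigma> b X' e\<^sub>X H\<^sub>X I\<^sub>X x\<^sub>0 Y' e\<^sub>Y H\<^sub>Y I\<^sub>Y y\<^sub>0 "real n" K g g1 g2 c "10 * C"
      proof (intro coupled.intro SX SY rad coupled_axioms.intro)
        show "0 \<le> 10 * C" using C by simp
      qed (rule g(7) g_anti drift st | assumption)+
      have "real (Suc k) < g 0" using g0(1) by simp
      from coincidence_bound[OF T _ this assms(18)] obtain E where E: "E \<in> sets M"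
        "AE \<omega> in M. (\<exists>s\<in>{0..T}. ereal s < e\<^sub>X \<omega> \<and> ereal s < e\<^sub>Y \<omega> \<and> X' s \<omega> = Y' s \<omega>) \<longrightarrow> \<omega> \<in> E"
        "real (Suc k) * prob E \<le> g u\<^sub>0 + T * (10 * C + 4 * K\<^sup>2)"
        unfolding u\<^sub>0_def by auto
      then have "bad E" "real (Suc k) * prob E \<le> Q" using g0(2) unfolding bad_def Q_def by linarith+
      then show ?thesis using E(1) by blast
    qed
    then have "\<forall>k. \<exists>E. E \<in> sets M \<and> bad E \<and> real (Suc k) * prob E \<le> Q" ..
    from choice[OF this] obtain E where "\<forall>k. E k \<in> sets M \<and> bad (E k) \<and> real (Suc k) * prob (E k) \<le> Q" ..
    then have E: "\<And>k. E k \<in> sets M" "\<And>k. bad (E k)" "\<And>k. real (Suc k) * prob (E k) \<le> Q" by simp_all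
    \<comment> \<open>Each \<open>E k\<close> almost surely contains the meetings and has
      probability at most \<open>Q / (k + 1)\<close>, so the meetings lie in a null
      intersection.\<close>
    have Em: "(\<Inter>k. E k) \<in> sets M" using E(1) by auto
    have "prob (\<Inter>k. E k) \<le> Q / real (Suc k)" for k
    proof -
      have "prob (\<Inter>k. E k) \<le> prob (E k)" using E(1) by (intro finite_measure_mono) auto
      also have "\<dots> \<le> Q / real (Suc k)" using E(3)[of k] by (simp add: field_simps)
      finally show ?thesis .
    qed
    then have "prob (\<Inter>k. E k) \<le> 0"
      by (intro LIMSEQ_le_const[OF LIMSEQ_Suc[OF lim_const_over_n[of Q]]]) auto
    then have "(\<Inter>k. E k) \<in> null_sets M"
      using Em by (intro null_setsI) (auto simp: emeasure_eq_measure measure_le_0_iff)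
    then have "AE \<omega> in M. \<omega> \<notin> (\<Inter>k. E k)" by (rule AE_not_in)
    moreover have "AE \<omega> in M. \<forall>k. (\<exists>s\<in>{0..T}. ereal s < e\<^sub>X \<omega> \<and> ereal s < e\<^sub>Y \<omega> \<and> X' s \<omega> = Y' s \<omega>) \<longrightarrow> \<omega> \<in> E k"
      unfolding AE_all_countable using E(2) unfolding bad_def by (rule allI)
    ultimately show ?thesis
      using X' Y'
    proof eventually_elim
      case (elim \<omega>)
      then have "\<not> (\<exists>s\<in>{0..T}. ereal s < e\<^sub>X \<omega> \<and> ereal s < e\<^sub>Y \<omega> \<and> X' s \<omega> = Y' s \<omega>)" by blast
      then show ?case using elim(3,4) by auto
    qed
  qed
  obtain n\<^sub>0 :: nat where n0: "max (norm x\<^sub>0) (norm y\<^sub>0) < real n\<^sub>0" using reals_Archimedean2 by blast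
  \<comment> \<open>The offset \<open>n\<^sub>0\<close> keeps both starting points inside every
    ball, and \<open>Suc k\<close> keeps the time horizon positive.\<close>
  have "AE \<omega> in M. \<forall>n k. \<forall>s\<in>{0..real (Suc k)}. (\<forall>u\<in>{0..s}. norm (X u \<omega>) < real (n\<^sub>0 + n) \<and> norm (Y u \<omega>) < real (n\<^sub>0 + n)) \<longrightarrow> X s \<omega> \<noteq> Y s \<omega>"
    unfolding AE_all_countable using n0 by (intro allI local) auto
  then show ?thesis
    using strong_solution_continuous[OF assms(16) lifeX] strong_solution_continuous[OF assms(17) lifeY]
  proof eventually_elim
    case (elim \<omega>)
    show ?case
    proof (intro allI impI)
      fix t :: real assume t: "0 < t"
      \<comment> \<open>On \<open>[0, t]\<close> the continuous paths stay in some ball, so a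
        meeting at \<open>t\<close> would fall under one of the countably many cases.\<close>
      have "bounded ((\<lambda>t. X t \<omega>) ` {0..t})" "bounded ((\<lambda>t. Y t \<omega>) ` {0..t})"
        by (intro compact_imp_bounded compact_continuous_image continuous_on_subset[OF conjunct2[OF elim(2)]] continuous_on_subset[OF conjunct2[OF elim(3)]]; force)+
      then obtain b1 b2 where b12: "\<forall>u\<in>{0..t}. norm (X u \<omega>) \<le> b1" "\<forall>u\<in>{0..t}. norm (Y u \<omega>) \<le> b2"
        by (auto simp: bounded_iff)
      obtain n :: nat where "max b1 b2 < real n" using reals_Archimedean2 by blast
      then have n: "\<forall>u\<in>{0..t}. norm (X u \<omega>) < real (n\<^sub>0 + n) \<and> norm (Y u \<omega>) < real (n\<^sub>0 + n)" using b12 by force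
      obtain k :: nat where "t < real k" using reals_Archimedean2 by blast
      then have "t \<in> {0..real (Suc k)}" using t by simp
      then show "X t \<omega> \<noteq> Y t \<omega>" using elim(1) n by blast
    qed
  qed
qed

end
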